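(* Let $\psi$ satisfy the integrability condition (I) of the context for $p=1$ (hence for every index in $[1,\infty]$), and let $\boldsymbol\gamma=(\gamma_{\mathfrak u})_{\mathfrak u\subseteq[1:d]}$ be a family of non-negative weights, not all zero, such that $\gamma_{\mathfrak w}>0$ implies $\gamma_{\mathfrak u}>0$ for all $\mathfrak u\subseteq\mathfrak w$. Let $p,q,p_0,q_0,p_1,q_1\in[1,\infty]$ and $\theta\in[0,1]$ be such that $$\frac1p=\frac{1-\theta}{p_0}+\frac{\theta}{p_1}\quad\text{and}\quad\frac1q=\frac{1-\theta}{q_0}+\frac{\theta}{q_1}$$ (with $1/\infty=0$). Then $$\|\imath_{p,q,\psi,\boldsymbol\gamma}\|\le\|\imath_{p_0,q_0,\psi,\boldsymbol\gamma}\|^{1-\theta}\,\|\imath_{p_1,q_1,\psi,\boldsymbol\gamma}\|^{\theta}.$$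
   Context: Setting. $D$ is an interval, either $D=[0,T)$ with $T\in(0,\infty]$ or $D=[0,T]$ with $T\in(0,\infty)$; $\psi:D\to[0,\infty)$ is a probability density function (with respect to Lebesgue measure) that is positive almost everywhere. $d$ is a positive integer, $[1:d]=\{1,\dots,d\}$, and $\mathfrak u,\mathfrak w$ denote subsets of $[1:d]$. For $\mathfrak u\neq\emptyset$, $D^{\mathfrak u}$ is the set of points $\boldsymbol x_{\mathfrak u}=(x_j)_{j\in\mathfrak u}$ with $x_j\in D$; functions on $D^{\mathfrak u}$ are identified with functions on $D^d$ depending only on the variables with indices in $\mathfrak u$. All functions are complex-valued (complex scalars). For $1\le p\le\infty$, $p'$ is the conjugate index, $1/p+1/p'=1$. $L_{p,\psi}(D^{\mathfrak u})$ is the Banach space of (classes of) functions with norm $\|g\|_{L_{p,\psi}(D^{\mathfrak u})}=\left(\int_{D^{\mathfrak u}}|g(\boldsymbol t_{\mathfrak u})|^p\prod_{j\in\mathfrak u}\psi(t_j)\,d\boldsymbol t_{\mathfrak u}\right)^{1/p}$ for $p<\infty$ and the essential supremum norm for $p=\infty$. $L_p^{\mathrm{loc}}(D)$ is the set of functions on $D$ whose restriction to $[0,x)$ is in $L_p([0,x))$ for all $x\in D$. Put $\overline\psi(t)=\int_t^T\psi(y)\,dy$. Integrability condition (I) for $p$ and $\psi$: either $p=\infty$ and $\overline\psi\in L_1(D)$; or $p<\infty$, $\psi^{-1/p}\in L_{p'}^{\mathrm{loc}}(D)$ and $\overline\psi\cdot\psi^{-1/p}\in L_{p'}(D)$. If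 (I) holds for $p=1$ then it holds for all $p\in[1,\infty]$. Kernels: $K_\pitchfork(x,t)=1_{[0,x)}(t)$, $K_A(x,t)=1_{[0,x)}(t)-\overline\psi(t)$ for $x,t\in D$, and $K_{\star,\mathfrak u}(\boldsymbol x_{\mathfrak u},\boldsymbol t_{\mathfrak u})=\prod_{j\in\mathfrak u}K_\star(x_j,t_j)$ for $\star\in\{\pitchfork,A\}$. For $\mathfrak u\ne\emptyset$ and $g_{\mathfrak u}\in L_{p,\psi}(D^{\mathfrak u})$ put $T_{\star,\mathfrak u}(g_{\mathfrak u})=\int_{D^{\mathfrak u}}g_{\mathfrak u}(\boldsymbol t_{\mathfrak u})K_{\star,\mathfrak u}(\cdot_{\mathfrak u},\boldsymbol t_{\mathfrak u})\,d\boldsymbol t_{\mathfrak u}$. For $\mathfrak u=\emptyset$, $L_{p,\psi}(D^\emptyset)$ is the scalar field with norm $|\cdot|$ and $T_{\star,\emptyset}(c)$ is the constant function $c$. Let $F_{\star,p,\psi,\mathfrak u}=T_{\star,\mathfrak u}(L_{p,\psi}(D^{\mathfrak u}))$; the maps $T_{\star,\mathfrak u}$ are one-to-one, and $\|T_{\star,\mathfrak u}(g)\|_{F_{\star,p,\psi,\mathfrak u}}:=\|g\|_{L_{p,\psi}(D^{\mathfrak u})}$. The sum of the spaces $F_{\star,p,\psi,\mathfrak u}$ over $\mathfrak u\subseteq[1:d]$ (inside the continuous functions on $D^d$) is direct. For weights $\boldsymbol\gamma$ let $\mathfrak U_{\boldsymbol\gamma}=\{\mathfrak u\subseteq[1:d]:\gamma_{\mathfrak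 u}>0\}$, assumed non-empty. For $\star\in\{\pitchfork,A\}$ and $1\le q\le\infty$, $W_{\star,p,q,\psi,\boldsymbol\gamma}=\bigoplus_{\mathfrak u\in\mathfrak U_{\boldsymbol\gamma}}F_{\star,p,\psi,\mathfrak u}$, a space of functions $f=\sum_{\mathfrak u\in\mathfrak U_{\boldsymbol\gamma}}T_{\star,\mathfrak u}(g_{\star,\mathfrak u})$ on $D^d$, with norm $\|f\|_{W_{\star,p,q,\psi,\boldsymbol\gamma}}=\left(\sum_{\mathfrak u\in\mathfrak U_{\boldsymbol\gamma}}(\|g_{\star,\mathfrak u}\|_{L_{p,\psi}(D^{\mathfrak u})}/\gamma_{\mathfrak u})^q\right)^{1/q}$ for $q<\infty$ and the maximum over $\mathfrak u\in\mathfrak U_{\boldsymbol\gamma}$ for $q=\infty$. ($\star=\pitchfork$: anchored space; $\star=A$: ANOVA space.) Under the assumption on $\boldsymbol\gamma$ in the claim the two spaces coincide as vector spaces of functions; $\imath_{p,q,\psi,\boldsymbol\gamma}$ is the identity map from $W_{A,p,q,\psi,\boldsymbol\gamma}$ to $W_{\pitchfork,p,q,\psi,\boldsymbol\gamma}$, and its norm is the operator norm. *)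

theory Defs
  imports "HOL-Analysis.Analysis" "HOL-Probability.Essential_Supremum"
begin

section \<open>Lebesgue spaces with exponents in \<open>[1, \<infinity>]\<close>\<close>

text \<open>
  Exponents are extended non-negative reals, so that \<open>1 / \<infinity> = 0\<close>. Classes of functions are
  handled through their representatives: the norm depends on the class only.
\<close>

definition conjugate_index :: "ennreal \<Rightarrow> ennreal" where
  "conjugate_index p = inverse (1 - inverse p)"

lemma conjugate_index:
  assumes "1 \<le> p"
  shows "1 / p + 1 / conjugate_index p = 1"
proof -
  have le: "inverse p \<le> 1"
  proof (cases p)
    case (real r)
    with assms have "1 \<le> r" by simp
    then have "inverse r \<le> 1" by (simp add: field_simps)
    with real \<open>1 \<le> r\<close> show ?thesis by (simp add: inverse_ennreal)
  qed simp
  have "inverse (inverse x) = x" for x :: ennreal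
  proof (cases x)
    case (real r)
    then show ?thesis by (cases "r = 0") (auto simp: inverse_ennreal)
  qed simp
  with le show ?thesis
    by (simp add: conjugate_index_def divide_ennreal_def add_diff_self_ennreal)
qed

definition Lp_space :: "'a measure \<Rightarrow> ennreal \<Rightarrow> ('a \<Rightarrow> 'b::{real_normed_vector,second_countable_topology}) set" where
  "Lp_space M p = {f \<in> borel_measurable M.
     if p = top then esssup M (\<lambda>t. ennreal (norm (f t))) < top
     else integrable M (\<lambda>t. norm (f t) powr enn2real p)}"

definition Lp_norm :: "'a measure \<Rightarrow> ennreal \<Rightarrow> ('a \<Rightarrow> 'b::{real_normed_vector,second_countable_topology}) \<Rightarrow> real" where
  "Lp_norm M p f =
     (if p = top then enn2real (esssup M (\<lambda>t. ennreal (norm (f t))))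
      else (LINT t|M. norm (f t) powr enn2real p) powr (1 / enn2real p))"

definition Lp_loc :: "real set \<Rightarrow> ennreal \<Rightarrow> (real \<Rightarrow> 'b::{real_normed_vector,second_countable_topology}) set" where
  "Lp_loc D p = {f. \<forall>x\<in>D. f \<in> Lp_space (lebesgue_on {0..<x}) p}"

section \<open>The domain, the density and the integrability condition\<close>

definition admissible_domain :: "real set \<Rightarrow> bool" where
  "admissible_domain D \<longleftrightarrow> D = {0..} \<or> (\<exists>T>0. D = {0..<T} \<or> D = {0..T})"

definition positive_density :: "real set \<Rightarrow> (real \<Rightarrow> real) \<Rightarrow> bool" where
  "positive_density D \<psi> \<longleftrightarrow>
     \<psi> \<in> borel_measurable (lebesgue_on D) \<and> (\<forall>t\<in>D. 0 \<le> \<psi> t) \<and>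
     (\<integral>\<^sup>+t. ennreal (\<psi> t) \<partial>lebesgue_on D) = 1 \<and>
     (AE t in lebesgue_on D. 0 < \<psi> t)"

definition psi_bar :: "real set \<Rightarrow> (real \<Rightarrow> real) \<Rightarrow> real \<Rightarrow> real" where
  "psi_bar D \<psi> t = (LINT y|lebesgue_on (D \<inter> {t..}). \<psi> y)"

definition integrability_condition :: "real set \<Rightarrow> (real \<Rightarrow> real) \<Rightarrow> ennreal \<Rightarrow> bool" where
  "integrability_condition D \<psi> p \<longleftrightarrow>
     (p = top \<and> psi_bar D \<psi> \<in> Lp_space (lebesgue_on D) 1) \<or>
     (p < top \<and>
      (\<lambda>t. \<psi> t powr (- 1 / enn2real p)) \<in> Lp_loc D (conjugate_index p) \<and>
      (\<lambda>t. psi_bar D \<psi> t * \<psi> t powr (- 1 / enn2real p)) \<in> Lp_space (lebesgue_on D) (conjugate_index p))"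

section \<open>Anchored and ANOVA spaces\<close>

text \<open>
  A point of \<open>D\<^sup>u\<close> is an extensional function on \<open>u\<close>. For \<open>u = {}\<close> the product measure is the unit
  mass at the single point \<^term>\<open>\<lambda>_. undefined\<close>, so that the space below is the scalar field and the
  operator \<open>T_op\<close> below yields constant functions.

  The factors carry the Lebesgue sigma-algebra. The product is not completed, which does not
  change the spaces of classes.
\<close>

definition product_lebesgue :: "real set \<Rightarrow> nat set \<Rightarrow> (nat \<Rightarrow> real) measure" where
  "product_lebesgue D u = PiM u (\<lambda>_. lebesgue_on D)"

text \<open>
  For \<open>p = \<infinity>\<close> the weighted measure gives the unweighted essential supremum, as the density is
  positive almost everywhere.
\<close>

definition weighted_measure :: "real set \<Rightarrow> (real \<Rightarrow> real) \<Rightarrow> nat set \<Rightarrow> (nat \<Rightarrow> real) measure" where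
  "weighted_measure D \<psi> u = density (product_lebesgue D u) (\<lambda>t. ennreal (\<Prod>j\<in>u. \<psi> (t j)))"

datatype decomposition = Anchored | Anova

fun kernel :: "real set \<Rightarrow> (real \<Rightarrow> real) \<Rightarrow> decomposition \<Rightarrow> real \<Rightarrow> real \<Rightarrow> real" where
  "kernel D \<psi> Anchored x t = indicator {0..<x} t"
| "kernel D \<psi> Anova x t = indicator {0..<x} t - psi_bar D \<psi> t"

definition T_op :: "real set \<Rightarrow> (real \<Rightarrow> real) \<Rightarrow> decomposition \<Rightarrow> nat set \<Rightarrow>
    ((nat \<Rightarrow> real) \<Rightarrow> complex) \<Rightarrow> (nat \<Rightarrow> real) \<Rightarrow> complex" where
  "T_op D \<psi> s u g x =
     (LINT t|product_lebesgue D u. g t * complex_of_real (\<Prod>j\<in>u. kernel D \<psi> s (x j) (t j)))"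

lemma weighted_measure_empty: "weighted_measure D \<psi> {} = product_lebesgue D {}"
  by (simp add: weighted_measure_def density_1)

lemma esssup_product_lebesgue_empty:
  "esssup (product_lebesgue D {}) (\<lambda>t. ennreal (h t)) = ennreal (h (\<lambda>_. undefined))"
  by (simp add: product_lebesgue_def PiM_empty esssup_eq_AE AE_count_space
      flip: atLeast_def)

lemma Lp_space_empty: "Lp_space (weighted_measure D \<psi> {}) p = UNIV"
  unfolding weighted_measure_empty
  by (auto simp: Lp_space_def esssup_product_lebesgue_empty)
     (auto simp: product_lebesgue_def PiM_empty integrable_count_space)

lemma Lp_norm_empty:
  assumes "1 \<le> p"
  shows "Lp_norm (weighted_measure D \<psi> {}) p g = norm (g (\<lambda>_. undefined))"
proof (cases p)
  case (real r)
  with assms have "1 \<le> r" by simp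
  with real show ?thesis
    by (simp add: Lp_norm_def weighted_measure_empty product_lebesgue_def PiM_empty
        lebesgue_integral_count_space_finite powr_powr)
next
  case top
  then show ?thesis
    by (simp add: Lp_norm_def weighted_measure_empty esssup_product_lebesgue_empty)
qed

lemma T_op_empty: "T_op D \<psi> s {} g x = g (\<lambda>_. undefined)"
  by (simp add: T_op_def product_lebesgue_def PiM_empty lebesgue_integral_count_space_finite)

definition active_sets :: "nat \<Rightarrow> (nat set \<Rightarrow> real) \<Rightarrow> nat set set" where
  "active_sets d \<gamma> = {u. u \<subseteq> {1..d} \<and> 0 < \<gamma> u}"

definition coefficients :: "real set \<Rightarrow> (real \<Rightarrow> real) \<Rightarrow> nat \<Rightarrow> (nat set \<Rightarrow> real) \<Rightarrow> ennreal \<Rightarrow>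
    (nat set \<Rightarrow> (nat \<Rightarrow> real) \<Rightarrow> complex) set" where
  "coefficients D \<psi> d \<gamma> p = {g. \<forall>u\<in>active_sets d \<gamma>. g u \<in> Lp_space (weighted_measure D \<psi> u) p}"

definition synthesis :: "real set \<Rightarrow> (real \<Rightarrow> real) \<Rightarrow> nat \<Rightarrow> (nat set \<Rightarrow> real) \<Rightarrow> decomposition \<Rightarrow>
    (nat set \<Rightarrow> (nat \<Rightarrow> real) \<Rightarrow> complex) \<Rightarrow> (nat \<Rightarrow> real) \<Rightarrow> complex" where
  "synthesis D \<psi> d \<gamma> s g = (\<lambda>x \<in> {1..d} \<rightarrow>\<^sub>E D. \<Sum>u\<in>active_sets d \<gamma>. T_op D \<psi> s u (g u) x)"

definition W_space :: "real set \<Rightarrow> (real \<Rightarrow> real) \<Rightarrow> nat \<Rightarrow> (nat set \<Rightarrow> real) \<Rightarrow> decomposition \<Rightarrow> ennreal \<Rightarrow>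
    ((nat \<Rightarrow> real) \<Rightarrow> complex) set" where
  "W_space D \<psi> d \<gamma> s p = synthesis D \<psi> d \<gamma> s ` coefficients D \<psi> d \<gamma> p"

definition coefficient_norm :: "real set \<Rightarrow> (real \<Rightarrow> real) \<Rightarrow> nat \<Rightarrow> (nat set \<Rightarrow> real) \<Rightarrow> ennreal \<Rightarrow> ennreal \<Rightarrow>
    (nat set \<Rightarrow> (nat \<Rightarrow> real) \<Rightarrow> complex) \<Rightarrow> real" where
  "coefficient_norm D \<psi> d \<gamma> p q g =
     (let a = (\<lambda>u. Lp_norm (weighted_measure D \<psi> u) p (g u) / \<gamma> u)
      in if q = top then Max (a ` active_sets d \<gamma>)
         else (\<Sum>u\<in>active_sets d \<gamma>. a u powr enn2real q) powr (1 / enn2real q))"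

text \<open>
  The coefficient functions of \<open>f\<close> are unique up to null sets, because the operators \<open>T_op\<close> are
  one-to-one and the sum of their ranges is direct. Hence their norm is uniquely determined.
\<close>

definition W_norm :: "real set \<Rightarrow> (real \<Rightarrow> real) \<Rightarrow> nat \<Rightarrow> (nat set \<Rightarrow> real) \<Rightarrow> decomposition \<Rightarrow> ennreal \<Rightarrow> ennreal \<Rightarrow>
    ((nat \<Rightarrow> real) \<Rightarrow> complex) \<Rightarrow> real" where
  "W_norm D \<psi> d \<gamma> s p q f =
     (THE r. \<exists>g \<in> coefficients D \<psi> d \<gamma> p.
        f = synthesis D \<psi> d \<gamma> s g \<and> r = coefficient_norm D \<psi> d \<gamma> p q g)"

text \<open>
  The operator norm of the identity map from the ANOVA space to the anchored space, in the form
  of \<^const>\<open>onorm\<close>; the zero function contributes \<open>0 / 0 = 0\<close>.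
\<close>

definition embedding_norm :: "real set \<Rightarrow> (real \<Rightarrow> real) \<Rightarrow> nat \<Rightarrow> (nat set \<Rightarrow> real) \<Rightarrow> ennreal \<Rightarrow> ennreal \<Rightarrow> real" where
  "embedding_norm D \<psi> d \<gamma> p q =
     (SUP f \<in> W_space D \<psi> d \<gamma> Anova p. W_norm D \<psi> d \<gamma> Anchored p q f / W_norm D \<psi> d \<gamma> Anova p q f)"

end

theory Submission
  imports Defs "HOL-Complex_Analysis.Complex_Analysis" "HOL-Probability.Infinite_Product_Measure"
begin

text \<open>
  Write \<open>\<Psi>\<close> for \<^const>\<open>psi_bar\<close>. Since \<open>K\<^sub>A(x, t) = K\<^sub>\<pitchfork>(x, t) - \<Psi>(t)\<close>, expanding the product kernels and Fubini's theorem
  show that the embedding acts on the coefficient functions by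
  \<open>h\<^sub>v = \<Sum>\<^bsub>u \<supseteq> v\<^esub> (-1)\<^bsup>|u - v|\<^esup> \<integral> g\<^sub>u \<Prod>\<^bsub>j \<in> u - v\<^esub> \<Psi>(t\<^sub>j) dt\<close>. This operator does not depend on the
  exponents, and it is bounded because \<open>\<Psi> / \<psi>\<close> is bounded by the integrability condition. The
  theorem is therefore the Riesz-Thorin theorem for this operator on spaces with the mixed norm
  \<open>\<ell>\<^sub>q(L\<^sub>p)\<close>. As the norms in question are defined through the coefficient functions, one also needs
  that these are unique: the anchored ones by letting variables vanish one after the other, the
  ANOVA ones because the above operator is triangular.
\<close>

section \<open>Lebesgue spaces and reciprocal exponents\<close>

text \<open>The weighted measure is a product of probability measures, so all spaces lie in L_1: one
  operator on L_1 families serves every exponent, and the two endpoint bounds concern the same map.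
  Its partial integrals exist only for almost every value of the remaining variables, so linearity
  holds only up to null sets. The analytic families must be finite sums in order to be entire, which
  forces functions of finite range on both sides of the duality. The image of such a function need
  not have finite range, so it is rounded before a dual function is chosen. The limit then requires
  some bound of the operator on the intermediate space; a crude one suffices, since its size
  disappears. The condition for p = 1 has conjugate index infinity, which is where the essential
  bounds of 1 / \<psi> on initial intervals and of \<Psi> / \<psi> come from. Finally, the factors
  carry the Lebesgue measurable sets, so intervals alone do not generate the sigma-algebra in the
  injectivity proof.\<close>

text \<open>Exponents enter through \<open>s = 1 / p\<close>, so that \<open>s = 0\<close> is the essential supremum and \<open>1 - s\<close> the conjugate.\<close>

definition Lr_space :: "'a measure \<Rightarrow> real \<Rightarrow> ('a \<Rightarrow> 'b::{real_normed_vector,second_countable_topology}) set" where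
  "Lr_space M s = Lp_space M (inverse (ennreal s))"

definition Lr_norm :: "'a measure \<Rightarrow> real \<Rightarrow> ('a \<Rightarrow> 'b::{real_normed_vector,second_countable_topology}) \<Rightarrow> real" where
  "Lr_norm M s f = Lp_norm M (inverse (ennreal s)) f"

lemma Lr_space_pos:
  "0 < s \<Longrightarrow> f \<in> Lr_space M s \<longleftrightarrow>
    f \<in> borel_measurable M \<and> integrable M (\<lambda>t. norm (f t) powr (1 / s))"
  by (auto simp: Lr_space_def Lp_space_def inverse_ennreal inverse_eq_divide)

lemma Lr_norm_pos: "0 < s \<Longrightarrow> Lr_norm M s f = (LINT t|M. norm (f t) powr (1 / s)) powr s"
  by (auto simp: Lr_norm_def Lp_norm_def inverse_ennreal inverse_eq_divide)

lemma Lr_norm_zero_AE: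
  assumes "f \<in> Lr_space M 0"
  shows "AE t in M. norm (f t) \<le> Lr_norm M 0 f"
proof -
  let ?e = "esssup M (\<lambda>t. ennreal (norm (f t)))"
  from assms have lt: "?e < top" by (simp add: Lr_space_def Lp_space_def)
  have "AE t in M. norm (f t) \<le> enn2real ?e"
    using esssup_AE[of "\<lambda>t. ennreal (norm (f t))" M]
    by eventually_elim (metis enn2real_ennreal enn2real_mono lt norm_ge_zero)
  then show ?thesis by (simp add: Lr_norm_def Lp_norm_def)
qed

lemma Lr_space_zero:
  "f \<in> Lr_space M 0 \<longleftrightarrow> f \<in> borel_measurable M \<and> (\<exists>C\<ge>0. AE t in M. norm (f t) \<le> C)"
proof (intro iffI conjI)
  assume f: "f \<in> Lr_space M 0"
  then show "f \<in> borel_measurable M" by (simp add: Lr_space_def Lp_space_def)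
  show "\<exists>C\<ge>0. AE t in M. norm (f t) \<le> C"
    using Lr_norm_zero_AE[OF f] by (intro exI[of _ "Lr_norm M 0 f"]) (simp add: Lr_norm_def Lp_norm_def)
next
  assume f: "f \<in> borel_measurable M \<and> (\<exists>C\<ge>0. AE t in M. norm (f t) \<le> C)"
  then obtain C where C: "0 \<le> C" "AE t in M. norm (f t) \<le> C" by blast
  have [measurable]: "f \<in> borel_measurable M" using f by simp
  have "esssup M (\<lambda>t. ennreal (norm (f t))) \<le> ennreal C"
    by (rule esssup_I) (use C in \<open>auto elim: eventually_mono simp: ennreal_leI\<close>)
  also have "\<dots> < top" by simp
  finally show "f \<in> Lr_space M 0" by (simp add: Lr_space_def Lp_space_def)
qed

lemma Lr_norm_zero_le:
  assumes [measurable]: "f \<in> borel_measurable M" and "0 \<le> C" and C: "AE t in M. norm (f t) \<le> C"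
  shows "Lr_norm M 0 f \<le> C"
proof -
  have "esssup M (\<lambda>t. ennreal (norm (f t))) \<le> ennreal C"
    by (rule esssup_I) (use C in \<open>auto elim: eventually_mono simp: ennreal_leI\<close>)
  then show ?thesis using \<open>0 \<le> C\<close> by (auto simp: Lr_norm_def Lp_norm_def intro: enn2real_leI)
qed

lemma Lr_space_measurable [measurable_dest]: "f \<in> Lr_space M s \<Longrightarrow> f \<in> borel_measurable M"
  by (simp add: Lr_space_def Lp_space_def)

lemma Lr_norm_nonneg [simp]: "0 \<le> Lr_norm M s f"
  by (simp add: Lr_norm_def Lp_norm_def)

lemma Lr_norm_powr:
  assumes "0 < s"
  shows "Lr_norm M s f powr (1 / s) = (LINT t|M. norm (f t) powr (1 / s))"
  using assms by (simp add: Lr_norm_pos powr_powr)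

lemma Lr_norm_le_iff:
  assumes "0 < s" "0 \<le> c"
  shows "Lr_norm M s f \<le> c \<longleftrightarrow> (LINT t|M. norm (f t) powr (1 / s)) \<le> c powr (1 / s)"
proof
  assume "Lr_norm M s f \<le> c"
  then show "(LINT t|M. norm (f t) powr (1 / s)) \<le> c powr (1 / s)"
    unfolding Lr_norm_powr[OF assms(1), symmetric] using assms by (intro powr_mono2) auto
next
  assume "(LINT t|M. norm (f t) powr (1 / s)) \<le> c powr (1 / s)"
  then have "(LINT t|M. norm (f t) powr (1 / s)) powr s \<le> (c powr (1 / s)) powr s"
    using assms by (intro powr_mono2) auto
  then show "Lr_norm M s f \<le> c" using assms by (simp add: Lr_norm_pos powr_powr)
qed

lemma
  assumes g: "g \<in> Lr_space M s" and f: "f \<in> borel_measurable M"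
    and le: "AE t in M. norm (f t) \<le> norm (g t)" and s: "0 \<le> s"
  shows Lr_space_mono: "f \<in> Lr_space M s" and Lr_norm_mono: "Lr_norm M s f \<le> Lr_norm M s g"
proof -
  note [measurable] = f Lr_space_measurable[OF g]
  have "f \<in> Lr_space M s \<and> Lr_norm M s f \<le> Lr_norm M s g"
  proof (cases "s = 0")
    case True
    have "AE t in M. norm (f t) \<le> Lr_norm M 0 g"
      using le Lr_norm_zero_AE[of g M] g unfolding True by auto
    then show ?thesis
      using True Lr_norm_zero_le[of f M "Lr_norm M 0 g"] Lr_space_zero[of f M] f by auto
  next
    case False
    with s have s: "0 < s" by simp
    have le': "AE t in M. norm (f t) powr (1 / s) \<le> norm (g t) powr (1 / s)"
      using le by eventually_elim (use s in \<open>auto intro: powr_mono2\<close>)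
    have gi: "integrable M (\<lambda>t. norm (g t) powr (1 / s))" using g s by (simp add: Lr_space_pos)
    have fi: "integrable M (\<lambda>t. norm (f t) powr (1 / s))"
      by (rule Bochner_Integration.integrable_bound[OF gi]) (use le' in auto)
    have "(LINT t|M. norm (f t) powr (1 / s)) \<le> (LINT t|M. norm (g t) powr (1 / s))"
      by (rule integral_mono_AE[OF fi gi le'])
    then show ?thesis using fi s f by (auto simp: Lr_norm_le_iff Lr_space_pos Lr_norm_powr)
  qed
  then show "f \<in> Lr_space M s" "Lr_norm M s f \<le> Lr_norm M s g" by auto
qed

lemma
  assumes g: "g \<in> Lr_space M s" and f: "f \<in> borel_measurable M"
    and eq: "AE t in M. norm (f t) = norm (g t)" and s: "0 \<le> s"
  shows Lr_space_cong: "f \<in> Lr_space M s" and Lr_norm_cong: "Lr_norm M s f = Lr_norm M s g"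
proof -
  have le: "AE t in M. norm (f t) \<le> norm (g t)" "AE t in M. norm (g t) \<le> norm (f t)"
    using eq by auto
  show fL: "f \<in> Lr_space M s" by (rule Lr_space_mono[OF g f le(1) s])
  show "Lr_norm M s f = Lr_norm M s g"
    using Lr_norm_mono[OF g f le(1) s] Lr_norm_mono[OF fL Lr_space_measurable[OF g] le(2) s] by simp
qed

lemma
  assumes g: "g \<in> Lr_space M s" and c: "0 \<le> c" and s: "0 \<le> s" and f: "f \<in> borel_measurable M"
    and le: "AE t in M. norm (f t) \<le> c * norm (g t)"
  shows Lr_space_cmult_mono: "f \<in> Lr_space M s"
    and Lr_norm_cmult_mono: "Lr_norm M s f \<le> c * Lr_norm M s g"
proof -
  note [measurable] = f Lr_space_measurable[OF g]
  have *: "(\<lambda>t. c *\<^sub>R g t) \<in> Lr_space M s \<and> Lr_norm M s (\<lambda>t. c *\<^sub>R g t) \<le> c * Lr_norm M s g"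
  proof (cases "s = 0")
    case True
    have "AE t in M. norm (c *\<^sub>R g t) \<le> c * Lr_norm M 0 g"
      using Lr_norm_zero_AE[of g M] g c unfolding True by (auto intro: mult_left_mono)
    then show ?thesis
      using True c Lr_norm_zero_le[of "\<lambda>t. c *\<^sub>R g t" M "c * Lr_norm M 0 g"]
        Lr_space_zero[of "\<lambda>t. c *\<^sub>R g t" M]
      by (auto intro!: exI[of _ "c * Lr_norm M 0 g"])
  next
    case False
    with s have s: "0 < s" by simp
    then show ?thesis using g c by (auto simp: Lr_space_pos Lr_norm_pos powr_mult powr_powr)
  qed
  have le': "AE t in M. norm (f t) \<le> norm (c *\<^sub>R g t)" using le c by auto
  from * show "f \<in> Lr_space M s" "Lr_norm M s f \<le> c * Lr_norm M s g"
    using Lr_space_mono[OF _ f le' s] Lr_norm_mono[OF _ f le' s] by fastforce+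
qed

lemma Lr_norm_cmult:
  assumes g: "g \<in> Lr_space M s" and c: "0 \<le> c" and s: "0 \<le> s" and f: "f \<in> borel_measurable M"
    and eq: "AE t in M. norm (f t) = c * norm (g t)"
  shows "Lr_norm M s f = c * Lr_norm M s g"
proof (rule antisym)
  have fL: "f \<in> Lr_space M s" by (rule Lr_space_cmult_mono[OF g c s f]) (use eq in auto)
  show "Lr_norm M s f \<le> c * Lr_norm M s g" by (rule Lr_norm_cmult_mono[OF g c s f]) (use eq in auto)
  show "c * Lr_norm M s g \<le> Lr_norm M s f"
  proof (cases "c = 0")
    case False
    then have "Lr_norm M s g \<le> (1 / c) * Lr_norm M s f"
      by (intro Lr_norm_cmult_mono[OF fL _ s Lr_space_measurable[OF g]]) (use eq c in auto)
    with False c show ?thesis by (simp add: field_simps)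
  qed simp
qed

lemma Lr_norm_eq_0_AE:
  assumes f: "f \<in> Lr_space M s" and s: "0 \<le> s" and 0: "Lr_norm M s f = 0"
  shows "AE t in M. f t = 0"
proof (cases "s = 0")
  case True
  then show ?thesis using Lr_norm_zero_AE[of f M] f 0 by auto
next
  case False
  with s have s: "0 < s" by simp
  from 0 s have "(LINT t|M. norm (f t) powr (1 / s)) = 0"
    by (metis Lr_norm_powr powr_zero_eq_one powr_eq_0_iff)
  then have "AE t in M. norm (f t) powr (1 / s) = 0"
    using f s by (subst (asm) integral_nonneg_eq_0_iff_AE) (auto simp: Lr_space_pos)
  then show ?thesis by auto
qed

lemma Lr_norm_0_AE:
  assumes f: "f \<in> borel_measurable M" and s: "0 \<le> s" and 0: "AE t in M. f t = 0"
  shows "f \<in> Lr_space M s" "Lr_norm M s f = 0"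
proof -
  have z: "(\<lambda>_. 0::real) \<in> Lr_space M s" "Lr_norm M s (\<lambda>_. 0::real) = 0"
  proof -
    have "s = 0 \<or> 0 < s" using s by auto
    then show "(\<lambda>_. 0::real) \<in> Lr_space M s" "Lr_norm M s (\<lambda>_. 0::real) = 0"
      using Lr_norm_zero_le[of "\<lambda>_. 0::real" M 0] Lr_norm_nonneg[of M 0 "\<lambda>_. 0::real"]
      by (auto simp: Lr_space_zero Lr_space_pos Lr_norm_pos intro!: exI[of _ 0] simp del: Lr_norm_nonneg)
  qed
  have eq: "AE t in M. norm (f t) = norm (0::real)" using 0 by auto
  show "f \<in> Lr_space M s" "Lr_norm M s f = 0"
    using Lr_space_cong[OF z(1) f eq s] Lr_norm_cong[OF z(1) f eq s] z by auto
qed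

lemma
  fixes f :: "'a \<Rightarrow> 'b::{real_normed_vector,second_countable_topology}"
  assumes f: "f \<in> Lr_space M s" and s: "0 \<le> s" "0 \<le> s'"
    and r: "s = 0 \<Longrightarrow> s' = 0 \<and> r = 1" "0 < s \<Longrightarrow> r = s' / s"
    and g: "g \<in> borel_measurable M" and eq: "AE t in M. norm (g t) \<le> norm (f t) powr r"
  shows Lr_space_powr: "g \<in> Lr_space M s'"
    and Lr_norm_powr_le: "Lr_norm M s' g \<le> Lr_norm M s f powr r"
proof -
  note [measurable] = g Lr_space_measurable[OF f]
  have *: "(\<lambda>t. norm (f t) powr r) \<in> Lr_space M s' \<and>
    Lr_norm M s' (\<lambda>t. norm (f t) powr r) \<le> Lr_norm M s f powr r"
  proof (cases "s = 0")
    case True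
    with r have "s' = 0" "r = 1" by auto
    with True f show ?thesis
      using Lr_space_cong[of f M 0 "\<lambda>t. norm (f t)"] Lr_norm_cong[of f M 0 "\<lambda>t. norm (f t)"] by simp
  next
    case False
    with s r have s0: "0 < s" and rs: "r = s' / s" by auto
    have fi: "integrable M (\<lambda>t. norm (f t) powr (1 / s))" using f s0 by (simp add: Lr_space_pos)
    show ?thesis
    proof (cases "s' = 0")
      case True
      with rs have [simp]: "r = 0" by simp
      show ?thesis
      \<comment> \<open>With \<open>r = 0\<close> the convention \<open>0 powr 0 = 0\<close>
        matters: if the norm vanishes, the right-hand side is 0, but then \<open>f\<close> is zero
        almost everywhere and so is the left-hand side.\<close>
      proof (cases "Lr_norm M s f = 0")
        case True
        then have "AE t in M. norm (f t) powr r = 0" using Lr_norm_eq_0_AE[OF f] s0 by auto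
        from Lr_norm_0_AE[OF _ _ this, of s'] s show ?thesis by auto
      next
        case False
        have "AE t in M. norm (norm (f t) powr r) \<le> 1" by auto
        then show ?thesis using False \<open>s' = 0\<close>
          Lr_norm_zero_le[of "\<lambda>t. norm (f t) powr r" M 1] Lr_space_zero[of "\<lambda>t. norm (f t) powr r" M]
          by (auto intro!: exI[of _ 1])
      qed
    next
      case False
      with s have s': "0 < s'" by simp
      then show ?thesis using fi s0 rs by (auto simp: Lr_space_pos Lr_norm_pos powr_powr)
    qed
  qed
  have le: "AE t in M. norm (g t) \<le> norm (norm (f t) powr r)" using eq by auto
  from * show "g \<in> Lr_space M s'" "Lr_norm M s' g \<le> Lr_norm M s f powr r"
    using Lr_space_mono[OF _ g le s(2)] Lr_norm_mono[OF _ g le s(2)] by fastforce+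
qed

text \<open>Beyond the open half-line only the case of an argument 0 remains, where the claim
  reduces to t^p \<le> t for t in (0, 1).\<close>

lemma convex_on_powr_nonneg:
  assumes "1 \<le> p"
  shows "convex_on {0..} (\<lambda>x::real. x powr p)"
proof (rule convex_onI)
  fix t x y :: real
  assume t: "0 < t" "t < 1" and xy: "x \<in> {0..}" "y \<in> {0..}"
  have le: "a powr p \<le> a" if "0 < a" "a < 1" for a :: real
    using powr_mono'[of 1 p a] that assms by simp
  consider "x > 0 \<and> y > 0" | "x = 0" | "y = 0" using xy by fastforce
  then show "((1 - t) *\<^sub>R x + t *\<^sub>R y) powr p \<le> (1 - t) * x powr p + t * y powr p"
  proof cases
    case 1
    then show ?thesis using convex_onD[OF powr_convex[OF assms], of t x y] t by simp
  next
    case 2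
    then show ?thesis using le[of t] t xy by (auto simp: powr_mult intro: mult_right_mono)
  next
    case 3
    then show ?thesis using le[of "1 - t"] t xy by (auto simp: powr_mult intro: mult_right_mono)
  qed
qed simp

text \<open>Minkowski's inequality by convexity: divided by their norms \<open>a\<close> and
  \<open>b\<close>, both functions lie on the unit sphere, and the sum is (a + b) times their convex
  combination with weights a / (a + b) and b / (a + b). Only the modulus of \<open>h\<close> enters,
  so the statement covers sums, differences and majorants.\<close>

lemma
  fixes f g :: "'a \<Rightarrow> 'b::{real_normed_vector,second_countable_topology}"
  assumes f: "f \<in> Lr_space M s" and g: "g \<in> Lr_space M s" and s: "0 \<le> s" "s \<le> 1"
    and h: "h \<in> borel_measurable M" and le: "AE t in M. norm (h t) \<le> norm (f t) + norm (g t)"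
  shows Lr_space_add: "h \<in> Lr_space M s"
    and Lr_norm_triangle: "Lr_norm M s h \<le> Lr_norm M s f + Lr_norm M s g"
proof -
  note [measurable] = h Lr_space_measurable[OF f] Lr_space_measurable[OF g]
  define a b where "a = Lr_norm M s f" and "b = Lr_norm M s g"
  have ab: "0 \<le> a" "0 \<le> b" by (auto simp: a_def b_def)
  have "h \<in> Lr_space M s \<and> Lr_norm M s h \<le> a + b"
  proof (cases "s = 0")
    case True
    have "AE t in M. norm (h t) \<le> a + b"
      using le Lr_norm_zero_AE[of f M] Lr_norm_zero_AE[of g M] f g unfolding True a_def b_def by auto
    then show ?thesis using True ab Lr_norm_zero_le[of h M "a + b"] Lr_space_zero[of h M] by auto
  next
    case False
    with s have s0: "0 < s" by simp
    consider "a = 0" | "b = 0" | "0 < a" "0 < b" using ab by fastforce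
    then show ?thesis
    proof cases
      case 1
      then have "AE t in M. norm (h t) \<le> norm (g t)"
        using le Lr_norm_eq_0_AE[OF f] s unfolding a_def by auto
      then show ?thesis
        using Lr_space_mono[OF g h _ s(1)] Lr_norm_mono[OF g h _ s(1)] 1 by (simp add: b_def)
    next
      case 2
      then have "AE t in M. norm (h t) \<le> norm (f t)"
        using le Lr_norm_eq_0_AE[OF g] s unfolding b_def by auto
      then show ?thesis
        using Lr_space_mono[OF f h _ s(1)] Lr_norm_mono[OF f h _ s(1)] 2 by (simp add: a_def)
    next
      case 3
      define p where "p = 1 / s"
      have p: "1 \<le> p" using s0 s by (simp add: p_def)
      have fi: "integrable M (\<lambda>t. norm (f t) powr p)" and gi: "integrable M (\<lambda>t. norm (g t) powr p)"
        using f g s0 by (simp_all add: Lr_space_pos p_def)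
      have fint: "(LINT t|M. norm (f t) powr p) = a powr p" and gint: "(LINT t|M. norm (g t) powr p) = b powr p"
        using s0 by (simp_all add: a_def b_def p_def Lr_norm_powr)
      let ?u = "\<lambda>t. (a + b) powr p * (a / (a + b) * (norm (f t) powr p / a powr p)
        + b / (a + b) * (norm (g t) powr p / b powr p))"
      have ui: "integrable M ?u" using fi gi by auto
      have pt: "norm (h t) powr p \<le> ?u t" if "norm (h t) \<le> norm (f t) + norm (g t)" for t
      proof -
        have "norm (h t) powr p \<le> (norm (f t) + norm (g t)) powr p"
          using that p by (intro powr_mono2) auto
        also have "norm (f t) + norm (g t) = (a + b) * (a / (a + b) * (norm (f t) / a) + b / (a + b) * (norm (g t) / b))"
          using 3 by (simp add: distrib_left)
        also have "\<dots> powr p = (a + b) powr p * (a / (a + b) * (norm (f t) / a) + b / (a + b) * (norm (g t) / b)) powr p"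
          by (rule powr_mult)
        also have "\<dots> \<le> (a + b) powr p * (a / (a + b) * (norm (f t) / a) powr p + b / (a + b) * (norm (g t) / b) powr p)"
        proof -
          have "a / (a + b) = 1 - b / (a + b)" using 3 by (simp add: field_simps)
          then have "(a / (a + b) * (norm (f t) / a) + b / (a + b) * (norm (g t) / b)) powr p \<le>
             a / (a + b) * (norm (f t) / a) powr p + b / (a + b) * (norm (g t) / b) powr p"
            using convex_onD[OF convex_on_powr_nonneg[OF p], of "b / (a + b)" "norm (f t) / a" "norm (g t) / b"] 3
            by simp
          then show ?thesis by (intro mult_left_mono) auto
        qed
        finally show ?thesis using 3 by (simp add: powr_divide)
      qed
      have pt': "AE t in M. norm (h t) powr p \<le> ?u t" using le by eventually_elim (rule pt)
      have hi: "integrable M (\<lambda>t. norm (h t) powr p)"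
        by (rule Bochner_Integration.integrable_bound[OF ui]) (use pt' in auto)
      have "(LINT t|M. norm (h t) powr p) \<le> integral\<^sup>L M ?u"
        by (rule integral_mono_AE[OF hi ui pt'])
      also have "\<dots> = (a + b) powr p" using 3 fi gi by (simp add: fint gint flip: add_divide_distrib)
      finally show ?thesis using hi s0 ab by (simp add: Lr_norm_le_iff Lr_space_pos p_def)
    qed
  qed
  then show "h \<in> Lr_space M s" "Lr_norm M s h \<le> Lr_norm M s f + Lr_norm M s g"
    by (auto simp: a_def b_def)
qed

text \<open>Young's inequality for the two functions divided by their norms. The endpoint
  \<open>s = 0\<close> is proved for arbitrary codomains, so that exchanging the factors also yields
  \<open>s = 1\<close>.\<close>

lemma Lr_norm_Hoelder:
  fixes f :: "'a \<Rightarrow> 'b::{real_normed_vector,second_countable_topology}"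
    and g :: "'a \<Rightarrow> 'c::{real_normed_vector,second_countable_topology}"
  assumes f: "f \<in> Lr_space M s" and g: "g \<in> Lr_space M (1 - s)" and s: "0 \<le> s" "s \<le> 1"
  shows "integrable M (\<lambda>t. norm (f t) * norm (g t))" (is ?I)
    and "(LINT t|M. norm (f t) * norm (g t)) \<le> Lr_norm M s f * Lr_norm M (1 - s) g" (is ?L)
proof -
  have end0: "integrable M (\<lambda>t. norm (f t) * norm (g t)) \<and>
      (LINT t|M. norm (f t) * norm (g t)) \<le> Lr_norm M 0 f * Lr_norm M 1 g"
    if f: "f \<in> Lr_space M 0" and g: "g \<in> Lr_space M 1"
    for f :: "'a \<Rightarrow> 'd::{real_normed_vector,second_countable_topology}"
      and g :: "'a \<Rightarrow> 'e::{real_normed_vector,second_countable_topology}"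
  proof -
    note [measurable] = Lr_space_measurable[OF f] Lr_space_measurable[OF g]
    have gi: "integrable M (\<lambda>t. norm (g t))" using g by (simp add: Lr_space_pos)
    have le: "AE t in M. norm (f t) * norm (g t) \<le> Lr_norm M 0 f * norm (g t)"
      using Lr_norm_zero_AE[OF f] by eventually_elim (rule mult_right_mono, auto)
    have i: "integrable M (\<lambda>t. norm (f t) * norm (g t))"
      by (rule Bochner_Integration.integrable_bound[of M "\<lambda>t. Lr_norm M 0 f * norm (g t)"])
         (use gi le in auto)
    have "(LINT t|M. norm (f t) * norm (g t)) \<le> (LINT t|M. Lr_norm M 0 f * norm (g t))"
      using gi by (intro integral_mono_AE[OF i _ le]) auto
    with i show ?thesis by (simp add: Lr_norm_pos)
  qed
  note [measurable] = Lr_space_measurable[OF f] Lr_space_measurable[OF g]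
  consider "s = 0" | "s = 1" | "0 < s" "s < 1" using s by fastforce
  then have "?I \<and> ?L"
  proof cases
    case 1
    then show ?thesis using end0[of f g] f g by simp
  next
    case 2
    then show ?thesis using end0[of g f] f g by (simp add: mult.commute)
  next
    case 3
    define p q where "p = 1 / s" and "q = 1 / (1 - s)"
    have pq: "1 < p" "1 < q" "1 / p + 1 / q = 1" using 3 by (auto simp: p_def q_def)
    define a b where "a = Lr_norm M s f" and "b = Lr_norm M (1 - s) g"
    have fi: "integrable M (\<lambda>t. norm (f t) powr p)" using f 3 by (simp add: Lr_space_pos p_def)
    have gi: "integrable M (\<lambda>t. norm (g t) powr q)" using g 3 by (simp add: Lr_space_pos q_def)
    have fint: "(LINT t|M. norm (f t) powr p) = a powr p"
      using 3 by (simp add: a_def p_def Lr_norm_powr)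
    have gint: "(LINT t|M. norm (g t) powr q) = b powr q"
      using 3 by (simp add: b_def q_def Lr_norm_powr)
    show ?thesis
    proof (cases "a = 0 \<or> b = 0")
      case True
      then have "AE t in M. norm (f t) * norm (g t) = 0"
        using Lr_norm_eq_0_AE[OF f] Lr_norm_eq_0_AE[OF g] s unfolding a_def b_def by auto
      then have "integrable M (\<lambda>t. norm (f t) * norm (g t))" "(LINT t|M. norm (f t) * norm (g t)) = 0"
        by (subst integrable_cong_AE[where g = "\<lambda>_. 0"] integral_cong_AE[where g = "\<lambda>_. 0"]; simp)+
      then show ?thesis by simp
    next
      case False
      then have ab: "0 < a" "0 < b" by (auto simp: a_def b_def less_le)
      let ?u = "\<lambda>t. a * b * ((norm (f t) powr p / a powr p) / p + (norm (g t) powr q / b powr q) / q)"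
      have ui: "integrable M ?u" using fi gi by auto
      have le: "norm (f t) * norm (g t) \<le> ?u t" for t
      proof -
        have "(norm (f t) / a) * (norm (g t) / b) \<le>
            (norm (f t) / a) powr p / p + (norm (g t) / b) powr q / q"
          using pq ab by (intro Youngs_inequality) auto
        then have "a * b * ((norm (f t) / a) * (norm (g t) / b)) \<le>
            a * b * ((norm (f t) / a) powr p / p + (norm (g t) / b) powr q / q)"
          using ab by (intro mult_left_mono) auto
        then show ?thesis using ab by (simp add: powr_divide)
      qed
      have i: "integrable M (\<lambda>t. norm (f t) * norm (g t))"
        by (rule Bochner_Integration.integrable_bound[OF ui]) (use le in \<open>auto intro: order_trans[OF _ abs_ge_self]\<close>)
      have "(LINT t|M. norm (f t) * norm (g t)) \<le> integral\<^sup>L M ?u"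
        by (rule integral_mono[OF i ui le])
      also have "\<dots> = a * b * (1 / p + 1 / q)" using ab fi gi by (simp add: fint gint)
      finally show ?thesis using i pq by (simp add: a_def b_def)
    qed
  qed
  then show ?I ?L by auto
qed

lemma Lr_Hoelder_complex:
  fixes f g :: "'a \<Rightarrow> complex"
  assumes f: "f \<in> Lr_space M s" and g: "g \<in> Lr_space M (1 - s)" and s: "0 \<le> s" "s \<le> 1"
  shows "integrable M (\<lambda>t. f t * g t)"
    and "cmod (LINT t|M. f t * g t) \<le> Lr_norm M s f * Lr_norm M (1 - s) g"
proof -
  note [measurable] = Lr_space_measurable[OF f] Lr_space_measurable[OF g]
  show "integrable M (\<lambda>t. f t * g t)"
    by (rule Bochner_Integration.integrable_bound[OF Lr_norm_Hoelder(1)[OF assms]]) (auto simp: norm_mult)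
  have "cmod (LINT t|M. f t * g t) \<le> (LINT t|M. cmod (f t * g t))" by (rule integral_norm_bound)
  also have "\<dots> \<le> Lr_norm M s f * Lr_norm M (1 - s) g"
    using Lr_norm_Hoelder(2)[OF assms] by (simp add: norm_mult)
  finally show "cmod (LINT t|M. f t * g t) \<le> Lr_norm M s f * Lr_norm M (1 - s) g" .
qed

section \<open>Lebesgue spaces over finite measures\<close>

lemma (in finite_measure) Lr_space_bounded:
  assumes [measurable]: "f \<in> borel_measurable M" and s: "0 \<le> s" and C: "AE t in M. norm (f t) \<le> C" 
  shows "f \<in> Lr_space M s"
proof (rule Lr_space_mono[where g = "\<lambda>_. \<bar>C\<bar>"])
  show "(\<lambda>_. \<bar>C\<bar>) \<in> Lr_space M s"
    by (cases "s = 0") (use s in \<open>auto simp: Lr_space_zero Lr_space_pos intro!: exI[of _ "\<bar>C\<bar>"]\<close>)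
qed (use C s in auto)

lemma (in finite_measure) Lr_space_finite_range:
  assumes f: "f \<in> borel_measurable M" "finite (range f)" and s: "0 \<le> s"
  shows "f \<in> Lr_space M s"
proof (rule Lr_space_bounded[OF f(1) s])
  show "AE t in M. norm (f t) \<le> Max (norm ` range f)" using f(2) by (intro AE_I2 Max_ge) auto
qed

lemma integrable_mult_bounded:
  fixes g :: "'a \<Rightarrow> complex"
  assumes g: "integrable M g" and h[measurable]: "h \<in> borel_measurable M" and le: "\<And>t. \<bar>h t\<bar> \<le> K"
  shows "integrable M (\<lambda>t. g t * of_real (h t))"
proof (rule Bochner_Integration.integrable_bound[of _ "\<lambda>t. K * cmod (g t)"])
  note [measurable] = borel_measurable_integrable[OF g]
  show "(\<lambda>t. g t * of_real (h t)) \<in> borel_measurable M" by measurable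
  have "norm (g t * of_real (h t)) \<le> K * cmod (g t)" for t
    unfolding norm_mult norm_of_real mult.commute[of "cmod _"] by (intro mult_right_mono le) auto
  then show "AE t in M. norm (g t * of_real (h t)) \<le> norm (K * cmod (g t))"
    by (intro AE_I2) (metis abs_ge_self order_trans real_norm_def)
qed (use g in simp)

lemma abs_prod_le_power:
  fixes f :: "'i \<Rightarrow> real"
  assumes "\<And>j. j \<in> u \<Longrightarrow> \<bar>f j\<bar> \<le> K"
  shows "\<bar>\<Prod>j\<in>u. f j\<bar> \<le> K ^ card u"
  unfolding abs_prod using prod_mono[of u "\<lambda>j. \<bar>f j\<bar>" "\<lambda>_. K"] assms by simp

lemma indicator_PiE:
  assumes "finite u" "t \<in> extensional u"
  shows "indicator (Pi\<^sub>E u A) t = (\<Prod>j\<in>u. indicator (A j) (t j) :: 'b::comm_semiring_1)"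
proof (cases "t \<in> Pi\<^sub>E u A")
  case True
  then show ?thesis by (auto simp: PiE_def Pi_def intro!: prod.neutral[symmetric])
next
  case False
  then obtain j where "j \<in> u" "t j \<notin> A j" using assms(2) by (auto simp: PiE_def)
  then show ?thesis using False assms(1) by (auto intro!: prod_zero bexI[of _ j])
qed

lemma (in finite_measure) Lr_space_integrable:
  fixes f :: "'a \<Rightarrow> 'b::{banach,second_countable_topology}"
  assumes f: "f \<in> Lr_space M s" and s: "0 \<le> s" "s \<le> 1"
  shows "integrable M f"
proof -
  have 1: "(\<lambda>_. 1::real) \<in> Lr_space M (1 - s)" using s by (intro Lr_space_bounded[where C=1]) auto
  show ?thesis
    using Lr_norm_Hoelder(1)[OF f 1 s] Lr_space_measurable[OF f] by (simp add: integrable_norm_iff)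
qed

text \<open>Hoelder's inequality against the constant 1, whose norm is at most 1 for every exponent
  because the total mass is 1. It plays the role of Jensen's inequality on the fibres of a
  product.\<close>

lemma (in prob_space) Lr_norm_integral:
  fixes f :: "'a \<Rightarrow> 'b::{banach,second_countable_topology}"
  assumes f: "f \<in> Lr_space M s" and s: "0 \<le> s" "s \<le> 1"
  shows "(LINT t|M. norm (f t)) \<le> Lr_norm M s f"
proof -
  have 1: "(\<lambda>_. 1::real) \<in> Lr_space M (1 - s)" using s by (intro Lr_space_bounded[where C=1]) auto
  have "Lr_norm M (1 - s) (\<lambda>_. 1::real) \<le> 1"
    by (cases "s = 1") (use s Lr_norm_zero_le[of "\<lambda>_. 1::real" M 1] in \<open>auto simp: Lr_norm_pos prob_space\<close>)
  with Lr_norm_Hoelder(2)[OF f 1 s] show ?thesis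
    by simp (metis Lr_norm_nonneg mult_left_le order_trans)
qed

lemma borel_measurable_cnj [measurable]: "cnj \<in> borel_measurable borel"
  by (intro borel_measurable_continuous_onI continuous_intros)

lemma borel_measurable_sgn_complex [measurable]: "(sgn :: complex \<Rightarrow> complex) \<in> borel_measurable borel"
  unfolding sgn_div_norm by measurable

text \<open>For non-zero norm the extremal dual function is explicit: for \<open>s > 0\<close> it is
  the conjugate sign of f times (|f| / a)^(1 / s - 1), for \<open>s = 0\<close> the conjugate sign
  on the set where |f| equals its essential supremum, divided by the measure of that set. It is
  produced as a function \<open>\<eta>\<close> of the values of \<open>f\<close>, so that it
  inherits the finite range.\<close>

lemma (in finite_measure) Lr_norm_converse_Hoelder:
  fixes f :: "'a \<Rightarrow> complex"
  assumes f[measurable]: "f \<in> borel_measurable M" and fin: "finite (range f)" and s: "0 \<le> s" "s \<le> 1"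
  obtains \<eta> where "\<eta> \<in> borel_measurable borel" "(\<lambda>t. \<eta> (f t)) \<in> Lr_space M (1 - s)"
    "Lr_norm M (1 - s) (\<lambda>t. \<eta> (f t)) \<le> 1" "(LINT t|M. f t * \<eta> (f t)) = of_real (Lr_norm M s f)"
proof (cases "Lr_norm M s f = 0")
  case True
  have "(\<lambda>_. 0::complex) \<in> Lr_space M (1 - s)" "Lr_norm M (1 - s) (\<lambda>_. 0::complex) = 0"
    using Lr_norm_0_AE[of "\<lambda>_. 0::complex" M "1 - s"] s by auto
  with True that[of "\<lambda>_. 0"] show ?thesis by simp
next
  case nz: False
  have fL: "f \<in> Lr_space M s'" if "0 \<le> s'" for s' by (rule Lr_space_finite_range[OF f fin that])
  define a where "a = Lr_norm M s f"
  have a: "0 < a" using nz by (simp add: a_def less_le)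
  have sgn: "x * cnj (sgn x) = of_real (cmod x)" for x
  proof (cases "x = 0")
    case False
    have "x * cnj (sgn x) = (x * cnj x) / of_real (cmod x)"
      by (simp add: sgn_div_norm scaleR_conv_of_real field_simps)
    also have "\<dots> = of_real (cmod x)"
      using False by (simp add: power2_eq_square flip: complex_norm_square)
    finally show ?thesis .
  qed simp
  show ?thesis
  proof (cases "s = 0")
    case True
    define A where "A = {t \<in> space M. cmod (f t) = a}"
    have [measurable]: "A \<in> sets M" by (simp add: A_def)
    \<comment> \<open>If |f| stayed below \<open>a\<close> almost everywhere, finiteness of the
      range would bound it by the largest value below \<open>a\<close>, contradicting that
      \<open>a\<close> is the essential supremum.\<close>
    have pos: "0 < measure M A"
    proof (rule ccontr)
      assume "\<not> 0 < measure M A"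
      then have "measure M A = 0" using measure_nonneg[of M A] by linarith
      then have "AE t in M. t \<notin> A"
        by (simp add: AE_iff_measurable[OF _ refl] emeasure_eq_measure A_def)
      moreover have "AE t in M. cmod (f t) \<le> a"
        using Lr_norm_zero_AE[of f M] fL[of 0] True by (simp add: a_def)
      ultimately have lt: "AE t in M. cmod (f t) < a"
        using AE_space by eventually_elim (auto simp: A_def)
      define B where "B = insert 0 {x \<in> norm ` range f. x < a}"
      have B: "finite B" "B \<noteq> {}" using fin by (auto simp: B_def)
      have "AE t in M. cmod (f t) \<le> Max B"
        using lt by eventually_elim (rule Max_ge[OF B(1)], auto simp: B_def)
      moreover have "0 \<le> Max B" by (rule Max_ge[OF B(1)]) (simp add: B_def)
      ultimately have "a \<le> Max B" using Lr_norm_zero_le[of f M "Max B"] True by (simp add: a_def)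
      moreover have "Max B < a" using Max_in[OF B] a by (auto simp: B_def)
      ultimately show False by simp
    qed
    define \<eta> where "\<eta> = (\<lambda>x. if cmod x = a then cnj (sgn x) / of_real (measure M A) else 0)"
    have [measurable]: "\<eta> \<in> borel_measurable borel" unfolding \<eta>_def by measurable
    have n: "cmod (\<eta> (f t)) = indicator A t / measure M A" if "t \<in> space M" for t
      using a pos that by (auto simp: \<eta>_def A_def norm_divide norm_sgn indicator_def)
    have i: "(LINT t|M. cmod (\<eta> (f t))) = 1"
      using pos by (simp add: n cong: Bochner_Integration.integral_cong)
    have "integrable M (\<lambda>t. indicat_real A t / measure M A)"
      by (auto intro!: integrable_real_indicator simp: emeasure_eq_measure)
    then have ii: "integrable M (\<lambda>t. cmod (\<eta> (f t)))"
      by (subst Bochner_Integration.integrable_cong[OF refl n]) auto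
    have "(LINT t|M. f t * \<eta> (f t)) = (LINT t|M. of_real (a * cmod (\<eta> (f t))))"
      using pos a by (intro Bochner_Integration.integral_cong refl) (auto simp: \<eta>_def sgn norm_divide norm_sgn)
    also have "\<dots> = of_real a" by (simp only: integral_complex_of_real integral_mult_right_zero i mult_1_right)
    finally show ?thesis using that[of \<eta>] i ii True by (simp add: Lr_norm_pos Lr_space_pos a_def)
  next
    case False
    with s have s0: "0 < s" by simp
    define e where "e = 1 / s - 1"
    have e: "0 \<le> e" using s0 s by (simp add: e_def)
    define \<eta> where "\<eta> = (\<lambda>x. cnj (sgn x) * of_real ((cmod x / a) powr e))"
    have [measurable]: "\<eta> \<in> borel_measurable borel" unfolding \<eta>_def by measurable
    have n: "cmod (\<eta> x) \<le> (cmod x / a) powr e" for x by (simp add: \<eta>_def norm_mult norm_sgn)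
    have fa: "(\<lambda>t. f t / of_real a) \<in> Lr_space M s" "Lr_norm M s (\<lambda>t. f t / of_real a) = 1"
    proof -
      show "(\<lambda>t. f t / of_real a) \<in> Lr_space M s"
        by (rule Lr_space_cmult_mono[OF fL, where c="1/a"]) (use a s in \<open>auto simp: norm_divide\<close>)
      have "Lr_norm M s (\<lambda>t. f t / of_real a) = (1 / a) * Lr_norm M s f"
        by (rule Lr_norm_cmult[OF fL]) (use a s in \<open>auto simp: norm_divide\<close>)
      then show "Lr_norm M s (\<lambda>t. f t / of_real a) = 1" using a by (simp add: a_def)
    qed
    have L: "(\<lambda>t. \<eta> (f t)) \<in> Lr_space M (1 - s)"
      by (rule Lr_space_powr[OF fa(1), where r=e]) (use s s0 n a in \<open>auto simp: e_def diff_divide_distrib norm_divide\<close>)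
    have le: "Lr_norm M (1 - s) (\<lambda>t. \<eta> (f t)) \<le> Lr_norm M s (\<lambda>t. f t / of_real a) powr e"
      by (rule Lr_norm_powr_le[OF fa(1), where r=e]) (use s s0 n a in \<open>auto simp: e_def diff_divide_distrib norm_divide\<close>)
    have "f t * \<eta> (f t) = of_real (cmod (f t) powr (1 / s) / a powr e)" for t
    proof -
      have "f t * \<eta> (f t) = of_real (cmod (f t) * (cmod (f t) / a) powr e)"
        by (simp add: \<eta>_def sgn flip: mult.assoc)
      also have "cmod (f t) * (cmod (f t) / a) powr e = cmod (f t) powr (1 / s) / a powr e"
        using a by (cases "f t = 0") (auto simp: powr_divide e_def powr_diff)
      finally show ?thesis .
    qed
    then have "(LINT t|M. f t * \<eta> (f t)) = of_real ((LINT t|M. cmod (f t) powr (1 / s)) / a powr e)"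
      by (simp only: integral_complex_of_real integral_divide_zero)
    also have "(LINT t|M. cmod (f t) powr (1 / s)) / a powr e = a"
      using s0 a by (simp add: a_def e_def powr_diff flip: Lr_norm_powr)
    finally show ?thesis using that[of \<eta>] L le fa(2) by (simp add: a_def)
  qed
qed

section \<open>Approximation by functions of finite range, and the three lines theorem\<close>

text \<open>A quantisation on the grid of mesh 1 / n, cut off outside the disc of radius n so that
  its range is finite. It is a fixed Borel function of the value, so it may be composed with any
  measurable function.\<close>

definition grid_round :: "nat \<Rightarrow> complex \<Rightarrow> complex" where
  "grid_round n z = (if cmod z \<le> real n
     then Complex (of_int \<lfloor>real n * Re z\<rfloor> / real n) (of_int \<lfloor>real n * Im z\<rfloor> / real n) else 0)"

lemma grid_round_measurable [measurable]: "grid_round n \<in> borel_measurable borel"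
proof -
  have "(\<lambda>z. if cmod z \<le> real n then of_real (of_int \<lfloor>real n * Re z\<rfloor> / real n) +
      \<i> * of_real (of_int \<lfloor>real n * Im z\<rfloor> / real n) else (0::complex)) \<in> borel_measurable borel"
    by measurable
  also have "(\<lambda>z. if cmod z \<le> real n then of_real (of_int \<lfloor>real n * Re z\<rfloor> / real n) +
      \<i> * of_real (of_int \<lfloor>real n * Im z\<rfloor> / real n) else (0::complex)) = grid_round n"
    by (auto simp: fun_eq_iff grid_round_def complex_eq_iff)
  finally show ?thesis .
qed

lemma finite_range_grid_round: "finite (range (grid_round n))"
proof -
  let ?S = "{- int (n * n)..int (n * n)}"
  have fl: "\<lfloor>real n * x\<rfloor> \<in> ?S" if "\<bar>x\<bar> \<le> real n" for x
  proof -
    have "\<bar>real n * x\<bar> \<le> real n * real n" using that by (simp add: abs_mult mult_left_mono)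
    then show ?thesis by (auto simp: le_floor_iff floor_le_iff abs_le_iff)
  qed
  have "range (grid_round n) \<subseteq>
      insert 0 ((\<lambda>(i, j). Complex (of_int i / real n) (of_int j / real n)) ` (?S \<times> ?S))"
  proof clarify
    fix z assume nz: "grid_round n z \<notin> (\<lambda>(i, j). Complex (of_int i / real n) (of_int j / real n)) ` (?S \<times> ?S)"
    show "grid_round n z = 0"
    proof (rule ccontr)
      assume "grid_round n z \<noteq> 0"
      then have "cmod z \<le> real n" by (auto simp: grid_round_def split: if_splits)
      then have "\<bar>Re z\<bar> \<le> real n" "\<bar>Im z\<bar> \<le> real n"
        using abs_Re_le_cmod[of z] abs_Im_le_cmod[of z] by linarith+
      then have "(\<lfloor>real n * Re z\<rfloor>, \<lfloor>real n * Im z\<rfloor>) \<in> ?S \<times> ?S" using fl by blast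
      with nz \<open>cmod z \<le> real n\<close> show False by (auto simp: grid_round_def image_iff)
    qed
  qed
  then show ?thesis by (rule finite_subset) auto
qed

lemma grid_round_error:
  assumes "1 \<le> n"
  shows "cmod z \<le> real n \<Longrightarrow> cmod (z - grid_round n z) \<le> 2 / real n"
    and "cmod (z - grid_round n z) \<le> 2 + cmod z"
proof -
  have n: "1 \<le> real n" using assms by simp
  have fl: "\<bar>x - of_int \<lfloor>real n * x\<rfloor> / real n\<bar> \<le> 1 / real n" for x :: real
  proof -
    have "\<bar>real n * x - of_int \<lfloor>real n * x\<rfloor>\<bar> \<le> 1" by linarith
    then have "\<bar>real n * x - of_int \<lfloor>real n * x\<rfloor>\<bar> / real n \<le> 1 / real n"
      using n by (intro divide_right_mono) auto
    also have "\<bar>real n * x - of_int \<lfloor>real n * x\<rfloor>\<bar> / real n = \<bar>x - of_int \<lfloor>real n * x\<rfloor> / real n\<bar>"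
    proof -
      have "x - of_int \<lfloor>real n * x\<rfloor> / real n = (real n * x - of_int \<lfloor>real n * x\<rfloor>) / real n"
        using n by (simp add: diff_divide_distrib)
      then show ?thesis using n by (simp add: abs_divide)
    qed
    finally show ?thesis .
  qed
  show *: "cmod (z - grid_round n z) \<le> 2 / real n" if "cmod z \<le> real n" for z
  proof -
    have "cmod (z - grid_round n z) \<le> \<bar>Re (z - grid_round n z)\<bar> + \<bar>Im (z - grid_round n z)\<bar>"
      by (rule cmod_le)
    also have "\<dots> \<le> 1 / real n + 1 / real n"
      using that fl by (intro add_mono) (simp_all add: grid_round_def)
    finally show ?thesis by simp
  qed
  show "cmod (z - grid_round n z) \<le> 2 + cmod z"
  proof (cases "cmod z \<le> real n")
    case True
    have "2 / real n \<le> 2" using n by (simp add: field_simps)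
    with *[OF True] norm_ge_zero[of z] show ?thesis by linarith
  qed (simp add: grid_round_def)
qed

text \<open>For \<open>s = 0\<close> the cut-off is eventually inactive and the mesh gives uniform
  convergence. For \<open>s > 0\<close> dominated convergence applies with the majorant (2 + |f|)^(1
  / s), integrable because constants belong to the space over a finite measure.\<close>

lemma (in finite_measure) Lr_norm_grid_round_tendsto:
  fixes f :: "'a \<Rightarrow> complex"
  assumes f: "f \<in> Lr_space M s" and s: "0 \<le> s" "s \<le> 1"
  shows "(\<lambda>n. Lr_norm M s (\<lambda>t. f t - grid_round n (f t))) \<longlonglongrightarrow> 0"
proof (cases "s = 0")
  case True
  note [measurable] = Lr_space_measurable[OF f]
  have "eventually (\<lambda>n. Lr_norm M 0 (\<lambda>t. f t - grid_round n (f t)) \<le> 2 / real n) sequentially"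
    using eventually_ge_at_top[of "nat \<lceil>Lr_norm M 0 f\<rceil> + 1"]
  proof eventually_elim
    case (elim n)
    then have n: "1 \<le> n" "Lr_norm M 0 f \<le> real n" by linarith+
    have "AE t in M. cmod (f t) \<le> real n" using Lr_norm_zero_AE[of f M] f True n(2) by auto
    then have "AE t in M. cmod (f t - grid_round n (f t)) \<le> 2 / real n"
      by eventually_elim (rule grid_round_error(1)[OF n(1)])
    then show ?case by (intro Lr_norm_zero_le) auto
  qed
  moreover have "(\<lambda>n. 2 / real n) \<longlonglongrightarrow> 0" by (rule lim_const_over_n)
  ultimately show ?thesis unfolding True
    by (rule tendsto_sandwich[OF _ _ tendsto_const[of 0], rotated]) auto
next
  case False
  with s have s0: "0 < s" by simp
  note [measurable] = Lr_space_measurable[OF f]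
  have "(\<lambda>t. cmod (f t)) \<in> Lr_space M s" by (rule Lr_space_cong[OF f]) (use s in auto)
  from Lr_space_add[OF Lr_space_bounded[of "\<lambda>_. 2" s 2] this s, of "\<lambda>t. 2 + cmod (f t)"]
  have "(\<lambda>t. 2 + cmod (f t)) \<in> Lr_space M s" using s by simp
  then have dom: "integrable M (\<lambda>t. (2 + cmod (f t)) powr (1 / s))"
    using s0 by (simp add: Lr_space_pos)
  \<comment> \<open>The error bounds hold for mesh parameter at least 1, hence the shift to
    \<open>Suc n\<close>, undone at the end.\<close>
  have "(\<lambda>n. LINT t|M. cmod (f t - grid_round (Suc n) (f t)) powr (1 / s)) \<longlonglongrightarrow> (LINT t|M. 0)"
  proof (rule integral_dominated_convergence[OF _ _ dom])
    show "AE t in M. (\<lambda>n. cmod (f t - grid_round (Suc n) (f t)) powr (1 / s)) \<longlonglongrightarrow> 0"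
    proof (rule AE_I2)
      fix t
      have "eventually (\<lambda>n. cmod (f t - grid_round (Suc n) (f t)) \<le> 2 / real (Suc n)) sequentially"
        using eventually_ge_at_top[of "nat \<lceil>cmod (f t)\<rceil>"]
        by eventually_elim (rule grid_round_error(1), simp, linarith)
      moreover have "(\<lambda>n. 2 / real (Suc n)) \<longlonglongrightarrow> 0" by (rule LIMSEQ_Suc[OF lim_const_over_n])
      ultimately have "(\<lambda>n. cmod (f t - grid_round (Suc n) (f t))) \<longlonglongrightarrow> 0"
        by (rule tendsto_sandwich[OF _ _ tendsto_const[of 0], rotated]) auto
      then show "(\<lambda>n. cmod (f t - grid_round (Suc n) (f t)) powr (1 / s)) \<longlonglongrightarrow> 0"
        by (rule tendsto_zero_powrI[OF _ tendsto_const]) (use s0 in auto)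
    qed
    show "AE t in M. norm (cmod (f t - grid_round (Suc n) (f t)) powr (1 / s)) \<le> (2 + cmod (f t)) powr (1 / s)" for n
      using grid_round_error(2)[of "Suc n"] s0 by (auto intro!: powr_mono2)
  qed auto
  then have "(\<lambda>n. Lr_norm M s (\<lambda>t. f t - grid_round (Suc n) (f t))) \<longlonglongrightarrow> 0"
    unfolding Lr_norm_pos[OF s0] by (intro tendsto_zero_powrI[OF _ tendsto_const]) (use s0 in auto)
  then show ?thesis by (rule LIMSEQ_imp_Suc)
qed

text \<open>
  The factor \<open>exp (\<epsilon> (z\<^sup>2 - 1))\<close> has modulus at most 1 on the strip and decays at its ends, so that
  the maximum principle applies on a large rectangle; then \<open>\<epsilon> \<longrightarrow> 0\<close>.
\<close>

lemma three_lines_unit: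
  assumes hol: "f holomorphic_on UNIV"
    and bdd: "\<And>z. 0 \<le> Re z \<Longrightarrow> Re z \<le> 1 \<Longrightarrow> cmod (f z) \<le> K"
    and le0: "\<And>z. Re z = 0 \<Longrightarrow> cmod (f z) \<le> 1" and le1: "\<And>z. Re z = 1 \<Longrightarrow> cmod (f z) \<le> 1"
    and z: "0 \<le> Re z" "Re z \<le> 1"
  shows "cmod (f z) \<le> 1"
proof -
  have eps: "cmod (f z * exp (of_real \<epsilon> * (z\<^sup>2 - 1))) \<le> 1" if "0 < \<epsilon>" for \<epsilon> :: real
  proof -
    let ?g = "\<lambda>z. f z * exp (of_real \<epsilon> * (z\<^sup>2 - 1))"
    have K0: "0 \<le> K" using bdd[OF z] norm_ge_zero order_trans by blast
    have ex: "cmod (exp (of_real \<epsilon> * (w\<^sup>2 - 1))) \<le> exp (- \<epsilon> * (Im w)\<^sup>2)" if "0 \<le> Re w" "Re w \<le> 1" for w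
    proof -
      have "(Re w)\<^sup>2 \<le> 1" using that by (simp add: power_le_one)
      then have "\<epsilon> * ((Re w)\<^sup>2 - (Im w)\<^sup>2 - 1) \<le> \<epsilon> * (- (Im w)\<^sup>2)"
        using \<open>0 < \<epsilon>\<close> by (intro mult_left_mono) auto
      then show ?thesis by (simp add: norm_exp_eq_Re power2_eq_square)
    qed
    \<comment> \<open>The height is chosen so that z lies in the rectangle and K \<le> \<epsilon> R
      \<le> \<epsilon> R^2. Then K is at most exp (\<epsilon> R^2), and the decaying factor brings
      the horizontal edges below 1.\<close>
    define R where "R = \<bar>Im z\<bar> + 1 + K / \<epsilon>"
    have R: "1 \<le> R" "\<bar>Im z\<bar> \<le> R" "K \<le> \<epsilon> * R" using K0 that by (auto simp: R_def field_simps)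
    have far: "K * exp (- \<epsilon> * R\<^sup>2) \<le> 1"
    proof -
      have "K \<le> \<epsilon> * R * R" using R K0 mult_mono[of K "\<epsilon> * R" 1 R] by simp
      then have "K \<le> exp (\<epsilon> * R\<^sup>2)"
        using exp_ge_add_one_self[of "\<epsilon> * R\<^sup>2"] unfolding power2_eq_square mult.assoc by linarith
      then show ?thesis by (simp add: exp_minus field_simps)
    qed
    have hg: "?g holomorphic_on UNIV" by (intro holomorphic_intros hol)
    have Re_z: "Re w \<in> {0..1}" "Im w \<in> {-R..R}" if "w \<in> cbox (Complex 0 (-R)) (Complex 1 R)" for w
      using that by (auto simp: in_cbox_complex_iff)
    show ?thesis
    proof (rule maximum_modulus_frontier[of ?g "cbox (Complex 0 (-R)) (Complex 1 R)"])
      fix w assume w: "w \<in> frontier (cbox (Complex 0 (-R)) (Complex 1 R))"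
      then have wc: "w \<in> cbox (Complex 0 (-R)) (Complex 1 R)" and wb: "w \<notin> box (Complex 0 (-R)) (Complex 1 R)"
        by (auto simp: frontier_cbox)
      have e: "cmod (?g w) \<le> cmod (f w) * exp (- \<epsilon> * (Im w)\<^sup>2)"
        using ex[of w] Re_z[OF wc] by (simp add: norm_mult mult_left_mono)
      consider "Re w = 0" | "Re w = 1" | "\<bar>Im w\<bar> = R"
        using Re_z[OF wc] wb by (auto simp: in_box_complex_iff)
      then show "cmod (?g w) \<le> 1"
      proof cases
        case 3
        have "(Im w)\<^sup>2 = R\<^sup>2" using 3 by (metis power2_abs)
        have "cmod (?g w) \<le> K * exp (- \<epsilon> * (Im w)\<^sup>2)"
          using e bdd[of w] Re_z[OF wc] by (auto intro: order_trans mult_right_mono)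
        with far \<open>(Im w)\<^sup>2 = R\<^sup>2\<close> show ?thesis by simp
      qed (use e le0[of w] le1[of w] \<open>0 < \<epsilon>\<close> in \<open>auto intro!: order_trans[OF e] mult_le_one\<close>)
    qed (use R z in \<open>auto simp: in_cbox_complex_iff intro: holomorphic_on_subset[OF hg]
        holomorphic_on_imp_continuous_on[OF holomorphic_on_subset[OF hg]]\<close>)
  qed
  have lim: "((\<lambda>\<epsilon>. cmod (f z * exp (of_real \<epsilon> * (z\<^sup>2 - 1)))) \<longlongrightarrow> cmod (f z * exp (of_real 0 * (z\<^sup>2 - 1)))) (at_right 0)"
    by (intro tendsto_intros)
  have "cmod (f z * exp (of_real 0 * (z\<^sup>2 - 1))) \<le> 1"
    by (rule tendsto_upperbound[OF lim]) (auto simp: eventually_at_right_less eps eventually_at_filter)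
  then show ?thesis by simp
qed

lemma three_lines:
  assumes hol: "f holomorphic_on UNIV"
    and bdd: "\<And>z. 0 \<le> Re z \<Longrightarrow> Re z \<le> 1 \<Longrightarrow> cmod (f z) \<le> K"
    and le0: "\<And>z. Re z = 0 \<Longrightarrow> cmod (f z) \<le> A" and le1: "\<And>z. Re z = 1 \<Longrightarrow> cmod (f z) \<le> B"
    and pos: "0 < A" "0 < B" and z: "0 \<le> Re z" "Re z \<le> 1"
  shows "cmod (f z) \<le> A powr (1 - Re z) * B powr Re z"
proof -
  \<comment> \<open>This is A^(z - 1) B^(-z): entire, bounded on the strip, of modulus 1 / A on the
    left edge and 1 / B on the right edge, so that its product with \<open>f\<close> falls under the
    unit case.\<close>
  define h where "h z = exp ((z - 1) * of_real (ln A) - z * of_real (ln B))" for z :: complex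
  have h: "cmod (h z) = inverse (A powr (1 - Re z) * B powr Re z)" for z
  proof -
    have "Re ((z - 1) * of_real (ln A) - z * of_real (ln B)) = - ((1 - Re z) * ln A + Re z * ln B)"
      unfolding minus_complex.sel times_complex.sel by (simp add: left_diff_distrib)
    then have "cmod (h z) = exp (- ((1 - Re z) * ln A + Re z * ln B))"
      unfolding h_def norm_exp_eq_Re by (rule arg_cong)
    also have "\<dots> = inverse (A powr (1 - Re z) * B powr Re z)"
      using pos unfolding powr_def exp_minus exp_add by auto
    finally show ?thesis .
  qed
  have cont: "continuous_on {0..1} (\<lambda>x. inverse (A powr (1 - x) * B powr x))"
    using pos by (intro continuous_intros) auto
  have "bounded ((\<lambda>x. inverse (A powr (1 - x) * B powr x)) ` {0..1})"
    by (intro compact_imp_bounded compact_continuous_image[OF cont]) auto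
  then obtain L where "\<forall>y\<in>(\<lambda>x. inverse (A powr (1 - x) * B powr x)) ` {0..1}. norm y \<le> L"
    unfolding bounded_iff ..
  then have L: "inverse (A powr (1 - x) * B powr x) \<le> L" if "0 \<le> x" "x \<le> 1" for x
    using that by fastforce
  have "cmod (f z * h z) \<le> 1"
  proof (rule three_lines_unit[of "\<lambda>z. f z * h z" "K * L"])
    show "(\<lambda>z. f z * h z) holomorphic_on UNIV" unfolding h_def by (intro holomorphic_intros hol)
    fix w :: complex
    show "cmod (f w * h w) \<le> K * L" if "0 \<le> Re w" "Re w \<le> 1"
      unfolding norm_mult h using bdd[OF that] L[OF that] order_trans[OF norm_ge_zero bdd[OF that]]
      by (intro mult_mono) auto
    show "cmod (f w * h w) \<le> 1" if "Re w = 0"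
      unfolding norm_mult h using le0[OF that] that pos by (simp add: field_simps)
    show "cmod (f w * h w) \<le> 1" if "Re w = 1"
      unfolding norm_mult h using le1[OF that] that pos by (simp add: field_simps)
  qed (use z in auto)
  then show ?thesis unfolding norm_mult h using pos by (simp add: field_simps)
qed

section \<open>Mixed norms\<close>

text \<open>The outer exponent and the weights do not occur: over a finite index set they affect the
  norm but not membership.\<close>

definition mixed_space :: "'i set \<Rightarrow> ('i \<Rightarrow> 'a measure) \<Rightarrow> real \<Rightarrow> ('i \<Rightarrow> 'a \<Rightarrow> complex) set" where
  "mixed_space I \<mu> s = {g. \<forall>u\<in>I. g u \<in> Lr_space (\<mu> u) s}"

text \<open>The outer norm is an \<open>Lr_norm\<close> over counting measure, so the inequalities
  of Hoelder and Minkowski and the power rule apply to it directly.\<close>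

definition mixed_norm :: "'i set \<Rightarrow> ('i \<Rightarrow> 'a measure) \<Rightarrow> ('i \<Rightarrow> real) \<Rightarrow> real \<Rightarrow> real \<Rightarrow> ('i \<Rightarrow> 'a \<Rightarrow> complex) \<Rightarrow> real" where
  "mixed_norm I \<mu> w s r g = Lr_norm (count_space I) r (\<lambda>u. w u * Lr_norm (\<mu> u) s (g u))"

text \<open>Bilinear, without conjugation, so that analytic dependence of both arguments on z is
  preserved.\<close>

definition pairing :: "'i set \<Rightarrow> ('i \<Rightarrow> 'a measure) \<Rightarrow> ('i \<Rightarrow> 'a \<Rightarrow> complex) \<Rightarrow> ('i \<Rightarrow> 'a \<Rightarrow> complex) \<Rightarrow> complex" where
  "pairing I \<mu> h \<phi> = (\<Sum>v\<in>I. LINT t|\<mu> v. h v t * \<phi> v t)"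

lemma Lr_space_count_space:
  fixes h :: "'i \<Rightarrow> real"
  assumes "finite I" "0 \<le> r"
  shows "h \<in> Lr_space (count_space I) r"
proof -
  interpret finite_measure "count_space I" by (rule finite_measure_count_space[OF assms(1)])
  show ?thesis by (rule Lr_space_bounded[where C = "\<Sum>u\<in>I. \<bar>h u\<bar>"])
       (use assms in \<open>auto simp: AE_count_space intro: member_le_sum\<close>)
qed

lemma Lr_norm_count_space_mono:
  fixes a b :: "'i \<Rightarrow> real"
  assumes "finite I" "0 \<le> r" "0 \<le> c" "\<And>u. u \<in> I \<Longrightarrow> \<bar>a u\<bar> \<le> c * \<bar>b u\<bar>"
  shows "Lr_norm (count_space I) r a \<le> c * Lr_norm (count_space I) r b"
  by (rule Lr_norm_cmult_mono[OF Lr_space_count_space[OF assms(1,2)]])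
     (use assms in \<open>auto simp: AE_count_space\<close>)

lemma mixed_norm_nonneg [simp]: "0 \<le> mixed_norm I \<mu> w s r g"
  by (simp add: mixed_norm_def)



lemma mixed_norm_cmult:
  assumes "finite I" "0 \<le> s" "0 \<le> r" "0 \<le> c" "\<And>u. u \<in> I \<Longrightarrow> 0 \<le> w u" and g: "g \<in> mixed_space I \<mu> s"
    and h: "\<And>u. u \<in> I \<Longrightarrow> h u \<in> borel_measurable (\<mu> u)"
    and eq: "\<And>u. u \<in> I \<Longrightarrow> AE t in \<mu> u. norm (h u t) = c * norm (g u t)"
  shows "mixed_norm I \<mu> w s r h = c * mixed_norm I \<mu> w s r g"
  unfolding mixed_norm_def
proof (rule Lr_norm_cmult[OF Lr_space_count_space])
  have "Lr_norm (\<mu> u) s (h u) = c * Lr_norm (\<mu> u) s (g u)" if "u \<in> I" for u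
    by (rule Lr_norm_cmult) (use g h eq assms that in \<open>auto simp: mixed_space_def\<close>)
  then show "AE u in count_space I. norm (w u * Lr_norm (\<mu> u) s (h u)) = c * norm (w u * Lr_norm (\<mu> u) s (g u))"
    using assms by (auto simp: AE_count_space abs_mult)
qed (use assms in auto)

lemma mixed_norm_triangle:
  assumes I: "finite I" and sr: "0 \<le> s" "s \<le> 1" "0 \<le> r" "r \<le> 1" and w: "\<And>u. u \<in> I \<Longrightarrow> 0 \<le> w u"
    and g: "g \<in> mixed_space I \<mu> s" and h: "h \<in> mixed_space I \<mu> s"
    and k: "\<And>u. u \<in> I \<Longrightarrow> k u \<in> borel_measurable (\<mu> u)"
    and le: "\<And>u. u \<in> I \<Longrightarrow> AE t in \<mu> u. norm (k u t) \<le> norm (g u t) + norm (h u t)"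
  shows "mixed_norm I \<mu> w s r k \<le> mixed_norm I \<mu> w s r g + mixed_norm I \<mu> w s r h"
  unfolding mixed_norm_def
proof (rule Lr_norm_triangle[OF Lr_space_count_space Lr_space_count_space])
  have "w u * Lr_norm (\<mu> u) s (k u) \<le> w u * Lr_norm (\<mu> u) s (g u) + w u * Lr_norm (\<mu> u) s (h u)"
    if "u \<in> I" for u
    unfolding distrib_left[symmetric]
    by (intro mult_left_mono Lr_norm_triangle) (use g h k le sr w that in \<open>auto simp: mixed_space_def\<close>)
  then show "AE u in count_space I. norm (w u * Lr_norm (\<mu> u) s (k u))
      \<le> norm (w u * Lr_norm (\<mu> u) s (g u)) + norm (w u * Lr_norm (\<mu> u) s (h u))"
    using w by (auto simp: AE_count_space abs_mult)
qed (use I sr in auto)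

lemma mixed_norm_Hoelder:
  assumes I: "finite I" and sr: "0 \<le> s" "s \<le> 1" "0 \<le> r" "r \<le> 1" and w: "\<And>u. u \<in> I \<Longrightarrow> 0 < w u"
    and h: "h \<in> mixed_space I \<mu> s" and \<phi>: "\<phi> \<in> mixed_space I \<mu> (1 - s)"
  shows "cmod (pairing I \<mu> h \<phi>) \<le>
    mixed_norm I \<mu> w s r h * mixed_norm I \<mu> (\<lambda>u. 1 / w u) (1 - s) (1 - r) \<phi>"
proof -
  let ?a = "\<lambda>u. w u * Lr_norm (\<mu> u) s (h u)" and ?b = "\<lambda>u. 1 / w u * Lr_norm (\<mu> u) (1 - s) (\<phi> u)"
  have "cmod (pairing I \<mu> h \<phi>) \<le> (\<Sum>u\<in>I. cmod (LINT t|\<mu> u. h u t * \<phi> u t))"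
    unfolding pairing_def by (rule norm_sum)
  also have "\<dots> \<le> (\<Sum>u\<in>I. norm (?a u) * norm (?b u))"
  proof (rule sum_mono)
    fix u assume u: "u \<in> I"
    have "cmod (LINT t|\<mu> u. h u t * \<phi> u t) \<le> Lr_norm (\<mu> u) s (h u) * Lr_norm (\<mu> u) (1 - s) (\<phi> u)"
      by (rule Lr_Hoelder_complex(2)) (use h \<phi> sr u in \<open>auto simp: mixed_space_def\<close>)
    then show "cmod (LINT t|\<mu> u. h u t * \<phi> u t) \<le> norm (?a u) * norm (?b u)"
      using w[OF u] by (simp add: abs_mult)
  qed
  also have "\<dots> = (LINT u|count_space I. norm (?a u) * norm (?b u))"
    using I by (simp add: lebesgue_integral_count_space_finite)
  also have "\<dots> \<le> Lr_norm (count_space I) r ?a * Lr_norm (count_space I) (1 - r) ?b"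
    by (rule Lr_norm_Hoelder(2)) (use I sr in \<open>auto intro: Lr_space_count_space\<close>)
  finally show ?thesis by (simp add: mixed_norm_def)
qed

text \<open>The scalar result is used twice: inside each component, giving \<open>\<eta> u\<close>,
  and for the finite sequence of weighted component norms, giving \<open>c\<close>. The dual family
  is their product times \<open>w u\<close>, a factor that cancels against the dual weight 1 /
  w.\<close>

lemma mixed_norm_converse_Hoelder:
  assumes I: "finite I" and \<mu>: "\<And>u. u \<in> I \<Longrightarrow> finite_measure (\<mu> u)"
    and sr: "0 \<le> s" "s \<le> 1" "0 \<le> r" "r \<le> 1" and w: "\<And>u. u \<in> I \<Longrightarrow> 0 < w u"
    and h: "\<And>u. u \<in> I \<Longrightarrow> h u \<in> borel_measurable (\<mu> u)" "\<And>u. u \<in> I \<Longrightarrow> finite (range (h u))"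
  obtains \<phi> where "\<And>u. u \<in> I \<Longrightarrow> \<phi> u \<in> borel_measurable (\<mu> u)" "\<And>u. u \<in> I \<Longrightarrow> finite (range (\<phi> u))"
    "mixed_norm I \<mu> (\<lambda>u. 1 / w u) (1 - s) (1 - r) \<phi> \<le> 1"
    "pairing I \<mu> h \<phi> = of_real (mixed_norm I \<mu> w s r h)"
proof -
  define P where "P u \<eta> \<longleftrightarrow> (\<lambda>t. \<eta> (h u t)) \<in> Lr_space (\<mu> u) (1 - s) \<and>
    Lr_norm (\<mu> u) (1 - s) (\<lambda>t. \<eta> (h u t)) \<le> 1 \<and>
    (LINT t|\<mu> u. h u t * \<eta> (h u t)) = of_real (Lr_norm (\<mu> u) s (h u))" for u \<eta>
  have "\<forall>u\<in>I. \<exists>\<eta>. P u \<eta>"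
  proof
    fix u assume u: "u \<in> I"
    obtain \<eta> where "P u \<eta>"
      by (rule finite_measure.Lr_norm_converse_Hoelder[OF \<mu>[OF u] h(1)[OF u] h(2)[OF u] sr(1,2)])
         (simp add: P_def)
    then show "\<exists>\<eta>. P u \<eta>" by blast
  qed
  from bchoice[OF this] obtain \<eta> where "\<forall>u\<in>I. P u (\<eta> u)" ..
  then have \<eta>: "(\<lambda>t. \<eta> u (h u t)) \<in> Lr_space (\<mu> u) (1 - s)"
    "Lr_norm (\<mu> u) (1 - s) (\<lambda>t. \<eta> u (h u t)) \<le> 1"
    "(LINT t|\<mu> u. h u t * \<eta> u (h u t)) = of_real (Lr_norm (\<mu> u) s (h u))" if "u \<in> I" for u
    using that unfolding P_def by auto
  let ?n = "\<lambda>u. w u * Lr_norm (\<mu> u) s (h u)"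
  interpret C: finite_measure "count_space I" by (rule finite_measure_count_space[OF I])
  \<comment> \<open>The value 0 outside \<open>I\<close> makes the range finite over the whole index
    type, as the converse inequality requires.\<close>
  define N where "N = (\<lambda>u. if u \<in> I then complex_of_real (?n u) else 0)"
  have N: "N \<in> borel_measurable (count_space I)" "finite (range N)"
  proof -
    show "finite (range N)"
      by (rule finite_subset[of _ "insert 0 (N ` I)"]) (use I in \<open>auto simp: N_def\<close>)
  qed simp
  obtain c where c: "(\<lambda>u. c (N u)) \<in> Lr_space (count_space I) (1 - r)"
    "Lr_norm (count_space I) (1 - r) (\<lambda>u. c (N u)) \<le> 1"
    "(LINT u|count_space I. N u * c (N u)) = of_real (Lr_norm (count_space I) r N)"
    by (rule C.Lr_norm_converse_Hoelder[OF N sr(3,4)]) (rule that)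
  have Nn: "Lr_norm (count_space I) r N = mixed_norm I \<mu> w s r h"
    unfolding mixed_norm_def
    by (rule Lr_norm_cong[OF Lr_space_count_space]) (use I sr w in \<open>auto simp: AE_count_space N_def norm_mult abs_mult\<close>)
  define \<phi> where "\<phi> = (\<lambda>u t. of_real (w u) * c (N u) * \<eta> u (h u t))"
  show ?thesis
  proof
    show meas: "\<phi> u \<in> borel_measurable (\<mu> u)" if "u \<in> I" for u
      using \<eta>(1)[OF that, THEN Lr_space_measurable] unfolding \<phi>_def by measurable
    show "finite (range (\<phi> u))" if "u \<in> I" for u
    proof -
      have "range (\<phi> u) = (\<lambda>x. of_real (w u) * c (N u) * \<eta> u x) ` range (h u)" by (auto simp: \<phi>_def)
      then show ?thesis using h(2)[OF that] by simp
    qed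
    have "Lr_norm (\<mu> u) (1 - s) (\<phi> u) \<le> w u * cmod (c (N u))" if u: "u \<in> I" for u
    proof -
      have "Lr_norm (\<mu> u) (1 - s) (\<phi> u) \<le> (w u * cmod (c (N u))) * Lr_norm (\<mu> u) (1 - s) (\<lambda>t. \<eta> u (h u t))"
        by (rule Lr_norm_cmult_mono[OF \<eta>(1)[OF u] _ _ meas[OF u]])
           (use sr w[OF u] in \<open>auto simp: \<phi>_def norm_mult\<close>)
      also have "\<dots> \<le> (w u * cmod (c (N u))) * 1"
        by (intro mult_left_mono \<eta>(2)[OF u]) (use w[OF u] in auto)
      finally show ?thesis by simp
    qed
    then have "mixed_norm I \<mu> (\<lambda>u. 1 / w u) (1 - s) (1 - r) \<phi> \<le> Lr_norm (count_space I) (1 - r) (\<lambda>u. c (N u))"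
      unfolding mixed_norm_def by (intro Lr_norm_mono[OF c(1)])
         (use sr w in \<open>auto simp: AE_count_space abs_mult pos_divide_le_eq mult.commute abs_of_pos\<close>)
    with c(2) show "mixed_norm I \<mu> (\<lambda>u. 1 / w u) (1 - s) (1 - r) \<phi> \<le> 1" by linarith
    have "pairing I \<mu> h \<phi> = (\<Sum>u\<in>I. of_real (w u) * c (N u) * (LINT t|\<mu> u. h u t * \<eta> u (h u t)))"
      unfolding pairing_def \<phi>_def
      by (intro sum.cong refl) (simp add: mult.left_commute flip: integral_mult_right_zero)
    also have "\<dots> = (\<Sum>u\<in>I. N u * c (N u))" using \<eta>(3) by (intro sum.cong) (auto simp: N_def)
    also have "\<dots> = of_real (mixed_norm I \<mu> w s r h)"
      using c(3) I by (simp add: lebesgue_integral_count_space_finite Nn)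
    finally show "pairing I \<mu> h \<phi> = of_real (mixed_norm I \<mu> w s r h)" .
  qed
qed

lemma mixed_norm_tendsto_0:
  assumes I: "finite I" and "0 \<le> r" and w: "\<And>u. u \<in> I \<Longrightarrow> 0 \<le> w u"
    and lim: "\<And>u. u \<in> I \<Longrightarrow> (\<lambda>n. Lr_norm (\<mu> u) s (g n u)) \<longlonglongrightarrow> 0"
  shows "(\<lambda>n. mixed_norm I \<mu> w s r (g n)) \<longlonglongrightarrow> 0"
proof -
  let ?K = "Lr_norm (count_space I) r (\<lambda>_. 1::real)"
  have le: "mixed_norm I \<mu> w s r (g n) \<le> (\<Sum>u\<in>I. w u * Lr_norm (\<mu> u) s (g n u)) * ?K" for n
    unfolding mixed_norm_def
  proof (rule Lr_norm_count_space_mono)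
    show "0 \<le> (\<Sum>u\<in>I. w u * Lr_norm (\<mu> u) s (g n u))" by (intro sum_nonneg) (use w in auto)
    fix u assume u: "u \<in> I"
    then show "\<bar>w u * Lr_norm (\<mu> u) s (g n u)\<bar> \<le> (\<Sum>u\<in>I. w u * Lr_norm (\<mu> u) s (g n u)) * \<bar>1\<bar>"
      using member_le_sum[OF u, of "\<lambda>u. w u * Lr_norm (\<mu> u) s (g n u)"] I w by (auto simp: abs_mult)
  qed (use assms in auto)
  have "(\<lambda>n. (\<Sum>u\<in>I. w u * Lr_norm (\<mu> u) s (g n u)) * ?K) \<longlonglongrightarrow> (\<Sum>u\<in>I. w u * 0) * ?K"
    by (intro tendsto_intros lim)
  then have "(\<lambda>n. (\<Sum>u\<in>I. w u * Lr_norm (\<mu> u) s (g n u)) * ?K) \<longlonglongrightarrow> 0" by simp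
  then show ?thesis
    by (rule tendsto_sandwich[OF _ _ tendsto_const[of 0], rotated 2]) (auto simp: le)
qed

lemma convex_combination_unit:
  fixes a b \<theta> :: real
  assumes "0 \<le> a" "a \<le> 1" "0 \<le> b" "b \<le> 1" "0 \<le> \<theta>" "\<theta> \<le> 1"
  shows "0 \<le> (1 - \<theta>) * a + \<theta> * b" "(1 - \<theta>) * a + \<theta> * b \<le> 1"
  using assms convex_bound_le[of a 1 b "1 - \<theta>" \<theta>] by auto

text \<open>These functions of z arise when a fixed value is raised to powers affine in z. The
  factor \<open>\<omega>\<close> may be 0, which covers the value 0. The class is closed under
  products and consists of entire functions bounded on the strip.\<close>

definition log_affine :: "(complex \<Rightarrow> complex) \<Rightarrow> bool" where
  "log_affine F \<longleftrightarrow> (\<exists>\<omega> (a::real) (b::real). F = (\<lambda>z. \<omega> * exp ((1 - z) * of_real a + z * of_real b)))"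

lemma log_affine_mult:
  assumes "log_affine F" "log_affine G"
  shows "log_affine (\<lambda>z. F z * G z)"
proof -
  from assms obtain \<omega> a b \<omega>' a' b' where
    F: "F = (\<lambda>z. \<omega> * exp ((1 - z) * of_real a + z * of_real b))" and
    G: "G = (\<lambda>z. \<omega>' * exp ((1 - z) * of_real a' + z * of_real b'))"
    unfolding log_affine_def by blast
  have "(\<lambda>z. F z * G z) = (\<lambda>z. (\<omega> * \<omega>') * exp ((1 - z) * of_real (a + a') + z * of_real (b + b')))"
    unfolding F G by (auto simp: fun_eq_iff exp_add distrib_left)
  then show ?thesis unfolding log_affine_def by blast
qed

lemma log_affine_holomorphic: "log_affine F \<Longrightarrow> F holomorphic_on UNIV"
  unfolding log_affine_def by (auto intro!: holomorphic_intros)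

lemma log_affine_bounded:
  assumes "log_affine F"
  obtains K where "\<And>z. 0 \<le> Re z \<Longrightarrow> Re z \<le> 1 \<Longrightarrow> cmod (F z) \<le> K"
proof -
  from assms obtain \<omega> a b where F: "F = (\<lambda>z. \<omega> * exp ((1 - z) * of_real a + z * of_real b))"
    unfolding log_affine_def by blast
  have "cmod (F z) \<le> cmod \<omega> * exp (\<bar>a\<bar> + \<bar>b\<bar>)" if z: "0 \<le> Re z" "Re z \<le> 1" for z
  proof -
    have "(1 - Re z) * a \<le> (1 - Re z) * \<bar>a\<bar>" "Re z * b \<le> Re z * \<bar>b\<bar>"
      using z by (auto intro: mult_left_mono)
    moreover have "(1 - Re z) * \<bar>a\<bar> \<le> \<bar>a\<bar>" "Re z * \<bar>b\<bar> \<le> \<bar>b\<bar>"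
      using z by (auto intro: mult_left_le_one_le)
    ultimately have "(1 - Re z) * a + Re z * b \<le> \<bar>a\<bar> + \<bar>b\<bar>" by linarith
    then show ?thesis unfolding F norm_mult norm_exp_eq_Re by (simp add: mult_left_mono)
  qed
  then show ?thesis by (rule that)
qed

section \<open>Interpolation of operators between mixed norm spaces\<close>

text \<open>\<open>E\<close> is applied to the values of \<open>g\<close> one by one. Composition
  with a function of finite range therefore has finite range, and for each single value the
  dependence on z is that of a scalar entire function. The norm bounds are recorded on the two
  edges, where the three lines theorem uses them.\<close>

definition calderon_family :: "'i set \<Rightarrow> ('i \<Rightarrow> 'a measure) \<Rightarrow> ('i \<Rightarrow> real) \<Rightarrow> ('i \<Rightarrow> 'a \<Rightarrow> complex) \<Rightarrow>
    real \<Rightarrow> real \<Rightarrow> real \<Rightarrow> real \<Rightarrow> real \<Rightarrow> (complex \<Rightarrow> 'i \<Rightarrow> complex \<Rightarrow> complex) \<Rightarrow> bool" where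
  "calderon_family I \<mu> w g s0 r0 s1 r1 \<theta> E \<longleftrightarrow>
    (\<forall>z u. E z u \<in> borel_measurable borel) \<and> (\<forall>u x. log_affine (\<lambda>z. E z u x)) \<and>
    (\<forall>u\<in>I. \<forall>x. E (of_real \<theta>) u x = x) \<and>
    (\<forall>z. Re z = 0 \<longrightarrow> (\<lambda>u t. E z u (g u t)) \<in> mixed_space I \<mu> s0 \<and> mixed_norm I \<mu> w s0 r0 (\<lambda>u t. E z u (g u t)) \<le> 1) \<and>
    (\<forall>z. Re z = 1 \<longrightarrow> (\<lambda>u t. E z u (g u t)) \<in> mixed_space I \<mu> s1 \<and> mixed_norm I \<mu> w s1 r1 (\<lambda>u t. E z u (g u t)) \<le> 1)"

lemma calderon_familyD:
  assumes "calderon_family I \<mu> w g s0 r0 s1 r1 \<theta> E"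
  shows "E z u \<in> borel_measurable borel" "log_affine (\<lambda>z. E z u x)" "u \<in> I \<Longrightarrow> E (of_real \<theta>) u x = x"
    "Re z = 0 \<Longrightarrow> (\<lambda>u t. E z u (g u t)) \<in> mixed_space I \<mu> s0"
    "Re z = 0 \<Longrightarrow> mixed_norm I \<mu> w s0 r0 (\<lambda>u t. E z u (g u t)) \<le> 1"
    "Re z = 1 \<Longrightarrow> (\<lambda>u t. E z u (g u t)) \<in> mixed_space I \<mu> s1"
    "Re z = 1 \<Longrightarrow> mixed_norm I \<mu> w s1 r1 (\<lambda>u t. E z u (g u t)) \<le> 1"
  using assms by (simp_all add: calderon_family_def)

text \<open>
  This is the Calderon factorisation \<open>g = g\<^sub>0\<^bsup>1 - \<theta>\<^esup> g\<^sub>1\<^bsup>\<theta>\<^esup>\<close> of an element of the unit ball: up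
  to weights, \<open>\<bar>E z u x\<bar> = \<bar>x\<bar>\<^bsup>a\<^esup> n\<^sub>u\<^bsup>b - a\<^esup>\<close>, where \<open>n\<^sub>u\<close> is the norm of \<open>g u\<close> and \<open>a\<close>, \<open>b\<close>
  are the ratios of the inner and of the outer exponents. A vanishing \<open>n\<^sub>u\<close> is replaced by 1.
\<close>

lemma calderon_factorization:
  fixes g :: "'i \<Rightarrow> 'a \<Rightarrow> complex"
  assumes I: "finite I" and w: "\<And>u. u \<in> I \<Longrightarrow> 0 < w u"
    and g: "g \<in> mixed_space I \<mu> s" and n1: "mixed_norm I \<mu> w s r g \<le> 1"
    and ranges: "0 \<le> s0" "0 \<le> s1" "0 \<le> r0" "0 \<le> r1"
    and \<theta>: "0 < \<theta>" "\<theta> < 1"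
    and s: "s = (1 - \<theta>) * s0 + \<theta> * s1" and r: "r = (1 - \<theta>) * r0 + \<theta> * r1"
  obtains E where "calderon_family I \<mu> w g s0 r0 s1 r1 \<theta> E"
proof -
  \<comment> \<open>The value 1 for x = 0 is consistent: since 0 < \<theta> < 1, s = 0 forces s0 =
    s1 = 0, and likewise for r.\<close>
  define \<rho> where "\<rho> x x' = (if x = 0 then 1 else x' / x)" for x x' :: real
  define n where "n u = w u * Lr_norm (\<mu> u) s (g u)" for u
  define m where "m u = (if n u = 0 then 1 else n u)" for u
  \<comment> \<open>For x \<noteq> 0 the exponential of this is (w |x|)^a m^(b - a) / w, with a and
    b the inner and the outer ratio. The exponents are balanced so that the weighted component norm
    becomes at most n^b.\<close>
  define A where "A x' y' u x = \<rho> s x' * ln (w u * cmod x) + (\<rho> r y' - \<rho> s x') * ln (m u) - ln (w u)"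
    for x' y' u and x :: complex
  define E where "E z u x = sgn x * exp ((1 - z) * of_real (A s0 r0 u x) + z * of_real (A s1 r1 u x))"
    for z u x
  have sr: "0 \<le> s" "0 \<le> r" using ranges \<theta> by (simp_all add: s r)
  have zero: "s = 0 \<Longrightarrow> s0 = 0 \<and> s1 = 0" "r = 0 \<Longrightarrow> r0 = 0 \<and> r1 = 0"
    using ranges \<theta> by (auto simp: s r add_nonneg_eq_0_iff)
  \<comment> \<open>The interpolation relations say that both ratios average to 1, which is why
    \<open>E\<close> reproduces x at z = \<theta>.\<close>
  have \<rho>1: "(1 - \<theta>) * \<rho> s s0 + \<theta> * \<rho> s s1 = 1" "(1 - \<theta>) * \<rho> r r0 + \<theta> * \<rho> r r1 = 1"
    using s r by (auto simp: \<rho>_def simp flip: add_divide_distrib)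
  \<comment> \<open>On an edge the modulus of \<open>E z u x\<close> does not depend on Im z, so one
    estimate for a function \<open>F\<close> with this modulus bound handles both edges.\<close>
  have edge: "(\<lambda>u t. F u (g u t)) \<in> mixed_space I \<mu> s' \<and> mixed_norm I \<mu> w s' r' (\<lambda>u t. F u (g u t)) \<le> 1"
    if F: "\<And>u. F u \<in> borel_measurable borel" and le: "\<And>u x. cmod (F u x) \<le> cmod (sgn x) * exp (A s' r' u x)"
      and s': "0 \<le> s'" "s = 0 \<Longrightarrow> s' = 0" and r': "0 \<le> r'" "r = 0 \<Longrightarrow> r' = 0" for F s' r'
  proof -
    define a b where "a = \<rho> s s'" and "b = \<rho> r r'"
    have a: "s = 0 \<Longrightarrow> s' = 0 \<and> a = 1" "0 < s \<Longrightarrow> a = s' / s" and b: "r = 0 \<Longrightarrow> r' = 0 \<and> b = 1" "0 < r \<Longrightarrow> b = r' / r"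
      using s' r' by (auto simp: a_def b_def \<rho>_def)
    have b0: "0 \<le> b" using b r' sr by (cases "r = 0") auto
    have "(\<lambda>t. F u (g u t)) \<in> Lr_space (\<mu> u) s' \<and> w u * Lr_norm (\<mu> u) s' (\<lambda>t. F u (g u t)) \<le> n u powr b"
      if u: "u \<in> I" for u
    proof -
      have gu: "g u \<in> Lr_space (\<mu> u) s" using g u by (simp add: mixed_space_def)
      note [measurable] = Lr_space_measurable[OF gu] F
      define k where "k = (\<lambda>t. cmod (g u t) powr a)"
      have k: "k \<in> Lr_space (\<mu> u) s'" "Lr_norm (\<mu> u) s' k \<le> Lr_norm (\<mu> u) s (g u) powr a"
        unfolding k_def
        by (rule Lr_space_powr[OF gu sr(1) s'(1) a] Lr_norm_powr_le[OF gu sr(1) s'(1) a]; simp)+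
      define c where "c = w u powr a * m u powr (b - a) / w u"
      have m: "0 < m u" using w[OF u] by (auto simp: m_def n_def less_le)
      have c: "0 \<le> c" using w[OF u] by (simp add: c_def)
      have "cmod (F u x) \<le> c * cmod x powr a" for x
      proof (cases "x = 0")
        case False
        have "exp (A s' r' u x) = (w u * cmod x) powr a * m u powr (b - a) / w u"
          using False w[OF u] m by (simp add: A_def a_def b_def powr_def exp_add exp_diff)
        with le[of u x] False show ?thesis by (simp add: c_def norm_sgn powr_mult mult_ac)
      qed (use le[of u 0] c in auto)
      then have Fk: "AE t in \<mu> u. cmod (F u (g u t)) \<le> c * norm (k t)" by (simp add: k_def)
      have FL: "(\<lambda>t. F u (g u t)) \<in> Lr_space (\<mu> u) s'"
        by (rule Lr_space_cmult_mono[OF k(1) c s'(1) _ Fk]) measurable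
      have "Lr_norm (\<mu> u) s' (\<lambda>t. F u (g u t)) \<le> c * Lr_norm (\<mu> u) s' k"
        by (rule Lr_norm_cmult_mono[OF k(1) c s'(1) _ Fk]) measurable
      also have "\<dots> \<le> c * Lr_norm (\<mu> u) s (g u) powr a" using k(2) c by (rule mult_left_mono)
      finally have "w u * Lr_norm (\<mu> u) s' (\<lambda>t. F u (g u t)) \<le> w u * (c * Lr_norm (\<mu> u) s (g u) powr a)"
        using w[OF u] by simp
      also have "\<dots> = m u powr (b - a) * n u powr a"
        using w[OF u] by (simp add: c_def n_def powr_mult)
      \<comment> \<open>Equality holds if n u \<noteq> 0. If n u = 0, both sides are 0, since
        \<open>powr\<close> with base 0 is 0 for every exponent.\<close>
      also have "\<dots> \<le> n u powr b" using m by (cases "n u = 0") (auto simp: m_def simp flip: powr_add)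
      finally show ?thesis using FL by simp
    qed
    note * = this
    have "mixed_norm I \<mu> w s' r' (\<lambda>u t. F u (g u t)) \<le> Lr_norm (count_space I) r n powr b"
      unfolding mixed_norm_def
    proof (rule Lr_norm_powr_le[OF Lr_space_count_space[OF I sr(2)] sr(2) r'(1) b])
      have "norm (w u * Lr_norm (\<mu> u) s' (\<lambda>t. F u (g u t))) \<le> norm (n u) powr b" if "u \<in> I" for u
        using *[OF that] w[OF that] by (simp add: abs_mult n_def)
      then show "AE u in count_space I. norm (w u * Lr_norm (\<mu> u) s' (\<lambda>t. F u (g u t))) \<le> norm (n u) powr b"
        by (auto simp: AE_count_space)
    qed auto
    also have "\<dots> \<le> 1 powr b"
      using n1 b0 by (intro powr_mono2) (auto simp: mixed_norm_def n_def[abs_def])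
    finally show ?thesis using * by (simp add: mixed_space_def)
  qed
  show ?thesis
  proof (rule that[of E], unfold calderon_family_def, intro conjI allI ballI impI)
    show meas: "E z u \<in> borel_measurable borel" for z u unfolding E_def A_def by measurable
    show "log_affine (\<lambda>z. E z u x)" for u x unfolding log_affine_def E_def by blast
    show "E (of_real \<theta>) u x = x" if u: "u \<in> I" for u x
    proof (cases "x = 0")
      case False
      have "(1 - \<theta>) * A s0 r0 u x + \<theta> * A s1 r1 u x =
          ((1 - \<theta>) * \<rho> s s0 + \<theta> * \<rho> s s1) * ln (w u * cmod x) +
          (((1 - \<theta>) * \<rho> r r0 + \<theta> * \<rho> r r1) - ((1 - \<theta>) * \<rho> s s0 + \<theta> * \<rho> s s1)) * ln (m u) - ln (w u)"
        unfolding A_def by algebra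
      also have "\<dots> = ln (cmod x)" unfolding \<rho>1 using False w[OF u] by (simp add: ln_mult)
      finally have *: "(1 - \<theta>) * A s0 r0 u x + \<theta> * A s1 r1 u x = ln (cmod x)" .
      have "E (of_real \<theta>) u x = sgn x * exp (of_real ((1 - \<theta>) * A s0 r0 u x + \<theta> * A s1 r1 u x))"
        by (simp add: E_def)
      also have "\<dots> = x"
        unfolding * exp_of_real using False by (simp add: sgn_div_norm scaleR_conv_of_real)
      finally show ?thesis .
    qed (simp add: E_def)
    have nE: "cmod (E z u x) = cmod (sgn x) * exp ((1 - Re z) * A s0 r0 u x + Re z * A s1 r1 u x)" for z u x
      unfolding E_def norm_mult norm_exp_eq_Re by simp
    show "(\<lambda>u t. E z u (g u t)) \<in> mixed_space I \<mu> s0" "mixed_norm I \<mu> w s0 r0 (\<lambda>u t. E z u (g u t)) \<le> 1"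
      if "Re z = 0" for z
      using edge[of "E z" s0 r0] meas nE that ranges zero by auto
    show "(\<lambda>u t. E z u (g u t)) \<in> mixed_space I \<mu> s1" "mixed_norm I \<mu> w s1 r1 (\<lambda>u t. E z u (g u t)) \<le> 1"
      if "Re z = 1" for z
      using edge[of "E z" s1 r1] meas nE that ranges zero by auto
  qed
qed

text \<open>\<open>K\<close> is any representative of c G + H, so the second clause expresses
  linearity and, with c = 0, compatibility with almost everywhere equality. The domain consists of
  the L_1 families, which contain all the mixed spaces over finite measures.\<close>

definition almost_linear :: "'i set \<Rightarrow> ('i \<Rightarrow> 'a measure) \<Rightarrow> (('i \<Rightarrow> 'a \<Rightarrow> complex) \<Rightarrow> 'i \<Rightarrow> 'a \<Rightarrow> complex) \<Rightarrow> bool" where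
  "almost_linear I \<mu> T \<longleftrightarrow>
     (\<forall>G v. G \<in> mixed_space I \<mu> 1 \<longrightarrow> v \<in> I \<longrightarrow> T G v \<in> borel_measurable (\<mu> v)) \<and>
     (\<forall>G H K c. G \<in> mixed_space I \<mu> 1 \<longrightarrow> H \<in> mixed_space I \<mu> 1 \<longrightarrow> K \<in> mixed_space I \<mu> 1 \<longrightarrow>
     (\<forall>u\<in>I. AE t in \<mu> u. K u t = c * G u t + H u t) \<longrightarrow>
     (\<forall>v\<in>I. AE t in \<mu> v. T K v t = c * T G v t + T H v t))"

lemma almost_linear_measurable:
  "almost_linear I \<mu> T \<Longrightarrow> G \<in> mixed_space I \<mu> 1 \<Longrightarrow> v \<in> I \<Longrightarrow> T G v \<in> borel_measurable (\<mu> v)"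
  unfolding almost_linear_def by meson

lemma almost_linearD:
  assumes "almost_linear I \<mu> T" "G \<in> mixed_space I \<mu> 1" "H \<in> mixed_space I \<mu> 1" "K \<in> mixed_space I \<mu> 1"
    "\<And>u. u \<in> I \<Longrightarrow> AE t in \<mu> u. K u t = c * G u t + H u t" "v \<in> I"
  shows "AE t in \<mu> v. T K v t = c * T G v t + T H v t"
  using assms unfolding almost_linear_def by meson

lemma mixed_space_add_cmult:
  fixes G H :: "'i \<Rightarrow> 'a \<Rightarrow> complex"
  assumes G: "G \<in> mixed_space I \<mu> s" and H: "H \<in> mixed_space I \<mu> s" and s: "0 \<le> s" "s \<le> 1"
  shows "(\<lambda>u t. c * G u t + H u t) \<in> mixed_space I \<mu> s"
  unfolding mixed_space_def
proof safe
  fix u assume u: "u \<in> I"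
  have Gu: "G u \<in> Lr_space (\<mu> u) s" and Hu: "H u \<in> Lr_space (\<mu> u) s"
    using G H u by (auto simp: mixed_space_def)
  note [measurable] = Lr_space_measurable[OF Gu] Lr_space_measurable[OF Hu]
  have "(\<lambda>t. c * G u t) \<in> Lr_space (\<mu> u) s"
    by (rule Lr_space_cmult_mono[OF Gu, where c = "cmod c"]) (use s in \<open>auto simp: norm_mult\<close>)
  from Lr_space_add[OF this Hu s] show "(\<lambda>t. c * G u t + H u t) \<in> Lr_space (\<mu> u) s"
    by (rule) (auto simp: norm_triangle_ineq)
qed

lemma almost_linear_zero:
  assumes T: "almost_linear I \<mu> T" and v: "v \<in> I"
  shows "AE t in \<mu> v. T (\<lambda>u t. 0) v t = 0"
proof -
  have 0: "(\<lambda>u t. 0) \<in> mixed_space I \<mu> 1" by (auto simp: mixed_space_def intro: Lr_norm_0_AE)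
  have "AE t in \<mu> v. T (\<lambda>u t. 0) v t = (-1) * T (\<lambda>u t. 0) v t + T (\<lambda>u t. 0) v t"
    by (rule almost_linearD[OF T 0 0 0 _ v]) simp
  then show ?thesis by simp
qed

lemma almost_linear_sum:
  assumes T: "almost_linear I \<mu> T" and v: "v \<in> I" and J: "finite J"
    and G: "\<And>j. j \<in> J \<Longrightarrow> G j \<in> mixed_space I \<mu> 1"
  shows "(\<lambda>u t. \<Sum>j\<in>J. c j * G j u t) \<in> mixed_space I \<mu> 1 \<and>
    (AE t in \<mu> v. T (\<lambda>u t. \<Sum>j\<in>J. c j * G j u t) v t = (\<Sum>j\<in>J. c j * T (G j) v t))"
  using J G
proof (induction J rule: finite_induct)
  case empty
  show ?case using almost_linear_zero[OF T v] by (auto simp: mixed_space_def intro: Lr_norm_0_AE)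
next
  case (insert j J)
  let ?S = "\<lambda>u t. \<Sum>j\<in>J. c j * G j u t"
  let ?S' = "\<lambda>u t. \<Sum>j\<in>insert j J. c j * G j u t"
  have S: "?S \<in> mixed_space I \<mu> 1" and AE: "AE t in \<mu> v. T ?S v t = (\<Sum>j\<in>J. c j * T (G j) v t)"
    using insert by auto
  have Gj: "G j \<in> mixed_space I \<mu> 1" using insert by auto
  have eq: "?S' = (\<lambda>u t. c j * G j u t + ?S u t)" using insert by (auto simp: fun_eq_iff)
  have S': "?S' \<in> mixed_space I \<mu> 1" unfolding eq by (rule mixed_space_add_cmult[OF Gj S]) auto
  have "AE t in \<mu> v. T ?S' v t = c j * T (G j) v t + T ?S v t"
    by (rule almost_linearD[OF T Gj S S' _ v]) (use insert in auto)
  with AE have "AE t in \<mu> v. T ?S' v t = (\<Sum>j\<in>insert j J. c j * T (G j) v t)"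
    by eventually_elim (use insert in auto)
  with S' show ?case by simp
qed

lemma almost_linear_cong:
  assumes T: "almost_linear I \<mu> T" and G: "G \<in> mixed_space I \<mu> 1" and H: "H \<in> mixed_space I \<mu> 1"
    and eq: "\<And>u. u \<in> I \<Longrightarrow> AE t in \<mu> u. G u t = H u t" and v: "v \<in> I"
  shows "AE t in \<mu> v. T G v t = T H v t"
  using almost_linearD[OF T H H G, of 0, OF _ v] eq by simp

section \<open>The Riesz-Thorin theorem for mixed norms\<close>

lemma norm_sum_bounded:
  fixes f :: "'i \<Rightarrow> 'z \<Rightarrow> 'b::real_normed_vector"
  assumes "\<And>i. \<exists>K. \<forall>z\<in>S. norm (f i z) \<le> K"
  shows "\<exists>K. \<forall>z\<in>S. norm (\<Sum>i\<in>A. f i z) \<le> K"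
proof -
  have "\<forall>i. \<exists>K. \<forall>z\<in>S. norm (f i z) \<le> K" using assms by blast
  from choice[OF this] obtain K where "\<forall>i. \<forall>z\<in>S. norm (f i z) \<le> K i" ..
  then have K: "norm (f i z) \<le> K i" if "z \<in> S" for i z using that by blast
  have "norm (\<Sum>i\<in>A. f i z) \<le> (\<Sum>i\<in>A. K i)" if "z \<in> S" for z by (rule sum_norm_le) (rule K[OF that])
  then show ?thesis by blast
qed

text \<open>The two bounds are positive because the three lines theorem takes their logarithms, and
  \<theta> is strictly between 0 and 1 as in the factorisation. Boundedness on the intermediate
  space is a hypothesis of the concluding theorem instead.\<close>

locale interpolation_setting =
  fixes I :: "'i set" and \<mu> :: "'i \<Rightarrow> 'a measure" and w :: "'i \<Rightarrow> real"
    and T :: "('i \<Rightarrow> 'a \<Rightarrow> complex) \<Rightarrow> 'i \<Rightarrow> 'a \<Rightarrow> complex"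
    and s0 r0 s1 r1 s r \<theta> B0 B1 :: real
  assumes I: "finite I" and \<mu>: "\<And>u. u \<in> I \<Longrightarrow> finite_measure (\<mu> u)" and w: "\<And>u. u \<in> I \<Longrightarrow> 0 < w u"
    and T: "almost_linear I \<mu> T"
    and s0: "0 \<le> s0" "s0 \<le> 1" and r0: "0 \<le> r0" "r0 \<le> 1"
    and s1: "0 \<le> s1" "s1 \<le> 1" and r1: "0 \<le> r1" "r1 \<le> 1"
    and \<theta>: "0 < \<theta>" "\<theta> < 1"
    and s: "s = (1 - \<theta>) * s0 + \<theta> * s1" and r: "r = (1 - \<theta>) * r0 + \<theta> * r1"
    and T0: "\<And>f. f \<in> mixed_space I \<mu> s0 \<Longrightarrow> T f \<in> mixed_space I \<mu> s0"
      "\<And>f. f \<in> mixed_space I \<mu> s0 \<Longrightarrow> mixed_norm I \<mu> w s0 r0 (T f) \<le> B0 * mixed_norm I \<mu> w s0 r0 f"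
    and T1: "\<And>f. f \<in> mixed_space I \<mu> s1 \<Longrightarrow> T f \<in> mixed_space I \<mu> s1"
      "\<And>f. f \<in> mixed_space I \<mu> s1 \<Longrightarrow> mixed_norm I \<mu> w s1 r1 (T f) \<le> B1 * mixed_norm I \<mu> w s1 r1 f"
    and B: "0 < B0" "0 < B1"
begin

abbreviation M :: "real \<Rightarrow> ('i \<Rightarrow> 'a \<Rightarrow> complex) set" where "M \<equiv> mixed_space I \<mu>"
abbreviation N :: "real \<Rightarrow> real \<Rightarrow> ('i \<Rightarrow> 'a \<Rightarrow> complex) \<Rightarrow> real" where "N \<equiv> mixed_norm I \<mu> w"
abbreviation N' :: "real \<Rightarrow> real \<Rightarrow> ('i \<Rightarrow> 'a \<Rightarrow> complex) \<Rightarrow> real" where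
  "N' \<equiv> mixed_norm I \<mu> (\<lambda>u. 1 / w u)"
abbreviation P :: "('i \<Rightarrow> 'a \<Rightarrow> complex) \<Rightarrow> ('i \<Rightarrow> 'a \<Rightarrow> complex) \<Rightarrow> complex" where "P \<equiv> pairing I \<mu>"

lemma sr: "0 \<le> s" "s \<le> 1" "0 \<le> r" "r \<le> 1"
  using convex_combination_unit[OF s0 s1, of \<theta>] convex_combination_unit[OF r0 r1, of \<theta>] \<theta>
  by (simp_all add: s r)

lemma finite_range_mixed_space:
  assumes "\<And>u. u \<in> I \<Longrightarrow> g u \<in> borel_measurable (\<mu> u)" "\<And>u. u \<in> I \<Longrightarrow> finite (range (g u))" "0 \<le> x"
  shows "g \<in> M x"
  unfolding mixed_space_def using assms by (auto intro: finite_measure.Lr_space_finite_range[OF \<mu>])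

text \<open>Both arguments are moved analytically: F z pairs T of \<open>E z\<close> applied to g
  with \<open>E' z\<close> applied to \<phi>, where \<open>E'\<close> belongs to the conjugate
  exponents and inverse weights. Finite ranges make F a finite sum of log-affine terms with constant
  coefficients, hence entire and bounded on the strip. Hoelder's inequality bounds it by
  \<open>B0\<close> and \<open>B1\<close> on the edges, and at z = \<theta> it is the original
  pairing.\<close>

lemma riesz_thorin_pairing:
  assumes g: "\<And>u. u \<in> I \<Longrightarrow> g u \<in> borel_measurable (\<mu> u)" "\<And>u. u \<in> I \<Longrightarrow> finite (range (g u))"
    and \<phi>: "\<And>u. u \<in> I \<Longrightarrow> \<phi> u \<in> borel_measurable (\<mu> u)" "\<And>u. u \<in> I \<Longrightarrow> finite (range (\<phi> u))"
    and g1: "N s r g \<le> 1"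
    and \<phi>1: "N' (1 - s) (1 - r) \<phi> \<le> 1"
  shows "cmod (P (T g) \<phi>) \<le> B0 powr (1 - \<theta>) * B1 powr \<theta>"
proof -
  have gm: "g \<in> M x" and \<phi>m: "\<phi> \<in> M x" if "0 \<le> x" for x
    by (rule finite_range_mixed_space[OF g that] finite_range_mixed_space[OF \<phi> that]; assumption)+
  obtain E where E: "calderon_family I \<mu> w g s0 r0 s1 r1 \<theta> E"
    by (rule calderon_factorization[OF I w gm[OF sr(1)] g1 s0(1) s1(1) r0(1) r1(1) \<theta> s r]) (assumption, rule that)
  note E = calderon_familyD[OF E]
  have s': "1 - s = (1 - \<theta>) * (1 - s0) + \<theta> * (1 - s1)" and r': "1 - r = (1 - \<theta>) * (1 - r0) + \<theta> * (1 - r1)"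
    by (simp_all add: s r algebra_simps)
  have w': "0 < 1 / w u" if "u \<in> I" for u using w[OF that] by simp
  have nonneg: "0 \<le> 1 - s" "0 \<le> 1 - s0" "0 \<le> 1 - s1" "0 \<le> 1 - r0" "0 \<le> 1 - r1"
    using sr s0 s1 r0 r1 by auto
  obtain E' where E': "calderon_family I \<mu> (\<lambda>u. 1 / w u) \<phi> (1 - s0) (1 - r0) (1 - s1) (1 - r1) \<theta> E'"
    by (rule calderon_factorization[OF I w' \<phi>m[OF nonneg(1)] \<phi>1 nonneg(2-) \<theta> s' r']) (assumption, rule that)
  note E' = calderon_familyD[OF E']
  \<comment> \<open>There is one basis element \<open>e j\<close> for each component u and each
    value of g u: the indicator of the level set, placed in component u. The numbers
    \<open>b j v y\<close> below are the matrix entries of T between level sets of g and of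
    \<phi>.\<close>
  define J where "J = Sigma I (\<lambda>u. range (g u))"
  have J: "finite J" using I g(2) by (simp add: J_def)
  define e where "e j u t = (if u = fst j \<and> g u t = snd j then 1 else 0 :: complex)" for j u t
  have em: "e j \<in> M x" if "0 \<le> x" for j x
  proof (rule finite_range_mixed_space[OF _ _ that])
    fix u assume u: "u \<in> I"
    note [measurable] = g(1)[OF u]
    show "finite (range (e j u))" by (rule finite_subset[of _ "{0, 1}"]) (auto simp: e_def)
    show "e j u \<in> borel_measurable (\<mu> u)" unfolding e_def by measurable
  qed
  have Te: "integrable (\<mu> v) (T (e j) v)" if "v \<in> I" for j v
  proof -
    have "T (e j) v \<in> Lr_space (\<mu> v) s0"
      using T0(1)[OF em[OF s0(1), of j]] that by (simp add: mixed_space_def)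
    then show ?thesis by (rule finite_measure.Lr_space_integrable[OF \<mu>[OF that] _ s0])
  qed
  define b where "b j v y = (LINT t|\<mu> v. T (e j) v t * (if \<phi> v t = y then 1 else 0))" for j v y
  define F where "F z = (\<Sum>v\<in>I. \<Sum>j\<in>J. \<Sum>y\<in>range (\<phi> v). E z (fst j) (snd j) * E' z v y * b j v y)" for z
  \<comment> \<open>Agreement is required on \<open>I\<close> only, because \<open>E\<close> at
    \<theta> reproduces values only there. The identity serves both the edges and z =
    \<theta>.\<close>
  have expand: "P (T G) \<psi> = F z"
    if G: "G \<in> M 1" "\<And>u t. u \<in> I \<Longrightarrow> G u t = E z u (g u t)"
      and \<psi>: "\<And>u t. u \<in> I \<Longrightarrow> \<psi> u t = E' z u (\<phi> u t)" for z G \<psi>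
    unfolding pairing_def F_def
  proof (rule sum.cong[OF refl])
    fix v assume v: "v \<in> I"
    let ?S = "\<lambda>u t. \<Sum>j\<in>J. E z (fst j) (snd j) * e j u t"
    have S: "?S \<in> M 1" "AE t in \<mu> v. T ?S v t = (\<Sum>j\<in>J. E z (fst j) (snd j) * T (e j) v t)"
      using almost_linear_sum[OF T v J em, of "\<lambda>j. E z (fst j) (snd j)"] by auto
    have "G u t = ?S u t" if u: "u \<in> I" for u t
    proof -
      have "?S u t = (\<Sum>j\<in>J. if j = (u, g u t) then E z (fst j) (snd j) else 0)"
        by (intro sum.cong refl) (auto simp: e_def)
      also have "\<dots> = E z u (g u t)" using J u by (simp add: J_def)
      finally show ?thesis using G(2)[OF u] by simp
    qed
    then have "AE t in \<mu> v. T G v t = T ?S v t"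
      by (intro almost_linear_cong[OF T G(1) S(1) _ v]) auto
    with S(2) have TG: "AE t in \<mu> v. T G v t = (\<Sum>j\<in>J. E z (fst j) (snd j) * T (e j) v t)"
      by eventually_elim simp
    have \<psi>v: "\<psi> v t = (\<Sum>y\<in>range (\<phi> v). E' z v y * (if \<phi> v t = y then 1 else 0))" for t
      using \<phi>(2)[OF v] by (simp add: \<psi>[OF v] if_distrib[of "\<lambda>x. _ * x"] sum.delta cong: if_cong)
    have eq: "AE t in \<mu> v. T G v t * \<psi> v t =
        (\<Sum>j\<in>J. \<Sum>y\<in>range (\<phi> v). (E z (fst j) (snd j) * E' z v y) * (T (e j) v t * (if \<phi> v t = y then 1 else 0)))"
      using TG by eventually_elim (simp add: \<psi>v sum_product mult_ac)
    note [measurable] = \<phi>(1)[OF v]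
    have int: "integrable (\<mu> v) (\<lambda>t. T (e j) v t * (if \<phi> v t = y then 1 else 0))" for j y
      by (rule Bochner_Integration.integrable_bound[OF Te[OF v, of j]])
         (use Te[OF v, of j] in auto)
    have "(LINT t|\<mu> v. T G v t * \<psi> v t) = (LINT t|\<mu> v. (\<Sum>j\<in>J. \<Sum>y\<in>range (\<phi> v).
        (E z (fst j) (snd j) * E' z v y) * (T (e j) v t * (if \<phi> v t = y then 1 else 0))))"
    proof (rule integral_cong_AE[OF _ _ eq])
      have "\<psi> v = (\<lambda>t. E' z v (\<phi> v t))" using \<psi>[OF v] by auto
      then have "\<psi> v \<in> borel_measurable (\<mu> v)" using E'(1) \<phi>(1)[OF v] by simp
      then show "(\<lambda>t. T G v t * \<psi> v t) \<in> borel_measurable (\<mu> v)"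
        using almost_linear_measurable[OF T G(1) v] by measurable
    qed (use int in auto)
    also have "\<dots> = (\<Sum>j\<in>J. \<Sum>y\<in>range (\<phi> v). E z (fst j) (snd j) * E' z v y * b j v y)"
      unfolding b_def using int by (subst Bochner_Integration.integral_sum; simp)+
    finally show "(LINT t|\<mu> v. T G v t * \<psi> v t) =
      (\<Sum>j\<in>J. \<Sum>y\<in>range (\<phi> v). E z (fst j) (snd j) * E' z v y * b j v y)" .
  qed
  have entry: "(\<lambda>z. E z (fst j) (snd j) * E' z v y * b j v y) holomorphic_on UNIV"
      "\<exists>K. \<forall>z\<in>{z. 0 \<le> Re z \<and> Re z \<le> 1}. cmod (E z (fst j) (snd j) * E' z v y * b j v y) \<le> K" for j v y
  proof -
    have la: "log_affine (\<lambda>z. E z (fst j) (snd j) * E' z v y)" by (intro log_affine_mult E(2) E'(2))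
    show "(\<lambda>z. E z (fst j) (snd j) * E' z v y * b j v y) holomorphic_on UNIV"
      by (rule holomorphic_on_mult[OF log_affine_holomorphic[OF la] holomorphic_on_const])
    obtain K where K: "\<And>z. 0 \<le> Re z \<Longrightarrow> Re z \<le> 1 \<Longrightarrow> cmod (E z (fst j) (snd j) * E' z v y) \<le> K"
      by (rule log_affine_bounded[OF la]) (rule that)
    then have "\<forall>z\<in>{z. 0 \<le> Re z \<and> Re z \<le> 1}. cmod (E z (fst j) (snd j) * E' z v y * b j v y) \<le> K * cmod (b j v y)"
      by (auto simp: norm_mult[of _ "b j v y"] intro!: mult_right_mono)
    then show "\<exists>K. \<forall>z\<in>{z. 0 \<le> Re z \<and> Re z \<le> 1}. cmod (E z (fst j) (snd j) * E' z v y * b j v y) \<le> K" ..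
  qed
  have "\<exists>K. \<forall>z\<in>{z. 0 \<le> Re z \<and> Re z \<le> 1}. cmod (F z) \<le> K"
    unfolding F_def by (intro norm_sum_bounded entry(2))
  then obtain K where K: "\<And>z. 0 \<le> Re z \<Longrightarrow> Re z \<le> 1 \<Longrightarrow> cmod (F z) \<le> K" by auto
  have hol: "F holomorphic_on UNIV" unfolding F_def by (intro holomorphic_on_sum entry(1))
  have gz1: "(\<lambda>u t. E z u (g u t)) \<in> M 1" for z
  proof (rule finite_range_mixed_space)
    fix u assume u: "u \<in> I"
    show "(\<lambda>t. E z u (g u t)) \<in> borel_measurable (\<mu> u)"
      by (rule measurable_compose[OF g(1)[OF u] E(1)])
    have "range (\<lambda>t. E z u (g u t)) = E z u ` range (g u)" by auto
    then show "finite (range (\<lambda>t. E z u (g u t)))" using g(2)[OF u] by simp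
  qed simp
  have edge: "cmod (P (T G) \<psi>) \<le> B"
    if G: "G \<in> M x" "N x y G \<le> 1"
      and \<psi>: "\<psi> \<in> M (1 - x)" "N' (1 - x) (1 - y) \<psi> \<le> 1"
      and TG: "T G \<in> M x" "N x y (T G) \<le> B * N x y G"
      and xy: "0 \<le> x" "x \<le> 1" "0 \<le> y" "y \<le> 1" and B: "0 < B" for G \<psi> x y B
  proof -
    have "cmod (P (T G) \<psi>) \<le>
        N x y (T G) * N' (1 - x) (1 - y) \<psi>"
      by (rule mixed_norm_Hoelder[OF I xy w TG(1) \<psi>(1)])
    also have "\<dots> \<le> B * 1"
    proof (rule mult_mono[OF _ \<psi>(2)])
      have "B * N x y G \<le> B * 1" using G(2) B by (intro mult_left_mono) auto
      with TG(2) show "N x y (T G) \<le> B" by simp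
    qed (use B in auto)
    finally show ?thesis by simp
  qed
  have "cmod (F (of_real \<theta>)) \<le> B0 powr (1 - Re (of_real \<theta>)) * B1 powr Re (of_real \<theta>)"
  proof (rule three_lines[OF hol K _ _ B])
    fix z :: complex
    show "cmod (F z) \<le> B0" if "Re z = 0"
      unfolding expand[OF gz1 refl refl, symmetric]
      by (rule edge[OF E(4,5)[OF that] E'(4,5)[OF that] T0(1)[OF E(4)[OF that]] T0(2)[OF E(4)[OF that]] s0 r0 B(1)])
    show "cmod (F z) \<le> B1" if "Re z = 1"
      unfolding expand[OF gz1 refl refl, symmetric]
      by (rule edge[OF E(6,7)[OF that] E'(6,7)[OF that] T1(1)[OF E(6)[OF that]] T1(2)[OF E(6)[OF that]] s1 r1 B(2)])
  qed (use \<theta> in auto)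
  moreover have "P (T g) \<phi> = F (of_real \<theta>)" by (rule expand) (use gm E(3) E'(3) in auto)
  ultimately show ?thesis by simp
qed

text \<open>The estimate for functions of finite range in the unit ball extends by homogeneity and
  then by rounding \<open>f\<close>. The constant \<open>C\<close> controls only the image of the
  rounding error, which tends to 0, and so it disappears from the conclusion.\<close>

theorem riesz_thorin_mixed:
  assumes Ts: "\<And>f. f \<in> M s \<Longrightarrow> T f \<in> M s"
      "\<And>f. f \<in> M s \<Longrightarrow> N s r (T f) \<le> C * N s r f"
    and f: "f \<in> M s"
  shows "N s r (T f) \<le> B0 powr (1 - \<theta>) * B1 powr \<theta> * N s r f"
proof -
  define B where "B = B0 powr (1 - \<theta>) * B1 powr \<theta>"
  have B0: "0 \<le> B" by (simp add: B_def)
  have w0: "0 \<le> w u" if "u \<in> I" for u using w[OF that] by simp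
  have sub1: "h \<in> M 1" if "h \<in> M s" for h
    using that finite_measure.Lr_space_integrable[OF \<mu> _ sr(1,2)]
    by (auto simp: mixed_space_def Lr_space_pos dest: Lr_space_measurable)
  have meas: "h u \<in> borel_measurable (\<mu> u)" if "h \<in> M s" "u \<in> I" for h u
    using that by (auto simp: mixed_space_def dest: Lr_space_measurable)
  define R where "R n h u t = grid_round n (h u t)" for n and h :: "'i \<Rightarrow> 'a \<Rightarrow> complex" and u t
  have Rfin: "finite (range (R n h u))" for n h u
    by (rule finite_subset[OF _ finite_range_grid_round[of n]]) (auto simp: R_def)
  have Rmeas: "R n h u \<in> borel_measurable (\<mu> u)" if "h \<in> M s" "u \<in> I" for n h u
    using meas[OF that] unfolding R_def by measurable
  have R: "R n h \<in> M s" if "h \<in> M s" for n h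
    by (rule finite_range_mixed_space[OF Rmeas[OF that] Rfin sr(1)])
  define D where "D n h u t = h u t - R n h u t" for n and h :: "'i \<Rightarrow> 'a \<Rightarrow> complex" and u t
  have D: "D n h \<in> M s" if "h \<in> M s" for n h
    using mixed_space_add_cmult[OF R[OF that] that sr(1,2), of "-1"] by (simp add: D_def[abs_def])
  have Dlim: "(\<lambda>n. N s r (D n h)) \<longlonglongrightarrow> 0" if "h \<in> M s" for h
  proof (rule mixed_norm_tendsto_0[OF I sr(3) w0])
    fix u assume u: "u \<in> I"
    have "D n h u = (\<lambda>t. h u t - grid_round n (h u t))" for n by (simp add: D_def[abs_def] R_def)
    then show "(\<lambda>n. Lr_norm (\<mu> u) s (D n h u)) \<longlonglongrightarrow> 0"
      using that u sr finite_measure.Lr_norm_grid_round_tendsto[OF \<mu>[OF u], of "h u" s]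
      by (simp add: mixed_space_def)
  qed auto
  have tri: "cmod (h u t) \<le> cmod (R n h u t) + cmod (D n h u t)"
    "cmod (R n h u t) \<le> cmod (h u t) + cmod (D n h u t)" for n h u t
    using norm_triangle_ineq[of "R n h u t" "D n h u t"] norm_triangle_ineq4[of "h u t" "D n h u t"]
    by (simp_all add: D_def)
  have unit: "N s r (T g) \<le> B"
    if g: "g \<in> M s" "\<And>u. u \<in> I \<Longrightarrow> finite (range (g u))" "N s r g \<le> 1" for g
  proof -
    let ?h = "T g"
    have h: "?h \<in> M s" by (rule Ts(1)[OF g(1)])
    \<comment> \<open>\<open>T g\<close> may have infinite range, so the dual family is chosen for
      its rounding. The error is paid twice: in the pairing and in the triangle inequality for the
      norm.\<close>
    have le: "N s r ?h \<le> B + 2 * N s r (D n ?h)" for n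
    proof -
      obtain \<phi> where \<phi>: "\<And>u. u \<in> I \<Longrightarrow> \<phi> u \<in> borel_measurable (\<mu> u)" "\<And>u. u \<in> I \<Longrightarrow> finite (range (\<phi> u))"
        "N' (1 - s) (1 - r) \<phi> \<le> 1"
        "P (R n ?h) \<phi> = of_real (N s r (R n ?h))"
        by (rule mixed_norm_converse_Hoelder[OF I \<mu> sr w Rmeas[OF h, where n = n] Rfin[where n = n]]) auto
      have \<phi>s: "\<phi> \<in> M (1 - s)" using sr by (intro finite_range_mixed_space[OF \<phi>(1,2)]) auto
      have int: "integrable (\<mu> v) (\<lambda>t. k v t * \<phi> v t)" if "k \<in> M s" "v \<in> I" for k v
        using that \<phi>s sr by (intro Lr_Hoelder_complex(1)[of _ _ s]) (auto simp: mixed_space_def)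
      have "P (R n ?h) \<phi> = P ?h \<phi> - P (D n ?h) \<phi>"
        unfolding pairing_def sum_subtractf[symmetric]
      proof (rule sum.cong[OF refl])
        fix v assume v: "v \<in> I"
        have "(LINT t|\<mu> v. ?h v t * \<phi> v t) - (LINT t|\<mu> v. D n ?h v t * \<phi> v t) =
            (LINT t|\<mu> v. ?h v t * \<phi> v t - D n ?h v t * \<phi> v t)"
          using int[OF h v] int[OF D[OF h] v] by simp
        also have "\<dots> = (LINT t|\<mu> v. R n ?h v t * \<phi> v t)" by (simp add: D_def left_diff_distrib)
        finally show "(LINT t|\<mu> v. R n ?h v t * \<phi> v t) =
            (LINT t|\<mu> v. ?h v t * \<phi> v t) - (LINT t|\<mu> v. D n ?h v t * \<phi> v t)" ..
      qed
      then have "N s r (R n ?h) = cmod (P ?h \<phi> - P (D n ?h) \<phi>)"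
        using \<phi>(4) by (metis mixed_norm_nonneg norm_of_real abs_of_nonneg)
      also have "\<dots> \<le> cmod (P ?h \<phi>) + cmod (P (D n ?h) \<phi>)" by (rule norm_triangle_ineq4)
      also have "cmod (P ?h \<phi>) \<le> B"
        unfolding B_def by (rule riesz_thorin_pairing[OF meas[OF g(1)] g(2) \<phi>(1,2) g(3) \<phi>(3)])
      also have "cmod (P (D n ?h) \<phi>) \<le>
          N s r (D n ?h) * N' (1 - s) (1 - r) \<phi>"
        by (rule mixed_norm_Hoelder[OF I sr w D[OF h] \<phi>s])
      also have "\<dots> \<le> N s r (D n ?h) * 1" using \<phi>(3) by (intro mult_left_mono) auto
      finally have "N s r (R n ?h) \<le> B + N s r (D n ?h)" by simp
      moreover have "N s r ?h \<le> N s r (R n ?h) + N s r (D n ?h)"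
        by (rule mixed_norm_triangle[OF I sr w0 R[OF h] D[OF h] meas[OF h]]) (auto intro: tri)
      ultimately show ?thesis by simp
    qed
    have "(\<lambda>n. B + 2 * N s r (D n ?h)) \<longlonglongrightarrow> B + 2 * 0" by (intro tendsto_intros Dlim[OF h])
    then show ?thesis using LIMSEQ_le_const[of _ "B + 2 * 0" "N s r ?h"] le by auto
  qed
  have simple: "N s r (T g) \<le> B * N s r g"
    if g: "g \<in> M s" "\<And>u. u \<in> I \<Longrightarrow> finite (range (g u))" for g
  proof (cases "N s r g = 0")
    case True
    \<comment> \<open>Rescaling is impossible for norm 0; here the a priori bound gives the
      claim.\<close>
    then have "N s r (T g) \<le> 0" using Ts(2)[OF g(1)] by simp
    then show ?thesis using True by simp
  next
    case False
    define a where "a = N s r g"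
    have a: "0 < a" using False by (simp add: a_def less_le)
    define k where "k u t = of_real (1 / a) * g u t" for u t
    have km: "k u \<in> borel_measurable (\<mu> u)" if "u \<in> I" for u
      using meas[OF g(1) that] unfolding k_def by measurable
    have k: "k \<in> M s"
      unfolding mixed_space_def
    proof safe
      fix u assume u: "u \<in> I"
      then have "g u \<in> Lr_space (\<mu> u) s" using g(1) by (simp add: mixed_space_def)
      from Lr_space_cmult_mono[OF this _ sr(1) km[OF u], of "1 / a"] show "k u \<in> Lr_space (\<mu> u) s"
        using a by (simp add: k_def norm_mult norm_divide)
    qed
    have "N s r k = 1 / a * N s r g"
      by (rule mixed_norm_cmult[OF I sr(1,3) _ w0 g(1) km]) (use a in \<open>auto simp: k_def norm_mult norm_divide\<close>)
    then have "N s r k \<le> 1" using a by (simp add: a_def)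
    moreover have "finite (range (k u))" if "u \<in> I" for u
    proof -
      have "range (k u) = (\<lambda>x. of_real (1 / a) * x) ` range (g u)" by (auto simp: k_def)
      then show ?thesis using g(2)[OF that] by simp
    qed
    ultimately have Tk: "N s r (T k) \<le> B" using unit[OF k] by blast
    have z: "(\<lambda>u t. 0) \<in> M 1" by (auto simp: mixed_space_def intro: Lr_norm_0_AE)
    have "AE t in \<mu> v. T k v t = of_real (1 / a) * T g v t" if v: "v \<in> I" for v
    proof -
      have "AE t in \<mu> v. T k v t = of_real (1 / a) * T g v t + T (\<lambda>u t. 0) v t"
        by (rule almost_linearD[OF T sub1[OF g(1)] z sub1[OF k] _ v]) (simp add: k_def)
      with almost_linear_zero[OF T v] show ?thesis by eventually_elim simp
    qed
    then have "AE t in \<mu> v. cmod (T k v t) = 1 / a * cmod (T g v t)" if "v \<in> I" for v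
      using that a by (fastforce elim: eventually_mono simp: norm_mult norm_divide)
    then have "N s r (T k) = 1 / a * N s r (T g)"
      using a by (intro mixed_norm_cmult[OF I sr(1,3) _ w0 Ts(1)[OF g(1)] meas[OF Ts(1)[OF k]]]) auto
    with Tk a show ?thesis by (simp add: a_def field_simps)
  qed
  have "N s r (T f) \<le> B * N s r f + (B + C) * N s r (D n f)" for n
  proof -
    have "N s r (T f) \<le> N s r (T (R n f)) + N s r (T (D n f))"
    proof (rule mixed_norm_triangle[OF I sr w0 Ts(1)[OF R[OF f]] Ts(1)[OF D[OF f]] meas[OF Ts(1)[OF f]]])
      fix u assume u: "u \<in> I"
      have "AE t in \<mu> u. T f u t = 1 * T (R n f) u t + T (D n f) u t"
        by (rule almost_linearD[OF T sub1[OF R[OF f]] sub1[OF D[OF f]] sub1[OF f] _ u]) (simp add: D_def)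
      then show "AE t in \<mu> u. cmod (T f u t) \<le> cmod (T (R n f) u t) + cmod (T (D n f) u t)"
        by eventually_elim (auto intro: norm_triangle_ineq)
    qed auto
    moreover have "N s r (T (R n f)) \<le> B * N s r (R n f)" by (rule simple[OF R[OF f] Rfin])
    moreover have "N s r (R n f) \<le> N s r f + N s r (D n f)"
      by (rule mixed_norm_triangle[OF I sr w0 f D[OF f] Rmeas[OF f]]) (auto intro: tri)
    moreover from this have "B * N s r (R n f) \<le> B * (N s r f + N s r (D n f))"
      using B0 by (rule mult_left_mono)
    moreover have "N s r (T (D n f)) \<le> C * N s r (D n f)" by (rule Ts(2)[OF D[OF f]])
    ultimately show ?thesis unfolding distrib_left distrib_right by linarith
  qed
  moreover have "(\<lambda>n. B * N s r f + (B + C) * N s r (D n f)) \<longlonglongrightarrow> B * N s r f + (B + C) * 0"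
    by (intro tendsto_intros Dlim[OF f])
  ultimately have "N s r (T f) \<le> B * N s r f"
    using LIMSEQ_le_const[of _ "B * N s r f + (B + C) * 0" "N s r (T f)"] by auto
  then show ?thesis by (simp add: B_def)
qed

end

section \<open>From the ANOVA to the anchored decomposition\<close>

lemma
  fixes f :: "'b \<Rightarrow> 'c::{banach,second_countable_topology}"
  assumes T[measurable]: "T \<in> measurable M N" and f[measurable]: "f \<in> borel_measurable N" and s: "0 \<le> s"
  shows Lr_space_distr: "f \<in> Lr_space (distr M N T) s \<longleftrightarrow> (\<lambda>x. f (T x)) \<in> Lr_space M s"
    and Lr_norm_distr: "f \<in> Lr_space (distr M N T) s \<Longrightarrow>
      Lr_norm (distr M N T) s f = Lr_norm M s (\<lambda>x. f (T x))"
proof -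
  have AE: "(AE x in distr M N T. norm (f x) \<le> C) \<longleftrightarrow> (AE x in M. norm (f (T x)) \<le> C)" for C
    by (rule AE_distr_iff) simp_all
  consider "s = 0" | "0 < s" using s by fastforce
  then show iff: "f \<in> Lr_space (distr M N T) s \<longleftrightarrow> (\<lambda>x. f (T x)) \<in> Lr_space M s"
    by cases (simp_all add: Lr_space_zero AE Lr_space_pos integrable_distr_eq)
  assume L: "f \<in> Lr_space (distr M N T) s"
  show "Lr_norm (distr M N T) s f = Lr_norm M s (\<lambda>x. f (T x))"
  proof (cases "s = 0")
    case True
    show ?thesis unfolding True
    proof (rule antisym)
      show "Lr_norm (distr M N T) 0 f \<le> Lr_norm M 0 (\<lambda>x. f (T x))"
        using L iff True by (intro Lr_norm_zero_le) (simp_all add: AE Lr_norm_zero_AE)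
      have "AE x in distr M N T. norm (f x) \<le> Lr_norm (distr M N T) 0 f"
        using L True by (intro Lr_norm_zero_AE) simp
      then show "Lr_norm M 0 (\<lambda>x. f (T x)) \<le> Lr_norm (distr M N T) 0 f"
        by (intro Lr_norm_zero_le) (simp_all add: AE)
    qed
  next
    case False
    then show ?thesis using s by (simp add: Lr_norm_pos integral_distr)
  qed
qed

text \<open>Integrating out the second probability factor is a contraction: on almost every fibre
  the mean of |F| is at most its L_p norm there, and Fubini's theorem integrates the p-th powers.
  For \<open>s = 0\<close> the essential bound passes to almost every fibre.\<close>

lemma
  fixes F :: "'a \<times> 'b \<Rightarrow> complex" and h :: "'a \<Rightarrow> complex"
  assumes P: "prob_space P" and Q: "prob_space Q" and s: "0 \<le> s" "s \<le> 1" and c: "0 \<le> c"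
    and F: "F \<in> Lr_space (P \<Otimes>\<^sub>M Q) s" and h: "h \<in> borel_measurable P"
    and le: "AE t in P. cmod (h t) \<le> c * (LINT y|Q. cmod (F (t, y)))"
  shows Lr_space_average: "h \<in> Lr_space P s"
    and Lr_norm_average: "Lr_norm P s h \<le> c * Lr_norm (P \<Otimes>\<^sub>M Q) s F"
proof -
  interpret P: prob_space P by fact
  interpret Q: prob_space Q by fact
  interpret PQ: pair_prob_space P Q ..
  note [measurable] = Lr_space_measurable[OF F] h
  define A where "A t = (LINT y|Q. cmod (F (t, y)))" for t
  have [measurable]: "A \<in> borel_measurable P" unfolding A_def by measurable
  have A0: "0 \<le> A t" for t by (simp add: A_def)
  have *: "A \<in> Lr_space P s \<and> Lr_norm P s A \<le> Lr_norm (P \<Otimes>\<^sub>M Q) s F"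
  proof (cases "s = 0")
    case True
    let ?N = "Lr_norm (P \<Otimes>\<^sub>M Q) 0 F"
    have "AE x in P \<Otimes>\<^sub>M Q. cmod (F x) \<le> ?N" using F True by (intro Lr_norm_zero_AE) simp
    then have "AE t in P. AE y in Q. cmod (F (t, y)) \<le> ?N" by (rule PQ.AE_pair)
    then have le: "AE t in P. norm (A t) \<le> ?N"
      using AE_space
    proof eventually_elim
      case (elim t)
      have "A t \<le> (LINT y|Q. ?N)"
        unfolding A_def
      proof (rule integral_mono_AE)
        show "integrable Q (\<lambda>y. cmod (F (t, y)))"
          by (rule Q.integrable_const_bound[of _ ?N]) (use elim in auto)
      qed (use elim in auto)
      then show ?case using A0[of t] by (simp add: Q.prob_space)
    qed
    then show ?thesis using True by (auto simp: Lr_space_zero intro!: Lr_norm_zero_le exI[of _ ?N])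
  next
    case False
    with s have s0: "0 < s" by simp
    have i: "integrable (P \<Otimes>\<^sub>M Q) (\<lambda>x. cmod (F x) powr (1 / s))"
      using F s0 by (simp add: Lr_space_pos)
    have le: "AE t in P. A t powr (1 / s) \<le> (LINT y|Q. cmod (F (t, y)) powr (1 / s))"
      using PQ.AE_integrable_fst'[OF i] AE_space
    proof eventually_elim
      case (elim t)
      then have Ft: "(\<lambda>y. F (t, y)) \<in> Lr_space Q s" using s0 by (simp add: Lr_space_pos)
      have "A t powr (1 / s) \<le> Lr_norm Q s (\<lambda>y. F (t, y)) powr (1 / s)"
        using Q.Lr_norm_integral[OF Ft s] A0[of t] s0 by (intro powr_mono2) (auto simp: A_def)
      then show ?case using s0 by (simp add: Lr_norm_powr)
    qed
    have i': "integrable P (\<lambda>t. LINT y|Q. cmod (F (t, y)) powr (1 / s))"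
      using PQ.integrable_fst'[OF i] by simp
    have iA: "integrable P (\<lambda>t. A t powr (1 / s))"
      by (rule Bochner_Integration.integrable_bound[OF i']) (use le in \<open>auto elim!: eventually_mono\<close>)
    have "(LINT t|P. A t powr (1 / s)) \<le> (LINT t|P. LINT y|Q. cmod (F (t, y)) powr (1 / s))"
      by (rule integral_mono_AE[OF iA i' le])
    also have "\<dots> = Lr_norm (P \<Otimes>\<^sub>M Q) s F powr (1 / s)"
      using PQ.integral_fst'[OF i] s0 by (simp add: Lr_norm_powr)
    finally show ?thesis using iA s0 A0 by (auto simp: Lr_space_pos Lr_norm_le_iff)
  qed
  have le': "AE t in P. norm (h t) \<le> c * norm (A t)" using le A0 by (simp add: A_def)
  show "h \<in> Lr_space P s" by (rule Lr_space_cmult_mono[OF _ c s(1) h le']) (use * in blast)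
  have "Lr_norm P s h \<le> c * Lr_norm P s A"
    by (rule Lr_norm_cmult_mono[OF _ c s(1) h le']) (use * in blast)
  also have "\<dots> \<le> c * Lr_norm (P \<Otimes>\<^sub>M Q) s F" using * c by (intro mult_left_mono) auto
  finally show "Lr_norm P s h \<le> c * Lr_norm (P \<Otimes>\<^sub>M Q) s F" .
qed

text \<open>With b = - \<Psi> / \<psi> and the weighted measure this is (-1)^|w| times the Lebesgue
  integral of g against the product of \<Psi> over the coordinates in w.\<close>

definition slice :: "'b measure \<Rightarrow> ('b \<Rightarrow> real) \<Rightarrow> 'i set \<Rightarrow> 'i set \<Rightarrow> (('i \<Rightarrow> 'b) \<Rightarrow> complex) \<Rightarrow> ('i \<Rightarrow> 'b) \<Rightarrow> complex" where
  "slice \<mu> b v w g t = (LINT y|PiM w (\<lambda>_. \<mu>). g (merge v w (t, y)) * of_real (\<Prod>j\<in>w. b (y j)))"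

text \<open>The bound on \<open>b\<close> holds at every point, so products of its values are
  bounded without exceptional sets. The later instance is truncated for this purpose.\<close>

locale averaging = prob_space \<mu> for \<mu> :: "'b measure" +
  fixes b :: "'b \<Rightarrow> real" and c :: real
  assumes b_measurable [measurable]: "b \<in> borel_measurable \<mu>" and b_bound: "\<And>t. \<bar>b t\<bar> \<le> c"
begin

abbreviation Pr :: "'i set \<Rightarrow> ('i \<Rightarrow> 'b) measure" where "Pr u \<equiv> PiM u (\<lambda>_. \<mu>)"

lemma prob_Pr: "prob_space (Pr u)"
  by (rule prob_space_PiM) (rule prob_space_axioms)

lemma product_sigma: "product_sigma_finite (\<lambda>_. \<mu>)"
  by (rule product_sigma_finite.intro) (rule sigma_finite_measure_axioms)

lemma c_nonneg: "0 \<le> c"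
  using b_bound[of undefined] abs_ge_zero order_trans by blast

lemma prod_b_bound: "\<bar>\<Prod>j\<in>w. b (y j)\<bar> \<le> c ^ card w"
  using b_bound by (rule abs_prod_le_power)

lemma distr_merge_Pr:
  "v \<inter> w = {} \<Longrightarrow> finite v \<Longrightarrow> finite w \<Longrightarrow> distr (Pr v \<Otimes>\<^sub>M Pr w) (Pr (v \<union> w)) (merge v w) = Pr (v \<union> w)"
  by (rule product_sigma_finite.distr_merge[OF product_sigma])

lemma slice_measurable:
  assumes [measurable]: "g \<in> borel_measurable (Pr (v \<union> w))"
  shows "slice \<mu> b v w g \<in> borel_measurable (Pr v)"
proof -
  interpret W: prob_space "Pr w" by (rule prob_Pr)
  show ?thesis unfolding slice_def by measurable
qed

lemma
  assumes vw: "v \<inter> w = {}" "finite v" "finite w" and g: "g \<in> Lr_space (Pr (v \<union> w)) s" and s: "0 \<le> s" "s \<le> 1"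
  shows Lr_space_slice: "slice \<mu> b v w g \<in> Lr_space (Pr v) s"
    and Lr_norm_slice: "Lr_norm (Pr v) s (slice \<mu> b v w g) \<le> c ^ card w * Lr_norm (Pr (v \<union> w)) s g"
proof -
  interpret V: prob_space "Pr v" by (rule prob_Pr)
  interpret W: prob_space "Pr w" by (rule prob_Pr)
  interpret VW: pair_prob_space "Pr v" "Pr w" ..
  note [measurable] = Lr_space_measurable[OF g]
  define F where "F = (\<lambda>x. g (merge v w x))"
  have FL: "F \<in> Lr_space (Pr v \<Otimes>\<^sub>M Pr w) s" and FN: "Lr_norm (Pr v \<Otimes>\<^sub>M Pr w) s F = Lr_norm (Pr (v \<union> w)) s g"
    using Lr_space_distr[of "merge v w" "Pr v \<Otimes>\<^sub>M Pr w" "Pr (v \<union> w)" g s]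
      Lr_norm_distr[of "merge v w" "Pr v \<Otimes>\<^sub>M Pr w" "Pr (v \<union> w)" g s] g s
    unfolding F_def distr_merge_Pr[OF vw] by auto
  have Fi: "integrable (Pr v \<Otimes>\<^sub>M Pr w) F" by (rule VW.Lr_space_integrable[OF FL s])
  have le: "AE t in Pr v. cmod (slice \<mu> b v w g t) \<le> c ^ card w * (LINT y|Pr w. cmod (F (t, y)))"
    using VW.AE_integrable_fst'[OF Fi] AE_space
  proof eventually_elim
    case (elim t)
    have bd: "cmod (g (merge v w (t, y)) * of_real (\<Prod>j\<in>w. b (y j))) \<le> c ^ card w * cmod (F (t, y))" for y
      unfolding norm_mult norm_of_real F_def mult.commute[of "cmod _"]
      by (intro mult_right_mono prod_b_bound) auto
    have i: "integrable (Pr w) (\<lambda>y. c ^ card w * cmod (F (t, y)))" using elim(1) by simp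
    have "integrable (Pr w) (\<lambda>y. g (merge v w (t, y)) * of_real (\<Prod>j\<in>w. b (y j)))"
      using elim(1) by (intro integrable_mult_bounded[OF _ _ prod_b_bound]) (simp add: F_def, measurable)
    then have "cmod (slice \<mu> b v w g t) \<le> (LINT y|Pr w. c ^ card w * cmod (F (t, y)))"
      unfolding slice_def
      by (intro order_trans[OF integral_norm_bound] integral_mono[OF _ i bd]) simp
    then show ?case by simp
  qed
  have cw: "0 \<le> c ^ card w" using c_nonneg by simp
  note av = prob_Pr prob_Pr s cw FL slice_measurable[OF Lr_space_measurable[OF g]] le
  show "slice \<mu> b v w g \<in> Lr_space (Pr v) s" by (rule Lr_space_average[OF av])
  show "Lr_norm (Pr v) s (slice \<mu> b v w g) \<le> c ^ card w * Lr_norm (Pr (v \<union> w)) s g"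
    using Lr_norm_average[OF av] unfolding FN .
qed

text \<open>By Fubini's theorem the partial integrals exist, and the equation for \<open>K\<close>
  holds on the fibre, for almost every t. This restricts linearity to almost all t.\<close>

lemma slice_AE_linear:
  assumes vw: "v \<inter> w = {}" "finite v" "finite w"
    and G: "integrable (Pr (v \<union> w)) G" and H: "integrable (Pr (v \<union> w)) H"
    and K: "K \<in> borel_measurable (Pr (v \<union> w))" and eq: "AE t in Pr (v \<union> w). K t = a * G t + H t"
  shows "AE t in Pr v. slice \<mu> b v w K t = a * slice \<mu> b v w G t + slice \<mu> b v w H t"
proof -
  interpret V: prob_space "Pr v" by (rule prob_Pr)
  interpret W: prob_space "Pr w" by (rule prob_Pr)
  interpret VW: pair_prob_space "Pr v" "Pr w" ..
  note [measurable] = K borel_measurable_integrable[OF G] borel_measurable_integrable[OF H]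
  have int: "AE t in Pr v. integrable (Pr w) (\<lambda>y. f (merge v w (t, y)) * of_real (\<Prod>j\<in>w. b (y j)))"
    if f: "integrable (Pr (v \<union> w)) f" for f :: "_ \<Rightarrow> complex"
  proof -
    note [measurable] = borel_measurable_integrable[OF f]
    have "integrable (Pr v \<Otimes>\<^sub>M Pr w) (\<lambda>x. f (merge v w x))"
      using f distr_merge_Pr[OF vw] by (metis integrable_distr measurable_merge)
    from VW.AE_integrable_fst'[OF this] show ?thesis
      by eventually_elim (rule integrable_mult_bounded[OF _ _ prod_b_bound], assumption, measurable)
  qed
  have "AE x in distr (Pr v \<Otimes>\<^sub>M Pr w) (Pr (v \<union> w)) (merge v w). K x = a * G x + H x"
    unfolding distr_merge_Pr[OF vw] by (rule eq)
  then have "AE x in Pr v \<Otimes>\<^sub>M Pr w. K (merge v w x) = a * G (merge v w x) + H (merge v w x)"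
    by (subst (asm) AE_distr_iff) simp_all
  then have "AE t in Pr v. AE y in Pr w. K (merge v w (t, y)) = a * G (merge v w (t, y)) + H (merge v w (t, y))"
    by (rule VW.AE_pair)
  then show ?thesis
    using int[OF G] int[OF H] AE_space
  proof eventually_elim
    case (elim t)
    have "slice \<mu> b v w K t = (LINT y|Pr w. a * (G (merge v w (t, y)) * of_real (\<Prod>j\<in>w. b (y j)))
        + H (merge v w (t, y)) * of_real (\<Prod>j\<in>w. b (y j)))"
      unfolding slice_def
    proof (rule integral_cong_AE)
      show "AE y in Pr w. K (merge v w (t, y)) * of_real (\<Prod>j\<in>w. b (y j)) =
          a * (G (merge v w (t, y)) * of_real (\<Prod>j\<in>w. b (y j))) + H (merge v w (t, y)) * of_real (\<Prod>j\<in>w. b (y j))"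
        using elim(1) by eventually_elim (simp add: distrib_right mult.assoc)
    qed (use elim(4) in measurable)
    also have "\<dots> = a * slice \<mu> b v w G t + slice \<mu> b v w H t"
      using elim(2,3) by (simp add: slice_def)
    finally show ?case .
  qed
qed

text \<open>The product of sums is expanded over the subsets v of u. In the term of v the factors
  \<open>b\<close> carry the coordinates in u - v, which Fubini's theorem integrates out, leaving
  the factors \<open>k\<close> on v. This is how an ANOVA integral becomes a sum of anchored
  ones.\<close>

lemma integral_prod_add:
  assumes u: "finite u" and g: "integrable (Pr u) g"
    and k[measurable]: "\<And>j. j \<in> u \<Longrightarrow> k j \<in> borel_measurable \<mu>" and kb: "\<And>j t. j \<in> u \<Longrightarrow> \<bar>k j t\<bar> \<le> L"
  shows "(LINT t|Pr u. g t * of_real (\<Prod>j\<in>u. k j (t j) + b (t j))) =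
    (\<Sum>v\<in>Pow u. LINT t|Pr v. slice \<mu> b v (u - v) g t * of_real (\<Prod>j\<in>v. k j (t j)))"
proof -
  let ?f = "\<lambda>v t. g t * of_real ((\<Prod>j\<in>v. k j (t j)) * (\<Prod>j\<in>u - v. b (t j)))"
  have int: "integrable (Pr u) (?f v)" if v: "v \<subseteq> u" for v
  proof (rule integrable_mult_bounded[OF g])
    have "(\<lambda>t. \<Prod>j\<in>v. k j (t j)) \<in> borel_measurable (Pr u)"
    proof (rule borel_measurable_prod)
      fix j assume "j \<in> v"
      with v have "j \<in> u" by blast
      show "(\<lambda>t. k j (t j)) \<in> borel_measurable (Pr u)"
        by (rule measurable_compose[OF measurable_component_singleton[OF \<open>j \<in> u\<close>] k[OF \<open>j \<in> u\<close>]])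
    qed
    moreover have "(\<lambda>t. \<Prod>j\<in>u - v. b (t j)) \<in> borel_measurable (Pr u)" by measurable
    ultimately show "(\<lambda>t. (\<Prod>j\<in>v. k j (t j)) * (\<Prod>j\<in>u - v. b (t j))) \<in> borel_measurable (Pr u)" by measurable
    show "\<bar>(\<Prod>j\<in>v. k j (t j)) * (\<Prod>j\<in>u - v. b (t j))\<bar> \<le> \<bar>L\<bar> ^ card v * c ^ card (u - v)" for t
    proof -
      have "\<bar>k j (t j)\<bar> \<le> \<bar>L\<bar>" if "j \<in> v" for j using kb[of j "t j"] that v by auto
      then show ?thesis unfolding abs_mult by (intro mult_mono abs_prod_le_power prod_b_bound) auto
    qed
  qed
  have "(LINT t|Pr u. g t * of_real (\<Prod>j\<in>u. k j (t j) + b (t j))) = (LINT t|Pr u. (\<Sum>v\<in>Pow u. ?f v t))"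
    by (simp only: prod_add[OF u] of_real_sum sum_distrib_left)
  also have "\<dots> = (\<Sum>v\<in>Pow u. LINT t|Pr u. ?f v t)"
    by (rule Bochner_Integration.integral_sum) (use int in auto)
  also have "\<dots> = (\<Sum>v\<in>Pow u. LINT t|Pr v. slice \<mu> b v (u - v) g t * of_real (\<Prod>j\<in>v. k j (t j)))"
  proof (rule sum.cong[OF refl])
    fix v assume "v \<in> Pow u"
    then have v: "v \<subseteq> u" "v \<union> (u - v) = u" "v \<inter> (u - v) = {}" "finite v" "finite (u - v)"
      using u finite_subset by auto
    interpret product_sigma_finite "\<lambda>_. \<mu>" by (rule product_sigma)
    have "(LINT t|Pr u. ?f v t) = (LINT x|Pr v. LINT y|Pr (u - v). ?f v (merge v (u - v) (x, y)))"
      using product_integral_fold[OF v(3-5), of "?f v"] int[OF v(1)] unfolding v(2) by simp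
    also have "\<dots> = (LINT t|Pr v. slice \<mu> b v (u - v) g t * of_real (\<Prod>j\<in>v. k j (t j)))"
    proof (rule Bochner_Integration.integral_cong[OF refl])
      fix x
      have "(\<Prod>j\<in>v. k j (merge v (u - v) (x, y) j)) = (\<Prod>j\<in>v. k j (x j))"
        "(\<Prod>j\<in>u - v. b (merge v (u - v) (x, y) j)) = (\<Prod>j\<in>u - v. b (y j))" for y
        by (auto intro!: prod.cong simp: merge_def)
      then show "(LINT y|Pr (u - v). ?f v (merge v (u - v) (x, y))) =
          slice \<mu> b v (u - v) g x * of_real (\<Prod>j\<in>v. k j (x j))"
        by (simp add: slice_def mult_ac flip: integral_mult_left_zero)
    qed
    finally show "(LINT t|Pr u. ?f v t) = (LINT t|Pr v. slice \<mu> b v (u - v) g t * of_real (\<Prod>j\<in>v. k j (t j)))" .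
  qed
  finally show ?thesis .
qed

end

lemma Lr_norm_sum:
  fixes f :: "'i \<Rightarrow> 'a \<Rightarrow> complex"
  assumes S: "finite S" and f: "\<And>i. i \<in> S \<Longrightarrow> f i \<in> Lr_space M s" and s: "0 \<le> s" "s \<le> 1"
  shows "(\<lambda>t. \<Sum>i\<in>S. f i t) \<in> Lr_space M s \<and>
    Lr_norm M s (\<lambda>t. \<Sum>i\<in>S. f i t) \<le> (\<Sum>i\<in>S. Lr_norm M s (f i))"
  using S f
proof (induction S rule: finite_induct)
  case empty
  then show ?case using Lr_norm_0_AE[of "\<lambda>_. 0::complex" M s] s by simp
next
  case (insert i S)
  have i: "f i \<in> Lr_space M s" and S: "(\<lambda>t. \<Sum>i\<in>S. f i t) \<in> Lr_space M s" using insert by auto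
  have m: "(\<lambda>t. \<Sum>i\<in>insert i S. f i t) \<in> borel_measurable M"
    using insert Lr_space_measurable by (intro borel_measurable_sum) blast
  have le: "AE t in M. norm (\<Sum>i\<in>insert i S. f i t) \<le> norm (f i t) + norm (\<Sum>i\<in>S. f i t)"
    using insert by (intro AE_I2) (simp add: norm_triangle_ineq)
  show ?case using Lr_space_add[OF i S s m le] Lr_norm_triangle[OF i S s m le] insert by auto
qed

text \<open>The measurable sets over which \<open>f\<close> integrates to 0 form a Dynkin system:
  the integral over the whole space handles complements, integrability handles disjoint unions. As
  it contains an intersection-stable generator, it contains every measurable set.\<close>

lemma integral_zero_Int_stable_imp_AE_zero:
  fixes f :: "'a \<Rightarrow> complex"
  assumes f: "integrable M f" and G: "Int_stable G" "G \<subseteq> Pow (space M)" "sets M = sigma_sets (space M) G"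
    and z: "\<And>A. A \<in> G \<Longrightarrow> (LINT t:A|M. f t) = 0" and z': "(LINT t|M. f t) = 0"
  shows "AE t in M. f t = 0"
proof -
  have si: "set_integrable M A f" if "A \<in> sets M" for A
    unfolding set_integrable_def using f that by (rule integrable_mult_indicator[rotated])
  have zero: "(LINT t:A|M. f t) = 0" if "A \<in> sets M" for A
    using G(1,2) that[unfolded G(3)]
  proof (induction rule: sigma_sets_induct_disjoint)
    case (basic A)
    then show ?case by (rule z)
  next
    case empty
    show ?case by (simp add: set_lebesgue_integral_def)
  next
    case (compl A)
    then have A: "A \<in> sets M" by (simp add: G(3))
    have "(LINT t:A \<union> (space M - A)|M. f t) = (LINT t:A|M. f t) + (LINT t:space M - A|M. f t)"
      using A by (intro set_integral_Un si) auto
    moreover have "A \<union> (space M - A) = space M" using sets.sets_into_space[OF A] by auto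
    ultimately show ?case using compl z' by (simp add: set_integral_space f)
  next
    case (union A)
    then have A: "A i \<in> sets M" for i by (auto simp: G(3))
    have "(LINT t:(\<Union>i. A i)|M. f t) = (\<Sum>i. LINT t:A i|M. f t)"
      using union A by (intro lebesgue_integral_countable_add si) (auto simp: disjoint_family_on_def)
    then show ?case using union by simp
  qed
  have "(LINT t:A|M. Re (f t)) = (LINT t:A|M. 0)" "(LINT t:A|M. Im (f t)) = (LINT t:A|M. 0)" if "A \<in> sets M" for A
    using arg_cong[OF zero[OF that], of Re] arg_cong[OF zero[OF that], of Im] si[OF that]
    unfolding set_lebesgue_integral_def set_integrable_def by (simp_all flip: integral_Re integral_Im)
  then have "AE t in M. Re (f t) = 0" "AE t in M. Im (f t) = 0"
    using f by (auto intro!: density_unique_real)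
  then show ?thesis by eventually_elim (simp add: complex_eq_iff)
qed

text \<open>Deliberately crude: Hoelder's inequality bounds the sum of the component norms by the
  mixed norm times the dual norm of 1 / w, and a common bound for all components costs the norm of
  \<open>w\<close>. What matters is that some finite constant exists.\<close>

lemma mixed_norm_bounded:
  assumes I: "finite I" and sr: "0 \<le> r" "r \<le> 1" and w: "\<And>u. u \<in> I \<Longrightarrow> 0 < w u" and K: "0 \<le> K"
    and le: "\<And>v. v \<in> I \<Longrightarrow> Lr_norm (\<mu> v) s (h v) \<le> K * (\<Sum>u\<in>I. Lr_norm (\<mu> u) s (g u))"
  shows "mixed_norm I \<mu> w s r h \<le>
    K * Lr_norm (count_space I) (1 - r) (\<lambda>u. 1 / w u) * Lr_norm (count_space I) r w * mixed_norm I \<mu> w s r g"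
proof -
  let ?L = "Lr_norm (count_space I) (1 - r) (\<lambda>u. 1 / w u)"
  have "(\<Sum>u\<in>I. Lr_norm (\<mu> u) s (g u)) = (\<Sum>u\<in>I. norm (w u * Lr_norm (\<mu> u) s (g u)) * norm (1 / w u))"
  proof (rule sum.cong[OF refl])
    fix u assume "u \<in> I"
    from w[OF this] show "Lr_norm (\<mu> u) s (g u) = norm (w u * Lr_norm (\<mu> u) s (g u)) * norm (1 / w u)"
      by (simp add: abs_mult)
  qed
  also have "\<dots> = (LINT u|count_space I. norm (w u * Lr_norm (\<mu> u) s (g u)) * norm (1 / w u))"
    using I by (simp add: lebesgue_integral_count_space_finite)
  also have "\<dots> \<le> mixed_norm I \<mu> w s r g * ?L"
    unfolding mixed_norm_def
    by (rule Lr_norm_Hoelder(2)) (use I sr in \<open>auto intro: Lr_space_count_space\<close>)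
  finally have S: "(\<Sum>u\<in>I. Lr_norm (\<mu> u) s (g u)) \<le> mixed_norm I \<mu> w s r g * ?L" .
  have "mixed_norm I \<mu> w s r h \<le> (K * (mixed_norm I \<mu> w s r g * ?L)) * Lr_norm (count_space I) r w"
    unfolding mixed_norm_def[of I \<mu> w s r h]
  proof (rule Lr_norm_count_space_mono[OF I sr(1)])
    show "0 \<le> K * (mixed_norm I \<mu> w s r g * ?L)" using K by simp
    fix v assume v: "v \<in> I"
    have "Lr_norm (\<mu> v) s (h v) \<le> K * (mixed_norm I \<mu> w s r g * ?L)"
      using le[OF v] mult_left_mono[OF S K] by linarith
    then show "\<bar>w v * Lr_norm (\<mu> v) s (h v)\<bar> \<le> K * (mixed_norm I \<mu> w s r g * ?L) * \<bar>w v\<bar>"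
      using w[OF v] by (simp add: abs_mult mult.commute)
  qed
  then show ?thesis by (simp add: mult_ac)
qed

section \<open>The coefficient operator, its boundedness and its triangularity\<close>

context averaging
begin

text \<open>The passage from ANOVA to anchored coefficients; the sign (-1)^|u - v| is contained in
  \<open>b\<close>.\<close>

definition mix :: "'i set set \<Rightarrow> ('i set \<Rightarrow> ('i \<Rightarrow> 'b) \<Rightarrow> complex) \<Rightarrow> 'i set \<Rightarrow> ('i \<Rightarrow> 'b) \<Rightarrow> complex" where
  "mix A g v t = (\<Sum>u\<in>{u \<in> A. v \<subseteq> u}. slice \<mu> b v (u - v) (g u) t)"

text \<open>Each slice costs c^|u - v|. Base \<open>max 1 c\<close> and exponent
  \<open>card (\<Union>A)\<close> give a bound uniform in u and v.\<close>

lemma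
  assumes A: "finite A" "\<And>u. u \<in> A \<Longrightarrow> finite u" and s: "0 \<le> s" "s \<le> 1"
    and g: "g \<in> mixed_space A Pr s"
  shows mix_space: "mix A g \<in> mixed_space A Pr s"
    and Lr_norm_mix: "v \<in> A \<Longrightarrow> Lr_norm (Pr v) s (mix A g v) \<le>
      max 1 c ^ card (\<Union>A) * (\<Sum>u\<in>A. Lr_norm (Pr u) s (g u))"
proof -
  have *: "mix A g v \<in> Lr_space (Pr v) s \<and> Lr_norm (Pr v) s (mix A g v) \<le>
      max 1 c ^ card (\<Union>A) * (\<Sum>u\<in>A. Lr_norm (Pr u) s (g u))" if v: "v \<in> A" for v
  proof -
    let ?S = "{u \<in> A. v \<subseteq> u}"
    have sl: "slice \<mu> b v (u - v) (g u) \<in> Lr_space (Pr v) s \<and>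
        Lr_norm (Pr v) s (slice \<mu> b v (u - v) (g u)) \<le> max 1 c ^ card (\<Union>A) * Lr_norm (Pr u) s (g u)"
      if u: "u \<in> ?S" for u
    proof -
      have vu: "v \<inter> (u - v) = {}" "finite v" "finite (u - v)" "v \<union> (u - v) = u" using u v A by auto
      have gu: "g u \<in> Lr_space (Pr (v \<union> (u - v))) s"
        using g u unfolding vu(4) by (simp add: mixed_space_def)
      have "card (u - v) \<le> card (\<Union>A)" using A u by (intro card_mono) auto
      then have "max 1 c ^ card (u - v) \<le> max 1 c ^ card (\<Union>A)" by (intro power_increasing) auto
      moreover have "c ^ card (u - v) \<le> max 1 c ^ card (u - v)"
        using c_nonneg by (intro power_mono) auto
      ultimately have "c ^ card (u - v) * Lr_norm (Pr u) s (g u) \<le> max 1 c ^ card (\<Union>A) * Lr_norm (Pr u) s (g u)"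
        by (intro mult_right_mono) auto
      then show ?thesis
        using Lr_space_slice[OF vu(1-3) gu s] Lr_norm_slice[OF vu(1-3) gu s] unfolding vu(4) by linarith
    qed
    have "mix A g v = (\<lambda>t. \<Sum>u\<in>?S. slice \<mu> b v (u - v) (g u) t)" by (simp add: mix_def fun_eq_iff)
    then have "mix A g v \<in> Lr_space (Pr v) s \<and>
        Lr_norm (Pr v) s (mix A g v) \<le> (\<Sum>u\<in>?S. Lr_norm (Pr v) s (slice \<mu> b v (u - v) (g u)))"
      using Lr_norm_sum[of ?S "\<lambda>u. slice \<mu> b v (u - v) (g u)" "Pr v" s] A sl s by simp
    moreover have "(\<Sum>u\<in>?S. Lr_norm (Pr v) s (slice \<mu> b v (u - v) (g u))) \<le>
        (\<Sum>u\<in>?S. max 1 c ^ card (\<Union>A) * Lr_norm (Pr u) s (g u))"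
      using sl by (intro sum_mono) blast
    moreover have "\<dots> \<le> (\<Sum>u\<in>A. max 1 c ^ card (\<Union>A) * Lr_norm (Pr u) s (g u))"
      using A by (intro sum_mono2) auto
    ultimately show ?thesis by (auto simp: sum_distrib_left)
  qed
  show "mix A g \<in> mixed_space A Pr s" using * by (simp add: mixed_space_def)
  show "v \<in> A \<Longrightarrow> Lr_norm (Pr v) s (mix A g v) \<le>
      max 1 c ^ card (\<Union>A) * (\<Sum>u\<in>A. Lr_norm (Pr u) s (g u))" using * by blast
qed

lemma almost_linear_mix:
  assumes A: "finite A" "\<And>u. u \<in> A \<Longrightarrow> finite u"
  shows "almost_linear A Pr (mix A)"
  unfolding almost_linear_def
proof (intro conjI allI impI ballI)
  fix G v assume G: "G \<in> mixed_space A Pr 1" and v: "v \<in> A"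
  have "mix A G \<in> mixed_space A Pr 1" by (rule mix_space[OF A _ _ G]) auto
  then show "mix A G v \<in> borel_measurable (Pr v)"
    using v Lr_space_measurable by (auto simp: mixed_space_def)
next
  fix G H K a v
  assume G: "G \<in> mixed_space A Pr 1" and H: "H \<in> mixed_space A Pr 1" and K: "K \<in> mixed_space A Pr 1"
    and eq: "\<forall>u\<in>A. AE t in Pr u. K u t = a * G u t + H u t" and v: "v \<in> A"
  have int: "integrable (Pr u) (F u)" if "F \<in> mixed_space A Pr 1" "u \<in> A" for F u
  proof -
    interpret U: prob_space "Pr u" by (rule prob_Pr)
    show ?thesis using that U.Lr_space_integrable[of "F u" 1] by (simp add: mixed_space_def)
  qed
  have "AE t in Pr v. slice \<mu> b v (u - v) (K u) t = a * slice \<mu> b v (u - v) (G u) t + slice \<mu> b v (u - v) (H u) t"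
    if u: "u \<in> {u \<in> A. v \<subseteq> u}" for u
  proof -
    have vu: "v \<inter> (u - v) = {}" "finite v" "finite (u - v)" "v \<union> (u - v) = u" using u v A by auto
    show ?thesis by (rule slice_AE_linear[OF vu(1-3)], unfold vu(4))
         (use int[OF G] int[OF H] borel_measurable_integrable[OF int[OF K]] eq u in auto)
  qed
  then have "AE t in Pr v. \<forall>u\<in>{u \<in> A. v \<subseteq> u}.
      slice \<mu> b v (u - v) (K u) t = a * slice \<mu> b v (u - v) (G u) t + slice \<mu> b v (u - v) (H u) t"
    using A by (intro AE_finite_allI) auto
  then show "AE t in Pr v. mix A K v t = a * mix A G v t + mix A H v t"
    by eventually_elim (simp add: mix_def sum.distrib sum_distrib_left)
qed

text \<open>Induction from large sets downwards, measured by card (\<Union>A) - card v: once g u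
  vanishes for all proper supersets u of v in \<open>A\<close>, the only term left is the slice over
  the empty set, which is g v.\<close>

lemma mix_triangular:
  assumes A: "finite A" "\<And>u. u \<in> A \<Longrightarrow> finite u" and g: "g \<in> mixed_space A Pr 1"
    and zero: "\<And>v. v \<in> A \<Longrightarrow> AE t in Pr v. mix A g v t = 0" and v: "v \<in> A"
  shows "AE t in Pr v. g v t = 0"
  using v
proof (induction "card (\<Union>A) - card v" arbitrary: v rule: less_induct)
  case less
  have int: "integrable (Pr u) (g u)" if "u \<in> A" for u
  proof -
    interpret U: prob_space "Pr u" by (rule prob_Pr)
    show ?thesis using that g U.Lr_space_integrable[of "g u" 1] by (simp add: mixed_space_def)
  qed
  have S: "AE t in Pr v. slice \<mu> b v (u - v) (g u) t = 0" if u: "u \<in> A" "v \<subset> u" for u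
  proof -
    have vu: "v \<inter> (u - v) = {}" "finite v" "finite (u - v)" "v \<union> (u - v) = u"
      using u less.prems A by auto
    have "card v < card u" using u A by (intro psubset_card_mono) auto
    moreover have "card u \<le> card (\<Union>A)" using A u by (intro card_mono) auto
    ultimately have "AE t in Pr u. g u t = 0" using u by (intro less.hyps) auto
    \<comment> \<open>A zero function satisfies g = -g + g, and linearity of the slice turns this
      into the vanishing of its slice.\<close>
    then have "AE t in Pr u. g u t = (-1) * g u t + g u t" by simp
    then have "AE t in Pr v. slice \<mu> b v (u - v) (g u) t =
        (-1) * slice \<mu> b v (u - v) (g u) t + slice \<mu> b v (u - v) (g u) t"
      using slice_AE_linear[OF vu(1-3), of "g u" "g u" "g u" "-1"] int[OF u(1)]
      unfolding vu(4) by auto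
    then show ?thesis by simp
  qed
  have "AE t in Pr v. \<forall>u\<in>{u \<in> A. v \<subset> u}. slice \<mu> b v (u - v) (g u) t = 0"
    using A S by (intro AE_finite_allI) auto
  then show ?case
    using zero[OF less.prems] AE_space
  proof eventually_elim
    case (elim t)
    have "{u \<in> A. v \<subseteq> u} = insert v {u \<in> A. v \<subset> u}" using less.prems by auto
    then have "mix A g v t = slice \<mu> b v {} (g v) t" using A(1) elim(1) by (simp add: mix_def)
    also have "\<dots> = g v (merge v {} (t, \<lambda>_. undefined))"
      by (simp add: slice_def PiM_empty lebesgue_integral_count_space_finite)
    \<comment> \<open>Points of the product space are extensional, so merging with no further
      coordinates returns the same point.\<close>
    also have "merge v {} (t, \<lambda>_. undefined) = t"
      using elim(3) by (auto simp: merge_def space_PiM PiE_def extensional_def fun_eq_iff)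
    finally show ?case using elim(2) by simp
  qed
qed

end

section \<open>Injectivity of the anchored kernel operators\<close>

context averaging
begin

text \<open>Since 1_A \<kappa>_X is again a kernel for each A in \<open>E\<close>, testing g against
  all products of kernels amounts to integrating g \<Prod> \<kappa>_X over all boxes with sides in
  \<open>E\<close>. These boxes are stable under intersection and generate the product
  sigma-algebra. The factor \<kappa>_X stays in the conclusion because nothing is learned where it
  vanishes.\<close>

lemma product_kernel_injective:
  fixes g :: "('i \<Rightarrow> 'b) \<Rightarrow> complex" and \<kappa> :: "'x \<Rightarrow> 'b \<Rightarrow> real" and D :: "'x set"
  assumes u: "finite u" and g: "integrable (Pr u) g"
    and X: "X \<in> D" and \<kappa>: "\<And>x. x \<in> D \<Longrightarrow> \<kappa> x \<in> borel_measurable \<mu>" "\<And>t. \<bar>\<kappa> X t\<bar> \<le> L"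
    and E: "Int_stable E" "space \<mu> \<in> E" "sets \<mu> = sigma_sets (space \<mu>) E"
    and E_kernel: "\<And>A. A \<in> E \<Longrightarrow> \<exists>x\<in>D. AE t in \<mu>. indicator A t * \<kappa> X t = \<kappa> x t"
    and z: "\<And>x. (\<And>j. j \<in> u \<Longrightarrow> x j \<in> D) \<Longrightarrow> (LINT t|Pr u. g t * of_real (\<Prod>j\<in>u. \<kappa> (x j) (t j))) = 0"
  shows "AE t in Pr u. g t * of_real (\<Prod>j\<in>u. \<kappa> X (t j)) = 0"
proof -
  note [measurable] = borel_measurable_integrable[OF g] \<kappa>(1)[OF X]
  have E_sets: "E \<subseteq> sets \<mu>" unfolding E(3) by blast
  then have EP: "E \<subseteq> Pow (space \<mu>)" using sets.sets_into_space by blast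
  let ?f = "\<lambda>t. g t * of_real (\<Prod>j\<in>u. \<kappa> X (t j))"
  define G where "G = {Pi\<^sub>E u A | A. \<forall>j\<in>u. A j \<in> E}"
  have f: "integrable (Pr u) ?f"
  proof (rule integrable_mult_bounded[OF g])
    show "\<bar>\<Prod>j\<in>u. \<kappa> X (t j)\<bar> \<le> L ^ card u" for t by (rule abs_prod_le_power) (rule \<kappa>(2))
  qed measurable
  have zG: "(LINT t:B|Pr u. ?f t) = 0" if B: "B \<in> G" for B
  proof -
    obtain A where A: "B = Pi\<^sub>E u A" "\<forall>j\<in>u. A j \<in> E" using B by (auto simp: G_def)
    then have As: "A j \<in> sets \<mu>" if "j \<in> u" for j using that E_sets by blast
    have "\<forall>j\<in>u. \<exists>x. x \<in> D \<and> (AE t in \<mu>. indicator (A j) t * \<kappa> X t = \<kappa> x t)"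
      using A(2) E_kernel by blast
    from bchoice[OF this] obtain x where
      x: "\<forall>j\<in>u. x j \<in> D \<and> (AE t in \<mu>. indicator (A j) t * \<kappa> X t = \<kappa> (x j) t)" ..
    have "AE t in Pr u. \<forall>j\<in>u. indicator (A j) (t j) * \<kappa> X (t j) = \<kappa> (x j) (t j)"
    proof (rule AE_finite_allI[OF u])
      fix j assume j: "j \<in> u"
      show "AE t in Pr u. indicator (A j) (t j) * \<kappa> X (t j) = \<kappa> (x j) (t j)"
        by (rule AE_PiM_component[OF prob_space_axioms j]) (use x j in blast)
    qed
    then have eq: "AE t in Pr u. indicator B t *\<^sub>R ?f t = g t * of_real (\<Prod>j\<in>u. \<kappa> (x j) (t j))"
      using AE_space
    proof eventually_elim
      case (elim t)
      have "indicator B t = (\<Prod>j\<in>u. indicator (A j) (t j) :: real)"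
        unfolding A(1) by (rule indicator_PiE[OF u]) (use elim(2) in \<open>auto simp: space_PiM PiE_def\<close>)
      then have eq: "(\<Prod>j\<in>u. \<kappa> (x j) (t j)) = indicator B t * (\<Prod>j\<in>u. \<kappa> X (t j))"
        using elim(1) by (simp flip: prod.distrib)
      show ?case unfolding eq scaleR_conv_of_real of_real_mult by (rule mult.left_commute)
    qed
    have "(LINT t:B|Pr u. ?f t) = (LINT t|Pr u. g t * of_real (\<Prod>j\<in>u. \<kappa> (x j) (t j)))"
      unfolding set_lebesgue_integral_def
    proof (rule integral_cong_AE[OF _ _ eq])
      have "B \<in> sets (Pr u)" unfolding A(1) using As u by (intro sets_PiM_I_finite) auto
      then show "(\<lambda>t. indicator B t *\<^sub>R ?f t) \<in> borel_measurable (Pr u)" by measurable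
      have "(\<lambda>t. \<Prod>j\<in>u. \<kappa> (x j) (t j)) \<in> borel_measurable (Pr u)"
      proof (rule borel_measurable_prod)
        fix j assume "j \<in> u"
        then show "(\<lambda>t. \<kappa> (x j) (t j)) \<in> borel_measurable (Pr u)"
          using measurable_compose[OF measurable_component_singleton[OF \<open>j \<in> u\<close>, of "\<lambda>_. \<mu>"] \<kappa>(1)] x by blast
      qed
      then show "(\<lambda>t. g t * of_real (\<Prod>j\<in>u. \<kappa> (x j) (t j))) \<in> borel_measurable (Pr u)" by measurable
    qed
    also have "\<dots> = 0" using z x by blast
    finally show ?thesis .
  qed
  show ?thesis
  proof (rule integral_zero_Int_stable_imp_AE_zero[OF f _ _ _ zG])
    show "Int_stable G"
    proof (rule Int_stableI)
      fix B B' assume "B \<in> G" "B' \<in> G"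
      then obtain A A' where "B = Pi\<^sub>E u A" "\<forall>j\<in>u. A j \<in> E" "B' = Pi\<^sub>E u A'" "\<forall>j\<in>u. A' j \<in> E"
        by (auto simp: G_def)
      moreover from this have "\<forall>j\<in>u. A j \<inter> A' j \<in> E" using Int_stableD[OF E(1)] by blast
      ultimately show "B \<inter> B' \<in> G" by (auto simp: G_def PiE_Int intro!: exI[of _ "\<lambda>j. A j \<inter> A' j"])
    qed
    show "G \<subseteq> Pow (space (Pr u))" using EP by (force simp: G_def space_PiM PiE_def Pi_def)
    show "sets (Pr u) = sigma_sets (space (Pr u)) G"
    proof -
      let ?P = "{{f \<in> \<Pi>\<^sub>E i\<in>u. space \<mu>. \<forall>i\<in>j. f i \<in> A i} |A j. j \<in> {u} \<and> A \<in> Pi j (\<lambda>_. E)}"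
      have box: "{f \<in> \<Pi>\<^sub>E i\<in>u. space \<mu>. \<forall>i\<in>u. f i \<in> A i} = Pi\<^sub>E u A" if "\<forall>i\<in>u. A i \<in> E" for A
        using that EP by (auto simp: PiE_def Pi_def)
      have "B \<in> ?P \<longleftrightarrow> B \<in> G" for B
      proof
        assume "B \<in> ?P"
        then obtain A where A: "B = {f \<in> \<Pi>\<^sub>E i\<in>u. space \<mu>. \<forall>i\<in>u. f i \<in> A i}" "\<forall>i\<in>u. A i \<in> E"
          by (auto simp: Pi_def)
        then show "B \<in> G" using box[OF A(2)] unfolding G_def by blast
      next
        assume "B \<in> G"
        then obtain A where A: "B = Pi\<^sub>E u A" "\<forall>i\<in>u. A i \<in> E" unfolding G_def by blast
        then have "B = {f \<in> \<Pi>\<^sub>E i\<in>u. space \<mu>. \<forall>i\<in>u. f i \<in> A i}" "A \<in> Pi u (\<lambda>_. E)"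
          using box[OF A(2)] by (auto simp: Pi_def)
        then show "B \<in> ?P" by blast
      qed
      then have "?P = G" by blast
      have "sets (Pr u) = sets (PiM u (\<lambda>_. sigma (space \<mu>) (E)))"
        using E(3) EP by (intro sets_PiM_cong) auto
      also have "\<dots> = sets (sigma (\<Pi>\<^sub>E i\<in>u. space \<mu>) ?P)"
        by (rule sets_PiM_sigma) (use E(2) EP u in auto)
      also have "\<dots> = sigma_sets (space (Pr u)) G"
        unfolding \<open>?P = G\<close> using \<open>G \<subseteq> Pow (space (Pr u))\<close> by (simp add: space_PiM)
      finally show ?thesis .
    qed
    show "(LINT t|Pr u. ?f t) = 0" by (rule z) (rule X)
  qed
qed

end

text \<open>A Lebesgue set splits into a Borel part below X, a null part below X and the part from X
  on. The intervals generate the first; the other two belong to \<open>E\<close> by the assumption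
  \<open>null\<close>, which admits every measurable set that is negligible below X.\<close>

lemma sets_lebesgue_on_generated:
  fixes D :: "real set" and X :: real
  assumes D: "D \<subseteq> {0..}" "D \<in> sets lebesgue" "X \<in> D" "{0..<X} \<subseteq> D" and E: "E \<subseteq> sets (lebesgue_on D)"
    and int: "\<And>x. x \<in> D \<Longrightarrow> x \<le> X \<Longrightarrow> {0..<x} \<in> E" and top: "D \<in> E"
    and null: "\<And>N. N \<in> sets (lebesgue_on D) \<Longrightarrow> AE t in lebesgue_on D. t \<notin> N \<or> X \<le> t \<Longrightarrow> N \<in> E"
  shows "sets (lebesgue_on D) = sigma_sets D E"
proof
  interpret S: sigma_algebra D "sigma_sets D E"
    by (rule sigma_algebra_sigma_sets) (use E sets.sets_into_space[of _ "lebesgue_on D"] in auto)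
  have "sigma_sets D E = sigma_sets (space (lebesgue_on D)) E" by simp
  also have "\<dots> \<subseteq> sets (lebesgue_on D)" by (rule sets.sigma_sets_subset[OF E])
  finally show "sigma_sets D E \<subseteq> sets (lebesgue_on D)" .
  have borel: "B \<inter> {0..<X} \<in> sigma_sets D E" if "B \<in> sets borel" for B :: "real set"
  proof -
    have "sets borel = sigma_sets UNIV (range lessThan :: real set set)" by (simp add: borel_Iio)
    with that have "B \<in> sigma_sets UNIV (range lessThan)" by simp
    then show ?thesis
    proof induction
      case (Basic a)
      then obtain x where a: "a = {..<x}" by auto
      consider "x \<le> 0" | "0 < x" "x < X" | "X \<le> x" by linarith
      then show ?case
      proof cases
        case 1
        then have "a \<inter> {0..<X} = {}" using a by auto
        then show ?thesis by simp
      next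
        case 2
        then have "a \<inter> {0..<X} = {0..<x}" using a by auto
        moreover have "x \<in> D" using 2 D(4) by auto
        ultimately show ?thesis using int[of x] 2 by auto
      next
        case 3
        then have "a \<inter> {0..<X} = {0..<X}" using a by auto
        then show ?thesis using int[of X] D(3) by auto
      qed
    next
      case Empty
      show ?case by simp
    next
      case (Compl a)
      have "(UNIV - a) \<inter> {0..<X} = {0..<X} - (a \<inter> {0..<X})" by auto
      then show ?case using Compl.IH int[of X] D(3) S.Diff by auto
    next
      case (Union a)
      have "(\<Union>i. a i) \<inter> {0..<X} = (\<Union>i. a i \<inter> {0..<X})" by auto
      also have "\<dots> \<in> sigma_sets D E" by (rule sigma_sets.Union) (rule Union.IH)
      finally show ?case .
    qed
  qed
  show "sets (lebesgue_on D) \<subseteq> sigma_sets D E"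
  proof
    fix A assume A: "A \<in> sets (lebesgue_on D)"
    then have AD: "A \<subseteq> D" "A \<in> sets lebesgue"
      using D(2) sets.sets_into_space[OF A] by (auto simp: sets_restrict_space_iff)
    obtain S N N' where SN: "A = S \<union> N" "N \<subseteq> N'" "N' \<in> null_sets lborel" "S \<in> sets borel"
      using AD(2) by (auto elim: sets_completionE)
    have *: "N \<inter> {0..<X} \<in> E"
    proof (rule null)
      have N: "N \<in> null_sets lebesgue"
        using SN by (meson null_sets_completionI null_sets_completion_subset)
      show "N \<inter> {0..<X} \<in> sets (lebesgue_on D)" using N D by (auto simp: sets_restrict_space_iff)
      have "AE t in lebesgue. t \<notin> N" by (rule AE_not_in[OF N])
      then show "AE t in lebesgue_on D. t \<notin> N \<inter> {0..<X} \<or> X \<le> t"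
        using D(2) by (subst AE_restrict_space_iff) auto
    qed
    have A': "A \<inter> {X..} \<in> E"
    proof (rule null)
      show "A \<inter> {X..} \<in> sets (lebesgue_on D)" using AD D by (auto simp: sets_restrict_space_iff)
    qed auto
    have "A = (S \<inter> {0..<X}) \<union> (N \<inter> {0..<X}) \<union> (A \<inter> {X..})"
      using SN(1) AD(1) D(1) by (auto simp: not_less)
    then show "A \<in> sigma_sets D E"
      using S.Un[OF S.Un[OF borel[OF SN(4)] sigma_sets.Basic[OF *]] sigma_sets.Basic[OF A']] by simp
  qed
qed

section \<open>The spaces of the theorem\<close>

text \<open>The exceptional set lies in a box with one null side, which has measure 0 even if other
  sides have infinite measure. This matters for Lebesgue measure on an unbounded domain.\<close>

lemma (in product_sigma_finite) AE_PiM_coordinate: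
  assumes u: "finite u" and i: "i \<in> u" and P: "AE t in M i. P t"
  shows "AE t in PiM u M. P (t i)"
proof -
  interpret finite_product_sigma_finite M u by standard fact
  obtain N where N: "N \<in> null_sets (M i)" "{t \<in> space (M i). \<not> P t} \<subseteq> N"
    using P by (auto simp: eventually_ae_filter)
  let ?B = "\<lambda>j. if j = i then N else space (M j)"
  have "emeasure (PiM u M) (Pi\<^sub>E u ?B) = (\<Prod>j\<in>u. emeasure (M j) (?B j))"
    using N by (intro measure_times) auto
  also have "\<dots> = 0" using N i u by (intro prod_zero) auto
  finally have "Pi\<^sub>E u ?B \<in> null_sets (PiM u M)"
    using N u by (auto simp: null_sets_def intro!: sets_PiM_I_finite)
  moreover have "{t \<in> space (PiM u M). \<not> P (t i)} \<subseteq> Pi\<^sub>E u ?B"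
    using N(2) i by (auto simp: space_PiM PiE_def Pi_def)
  ultimately show ?thesis unfolding eventually_ae_filter by blast
qed

lemma conjugate_index_1: "conjugate_index 1 = inverse (ennreal 0)"
  by (simp add: conjugate_index_def)

locale admissible_setting =
  fixes D :: "real set" and \<psi> :: "real \<Rightarrow> real"
  assumes adm: "admissible_domain D" and dens: "positive_density D \<psi>"
    and cond: "integrability_condition D \<psi> 1"
begin

abbreviation Leb :: "real measure" where "Leb \<equiv> lebesgue_on D"
abbreviation "T\<^sub>0 \<equiv> T_op D \<psi> Anchored"

definition \<mu> :: "real measure" where "\<mu> = density Leb (\<lambda>t. ennreal (\<psi> t))"

lemma domain: "D \<subseteq> {0..}" "D \<in> sets lebesgue" "0 \<in> D" "\<And>x. x \<in> D \<Longrightarrow> {0..x} \<subseteq> D" "\<And>x. x \<in> D \<Longrightarrow> {0..<x} \<subseteq> D"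
  using adm by (auto simp: admissible_domain_def)

text \<open>The right end point of a closed interval is the only exception. Hence almost every point
  lies in some [0, X) with X in D, by which the injectivity proof exhausts the domain.\<close>

lemma AE_ex_greater: "AE t in Leb. \<exists>x\<in>D. t < x"
proof -
  consider "D = {0..}" | T where "D = {0..<T}" | T where "D = {0..T}"
    using adm by (auto simp: admissible_domain_def)
  then show ?thesis
  proof cases
    case 1
    have "\<exists>x\<in>D. t < x" if "t \<in> D" for t using 1 that by (intro bexI[of _ "t + 1"]) auto
    then show ?thesis by (intro AE_I2) simp
  next
    case 2
    have "\<exists>x\<in>D. t < x" if "t \<in> D" for t using 2 that dense[of t T] by auto
    then show ?thesis by (intro AE_I2) simp
  next
    case 3
    have "AE t in lebesgue. t \<notin> {T}" by (rule AE_not_in) simp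
    then have "AE t in Leb. t \<notin> {T}" using domain(2) by (subst AE_restrict_space_iff) auto
    then show ?thesis using AE_space by eventually_elim (use 3 in \<open>auto intro!: bexI[of _ T]\<close>)
  qed
qed

lemma psi [measurable]: "\<psi> \<in> borel_measurable Leb"
  and psi_nonneg: "t \<in> D \<Longrightarrow> 0 \<le> \<psi> t" and psi_pos: "AE t in Leb. 0 < \<psi> t"
  and psi_1: "(\<integral>\<^sup>+t. ennreal (\<psi> t) \<partial>Leb) = 1"
  using dens by (auto simp: positive_density_def)

lemma space_mu [simp]: "space \<mu> = D" and sets_mu [simp, measurable_cong]: "sets \<mu> = sets Leb"
  by (simp_all add: \<mu>_def)

lemma AE_mu: "(AE t in \<mu>. P t) \<longleftrightarrow> (AE t in Leb. P t)"
  unfolding \<mu>_def using psi_pos by (subst AE_density) (auto elim: eventually_elim2)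

lemma prob_mu: "prob_space \<mu>"
proof
  have "emeasure \<mu> (space \<mu>) = (\<integral>\<^sup>+t. ennreal (\<psi> t) * indicator D t \<partial>Leb)"
    unfolding \<mu>_def by (subst emeasure_density) auto
  also have "\<dots> = (\<integral>\<^sup>+t. ennreal (\<psi> t) \<partial>Leb)" by (intro nn_integral_cong) (auto simp: indicator_def)
  finally show "emeasure \<mu> (space \<mu>) = 1" using psi_1 by simp
qed

lemma psi_integrable: "integrable Leb \<psi>"
  using psi_1 psi_nonneg by (intro integrableI_nn_integral_finite[of _ _ 1]) (auto intro: AE_I2)

text \<open>The tail integral is antitone in t and therefore Borel. It is rewritten with an
  indicator so that its values are compared under one measure.\<close>

lemma psi_bar_measurable [measurable]: "psi_bar D \<psi> \<in> borel_measurable Leb"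
proof -
  have eq: "psi_bar D \<psi> t = (LINT y|Leb. indicator {t..} y * \<psi> y)" for t
  proof -
    have "lebesgue_on (D \<inter> {t..}) = restrict_space Leb {t..}"
      by (simp add: restrict_restrict_space domain)
    then have "psi_bar D \<psi> t = (LINT y|restrict_space Leb {t..}. \<psi> y)" by (simp only: psi_bar_def)
    also have "\<dots> = (LINT y|Leb. indicator {t..} y *\<^sub>R \<psi> y)"
      using domain(2) by (intro integral_restrict_space) (auto simp: sets_restrict_space)
    finally show ?thesis by simp
  qed
  have int: "integrable Leb (\<lambda>y. indicator {t..} y * \<psi> y)" for t
  proof -
    have "{t..} \<inter> D \<in> sets Leb" using domain(2) by (auto simp: sets_restrict_space_iff)
    then have "integrable Leb (\<lambda>y. indicator ({t..} \<inter> D) y *\<^sub>R \<psi> y)"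
      by (rule integrable_mult_indicator[OF _ psi_integrable])
    then show ?thesis
      by (rule Bochner_Integration.integrable_cong[THEN iffD1, OF refl, rotated]) (auto simp: indicator_def)
  qed
  have "mono (\<lambda>t. - psi_bar D \<psi> t)"
  proof (rule monoI)
    fix x y :: real assume "x \<le> y"
    then show "- psi_bar D \<psi> x \<le> - psi_bar D \<psi> y"
      unfolding eq neg_le_iff_le by (intro integral_mono int) (auto simp: indicator_def psi_nonneg)
  qed
  then have "(\<lambda>t. - (- psi_bar D \<psi> t)) \<in> borel_measurable borel"
    by (intro borel_measurable_uminus borel_measurable_mono)
  then have "psi_bar D \<psi> \<in> borel_measurable borel" by simp
  then have "psi_bar D \<psi> \<in> borel_measurable lebesgue" by (simp add: measurable_completion)
  then show ?thesis by (rule measurable_restrict_space1)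
qed

text \<open>For p = 1 the conjugate index is infinity, so the integrability condition says that
  \<Psi> / \<psi> is essentially bounded on D and 1 / \<psi> on each [0, x).\<close>

lemma ex_bound:
  shows "\<exists>C\<ge>0. AE t in Leb. \<bar>psi_bar D \<psi> t * \<psi> t powr - 1\<bar> \<le> C"
    and "x \<in> D \<Longrightarrow> \<exists>C\<ge>0. AE t in Leb. t < x \<longrightarrow> \<psi> t powr - 1 \<le> C"
proof -
  have loc: "(\<lambda>t. \<psi> t powr - 1) \<in> Lr_space (lebesgue_on {0..<x}) 0" if "x \<in> D" for x
    using cond that
    by (auto simp: integrability_condition_def Lp_loc_def Lr_space_def conjugate_index_1)
  have glob: "(\<lambda>t. psi_bar D \<psi> t * \<psi> t powr - 1) \<in> Lr_space Leb 0"
    using cond by (auto simp: integrability_condition_def Lr_space_def conjugate_index_1)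
  show "\<exists>C\<ge>0. AE t in Leb. \<bar>psi_bar D \<psi> t * \<psi> t powr - 1\<bar> \<le> C"
    using glob by (simp add: Lr_space_zero)
  assume x: "x \<in> D"
  from loc[OF x] obtain C where C: "0 \<le> C" "AE t in lebesgue_on {0..<x}. \<psi> t powr - 1 \<le> C"
    by (auto simp: Lr_space_zero)
  have "AE t in Leb. t < x \<longrightarrow> \<psi> t powr - 1 \<le> C"
    using C(2) domain by (subst (asm) AE_restrict_space_iff, simp, subst AE_restrict_space_iff)
      (auto elim!: eventually_mono)
  with C(1) show "\<exists>C\<ge>0. AE t in Leb. t < x \<longrightarrow> \<psi> t powr - 1 \<le> C" by blast
qed

text \<open>
  The kernels with respect to \<open>\<mu>\<close> are those with respect to the Lebesgue measure divided by
  \<open>\<psi>\<close>. They are bounded almost everywhere, and truncation makes them bounded.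
\<close>

definition c :: real where
  "c = (SOME C. 0 \<le> C \<and> (AE t in Leb. \<bar>psi_bar D \<psi> t * \<psi> t powr - 1\<bar> \<le> C))"

definition b :: "real \<Rightarrow> real" where
  "b t = (if \<bar>psi_bar D \<psi> t * \<psi> t powr - 1\<bar> \<le> c then - (psi_bar D \<psi> t * \<psi> t powr - 1) else 0)"

definition L :: "real \<Rightarrow> real" where
  "L x = (SOME C. 0 \<le> C \<and> (AE t in Leb. t < x \<longrightarrow> \<psi> t powr - 1 \<le> C))"

definition \<kappa> :: "real \<Rightarrow> real \<Rightarrow> real" where
  "\<kappa> x t = (if 0 \<le> t \<and> t < x \<and> \<psi> t powr - 1 \<le> L x then \<psi> t powr - 1 else 0)"

lemma c_bound: "0 \<le> c" "AE t in Leb. \<bar>psi_bar D \<psi> t * \<psi> t powr - 1\<bar> \<le> c"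
  using someI_ex[OF ex_bound(1)[unfolded Bex_def]] by (simp_all add: c_def)

lemma L_bound:
  assumes "x \<in> D"
  shows "0 \<le> L x" "AE t in Leb. t < x \<longrightarrow> \<psi> t powr - 1 \<le> L x"
  using someI_ex[OF ex_bound(2)[OF assms]] by (simp_all add: L_def)

lemma b_AE: "AE t in Leb. b t * \<psi> t = - psi_bar D \<psi> t"
  using c_bound(2) psi_pos by eventually_elim (auto simp: b_def powr_minus field_simps)

lemma kappa_AE:
  assumes "x \<in> D"
  shows "AE t in Leb. \<kappa> x t = indicator {0..<x} t * \<psi> t powr - 1"
  using L_bound(2)[OF assms] by eventually_elim (auto simp: \<kappa>_def)

lemma kappa_psi_AE:
  assumes "x \<in> D"
  shows "AE t in Leb. \<kappa> x t * \<psi> t = indicator {0..<x} t"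
  using kappa_AE[OF assms] psi_pos by eventually_elim (auto simp: powr_minus indicator_def)

lemma id_measurable [measurable]: "(\<lambda>t. t) \<in> borel_measurable Leb"
  using id_borel_measurable_lebesgue_on[of D] by (simp add: id_def)

lemma kappa_measurable [measurable]: "\<kappa> x \<in> borel_measurable \<mu>"
  unfolding \<kappa>_def by measurable

lemma kappa_bound: "x \<in> D \<Longrightarrow> \<bar>\<kappa> x t\<bar> \<le> L x"
  using L_bound(1) by (auto simp: \<kappa>_def)

sublocale averaging \<mu> b c
proof -
  interpret prob_space \<mu> by (rule prob_mu)
  show "averaging \<mu> b c"
  proof
    show "b \<in> borel_measurable \<mu>" unfolding b_def by measurable
    show "\<bar>b t\<bar> \<le> c" for t using c_bound(1) by (auto simp: b_def)
  qed
qed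

section \<open>Kernel integrals over products of probability measures\<close>

lemma sigma_finite_lebesgue_on_D: "sigma_finite_measure Leb"
proof -
  have "sigma_finite_measure (lebesgue :: real measure)"
  proof
    show "\<exists>A. countable A \<and> A \<subseteq> sets lebesgue \<and> \<Union>A = space (lebesgue :: real measure) \<and>
        (\<forall>a\<in>A. emeasure lebesgue a \<noteq> \<infinity>)"
    proof (intro exI[of _ "range (\<lambda>n. {- real n..real n})"] conjI)
      have "\<exists>n. x \<in> {- real n..real n}" for x
      proof -
        obtain n where "\<bar>x\<bar> \<le> real n" using real_arch_simple by blast
        then have "x \<in> {- real n..real n}" by (simp add: abs_le_iff)
        then show ?thesis ..
      qed
      then show "(\<Union>n. {- real n..real n}) = space (lebesgue :: real measure)" by auto
    qed auto
  qed
  then show ?thesis using domain(2) by (intro sigma_finite_measure_restrict_space) auto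
qed

lemma product_lebesgue_sigma: "product_sigma_finite (\<lambda>_. Leb)"
  by (rule product_sigma_finite.intro) (rule sigma_finite_lebesgue_on_D)

text \<open>Both measures agree on boxes, where Tonelli's theorem factorises the integral of the
  product density. The norms of the spaces are thus norms over a product of probability
  measures.\<close>

lemma weighted_measure_eq:
  assumes u: "finite u"
  shows "weighted_measure D \<psi> u = Pr u"
proof -
  interpret M: product_sigma_finite "\<lambda>_::nat. Leb" by (rule product_lebesgue_sigma)
  interpret \<mu>: product_sigma_finite "\<lambda>_::nat. \<mu>" by (rule product_sigma)
  show ?thesis
  proof (rule \<mu>.PiM_eqI[OF u])
    have [measurable]: "(\<lambda>t. ennreal (\<Prod>j\<in>u. \<psi> (t j))) \<in> borel_measurable (product_lebesgue D u)"
      unfolding product_lebesgue_def by measurable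
    show "sets (weighted_measure D \<psi> u) = sets (Pr u)"
      unfolding weighted_measure_def product_lebesgue_def sets_density by (intro sets_PiM_cong) auto
    fix A assume A: "\<And>i. i \<in> u \<Longrightarrow> A i \<in> sets \<mu>"
    then have A': "A i \<in> sets Leb" if "i \<in> u" for i using that by simp
    then have PA: "Pi\<^sub>E u A \<in> sets (product_lebesgue D u)"
      unfolding product_lebesgue_def using u by (intro sets_PiM_I_finite) auto
    have "emeasure (weighted_measure D \<psi> u) (Pi\<^sub>E u A) =
        (\<integral>\<^sup>+t. ennreal (\<Prod>j\<in>u. \<psi> (t j)) * indicator (Pi\<^sub>E u A) t \<partial>product_lebesgue D u)"
      unfolding weighted_measure_def using PA by (intro emeasure_density) auto
    also have "\<dots> = (\<integral>\<^sup>+t. (\<Prod>j\<in>u. ennreal (\<psi> (t j)) * indicator (A j) (t j)) \<partial>product_lebesgue D u)"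
    proof (rule nn_integral_cong)
      fix t assume "t \<in> space (product_lebesgue D u)"
      then have t: "t \<in> extensional u" "\<And>j. j \<in> u \<Longrightarrow> t j \<in> D"
        by (auto simp: product_lebesgue_def space_PiM PiE_def)
      have "indicator (Pi\<^sub>E u A) t = (\<Prod>j\<in>u. indicator (A j) (t j) :: ennreal)"
        by (rule indicator_PiE[OF u t(1)])
      then show "ennreal (\<Prod>j\<in>u. \<psi> (t j)) * indicator (Pi\<^sub>E u A) t =
          (\<Prod>j\<in>u. ennreal (\<psi> (t j)) * indicator (A j) (t j))"
        using t(2) psi_nonneg by (simp add: prod.distrib prod_ennreal)
    qed
    also have "\<dots> = (\<Prod>j\<in>u. \<integral>\<^sup>+t. ennreal (\<psi> t) * indicator (A j) t \<partial>Leb)"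
      unfolding product_lebesgue_def
      using A' by (intro M.product_nn_integral_prod[OF u, of "\<lambda>j t. ennreal (\<psi> t) * indicator (A j) t"]) auto
    also have "\<dots> = (\<Prod>i\<in>u. emeasure \<mu> (A i))"
      unfolding \<mu>_def using A' by (intro prod.cong refl) (simp add: emeasure_density)
    finally show "emeasure (weighted_measure D \<psi> u) (Pi\<^sub>E u A) = (\<Prod>i\<in>u. emeasure \<mu> (A i))" .
  qed
qed

text \<open>The density is absorbed into the kernels: it suffices that k \<psi> = K almost
  everywhere in each coordinate. Truncated, bounded kernels may therefore replace the original
  ones.\<close>

lemma integral_product_lebesgue:
  fixes g :: "(nat \<Rightarrow> real) \<Rightarrow> complex"
  assumes u: "finite u" and g: "g \<in> borel_measurable (Pr u)"
    and k: "\<And>j. j \<in> u \<Longrightarrow> k j \<in> borel_measurable Leb" "\<And>j. j \<in> u \<Longrightarrow> K j \<in> borel_measurable Leb"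
    and eq: "\<And>j. j \<in> u \<Longrightarrow> AE t in Leb. k j t * \<psi> t = K j t"
  shows "(LINT t|product_lebesgue D u. g t * of_real (\<Prod>j\<in>u. K j (t j))) =
    (LINT t|Pr u. g t * of_real (\<Prod>j\<in>u. k j (t j)))"
proof -
  interpret M: product_sigma_finite "\<lambda>_::nat. Leb" by (rule product_lebesgue_sigma)
  have "sets (Pr u) = sets (product_lebesgue D u)"
    unfolding product_lebesgue_def by (intro sets_PiM_cong) auto
  then have gm: "g \<in> borel_measurable (product_lebesgue D u)"
    using g by (simp cong: measurable_cong_sets)
  have pm: "(\<lambda>t. \<Prod>j\<in>u. f j (t j)) \<in> borel_measurable (product_lebesgue D u)"
    if "\<And>j. j \<in> u \<Longrightarrow> f j \<in> borel_measurable Leb" for f :: "nat \<Rightarrow> real \<Rightarrow> real"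
    unfolding product_lebesgue_def
  proof (rule borel_measurable_prod)
    fix j assume j: "j \<in> u"
    show "(\<lambda>t. f j (t j)) \<in> borel_measurable (Pi\<^sub>M u (\<lambda>_. Leb))"
      by (rule measurable_compose[OF measurable_component_singleton[OF j] that[OF j]])
  qed
  have m: "(\<lambda>t. g t * of_real (\<Prod>j\<in>u. k j (t j))) \<in> borel_measurable (product_lebesgue D u)"
    "(\<lambda>t. g t * of_real (\<Prod>j\<in>u. K j (t j))) \<in> borel_measurable (product_lebesgue D u)"
    by (intro borel_measurable_times[OF gm] measurable_compose[OF pm borel_measurable_of_real] k; assumption)+
  have AEu: "AE t in product_lebesgue D u. \<forall>j\<in>u. k j (t j) * \<psi> (t j) = K j (t j)"
  proof (rule AE_finite_allI[OF u])
    fix j assume j: "j \<in> u"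
    show "AE t in product_lebesgue D u. k j (t j) * \<psi> (t j) = K j (t j)"
      unfolding product_lebesgue_def by (rule M.AE_PiM_coordinate[OF u j]) (rule eq[OF j])
  qed
  have pos: "AE t in product_lebesgue D u. 0 \<le> (\<Prod>j\<in>u. \<psi> (t j))"
    by (rule AE_I2) (auto simp: product_lebesgue_def space_PiM PiE_def Pi_def intro!: prod_nonneg psi_nonneg)
  have "(LINT t|Pr u. g t * of_real (\<Prod>j\<in>u. k j (t j))) =
      (LINT t|product_lebesgue D u. (\<Prod>j\<in>u. \<psi> (t j)) *\<^sub>R (g t * of_real (\<Prod>j\<in>u. k j (t j))))"
    unfolding weighted_measure_eq[OF u, symmetric] weighted_measure_def
    by (rule integral_density[OF m(1) pm[of "\<lambda>_. \<psi>", OF psi] pos])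
  also have "\<dots> = (LINT t|product_lebesgue D u. g t * of_real (\<Prod>j\<in>u. K j (t j)))"
  proof (rule integral_cong_AE)
    show "AE t in product_lebesgue D u. (\<Prod>j\<in>u. \<psi> (t j)) *\<^sub>R (g t * of_real (\<Prod>j\<in>u. k j (t j))) =
        g t * of_real (\<Prod>j\<in>u. K j (t j))"
      using AEu
    proof eventually_elim
      case (elim t)
      then have "(\<Prod>j\<in>u. K j (t j)) = (\<Prod>j\<in>u. \<psi> (t j)) * (\<Prod>j\<in>u. k j (t j))"
        by (simp add: mult.commute flip: prod.distrib)
      then show ?case by (simp only: scaleR_conv_of_real of_real_mult mult.left_commute)
    qed
  qed (intro m borel_measurable_scaleR pm[of "\<lambda>_. \<psi>", OF psi])+
  finally show ?thesis ..
qed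

lemma kernel_measurable: "kernel D \<psi> s y \<in> borel_measurable Leb"
proof -
  have "(\<lambda>t. indicator {0..<y} t :: real) \<in> borel_measurable Leb"
    unfolding indicator_def[abs_def] atLeastLessThan_iff by measurable
  moreover have "kernel D \<psi> Anchored y = (\<lambda>t. indicator {0..<y} t)"
    "kernel D \<psi> Anova y = (\<lambda>t. indicator {0..<y} t - psi_bar D \<psi> t)"
    by (simp_all add: fun_eq_iff)
  ultimately show ?thesis by (cases s) simp_all
qed

lemma T_op_Anchored:
  assumes u: "finite u" and g: "g \<in> borel_measurable (Pr u)" and x: "\<And>j. j \<in> u \<Longrightarrow> x j \<in> D"
  shows "T\<^sub>0 u g x = (LINT t|Pr u. g t * of_real (\<Prod>j\<in>u. \<kappa> (x j) (t j)))"
  unfolding T_op_def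
proof (rule integral_product_lebesgue[OF u g])
  fix j assume "j \<in> u"
  show "\<kappa> (x j) \<in> borel_measurable Leb"
    using kappa_measurable[of "x j"] by (simp cong: measurable_cong_sets)
  show "kernel D \<psi> Anchored (x j) \<in> borel_measurable Leb" by (rule kernel_measurable)
  show "AE t in Leb. \<kappa> (x j) t * \<psi> t = kernel D \<psi> Anchored (x j) t"
    using kappa_psi_AE[OF x[OF \<open>j \<in> u\<close>]] by simp
qed

text \<open>With respect to the weighted measure the ANOVA kernel is \<kappa> + b almost everywhere,
  so the expansion over subsets applies.\<close>

lemma T_op_Anova:
  assumes u: "finite u" and g: "integrable (Pr u) g" and x: "\<And>j. j \<in> u \<Longrightarrow> x j \<in> D"
  shows "T_op D \<psi> Anova u g x = (\<Sum>v\<in>Pow u. T\<^sub>0 v (slice \<mu> b v (u - v) g) x)"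
proof -
  have "T_op D \<psi> Anova u g x = (LINT t|Pr u. g t * of_real (\<Prod>j\<in>u. \<kappa> (x j) (t j) + b (t j)))"
    unfolding T_op_def
  proof (rule integral_product_lebesgue[OF u borel_measurable_integrable[OF g]])
    fix j assume "j \<in> u"
    show "(\<lambda>t. \<kappa> (x j) t + b t) \<in> borel_measurable Leb"
      using borel_measurable_add[OF kappa_measurable[of "x j"] b_measurable]
      by (simp cong: measurable_cong_sets)
    show "kernel D \<psi> Anova (x j) \<in> borel_measurable Leb" by (rule kernel_measurable)
    show "AE t in Leb. (\<kappa> (x j) t + b t) * \<psi> t = kernel D \<psi> Anova (x j) t"
      using kappa_psi_AE[OF x[OF \<open>j \<in> u\<close>]] b_AE by eventually_elim (simp add: distrib_right)
  qed
  also have "\<dots> = (\<Sum>v\<in>Pow u. LINT t|Pr v. slice \<mu> b v (u - v) g t * of_real (\<Prod>j\<in>v. \<kappa> (x j) (t j)))"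
  proof (rule integral_prod_add[OF u g])
    show "\<bar>\<kappa> (x j) t\<bar> \<le> (\<Sum>j\<in>u. L (x j))" if "j \<in> u" for j t
      using kappa_bound[OF x[OF that], of t] member_le_sum[OF that, of "\<lambda>j. L (x j)"] L_bound(1) x u by force
  qed measurable
  also have "\<dots> = (\<Sum>v\<in>Pow u. T\<^sub>0 v (slice \<mu> b v (u - v) g) x)"
  proof (rule sum.cong[OF refl])
    fix v assume v: "v \<in> Pow u"
    then have "v \<union> (u - v) = u" by auto
    then have "slice \<mu> b v (u - v) g \<in> borel_measurable (Pr v)"
      using slice_measurable[of g v "u - v"] borel_measurable_integrable[OF g] by simp
    then show "(LINT t|Pr v. slice \<mu> b v (u - v) g t * of_real (\<Prod>j\<in>v. \<kappa> (x j) (t j))) =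
        T\<^sub>0 v (slice \<mu> b v (u - v) g) x"
      using v u x by (intro T_op_Anchored[symmetric]) (auto intro: finite_subset)
  qed
  finally show ?thesis .
qed

text \<open>
  The sets \<open>A\<close> for which \<open>A \<inter> [0, X)\<close> is almost everywhere equal to an interval \<open>[0, x)\<close> form
  a \<open>\<pi>\<close>-system that, unlike the intervals alone, contains the null sets, so that it generates
  the Lebesgue measurable sets and not only the Borel sets.
\<close>

lemma kernel_sets_generate:
  assumes X: "X \<in> D"
  defines "E \<equiv> {A \<in> sets Leb. \<exists>x\<in>D. x \<le> X \<and> (AE t in Leb. t \<in> A \<and> t < X \<longleftrightarrow> t < x)}"
  shows "Int_stable E" "space \<mu> \<in> E" "sets \<mu> = sigma_sets (space \<mu>) E"
    and "\<And>A. A \<in> E \<Longrightarrow> \<exists>x\<in>D. AE t in \<mu>. indicator A t * \<kappa> X t = \<kappa> x t"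
proof -
  show "\<exists>x\<in>D. AE t in \<mu>. indicator A t * \<kappa> X t = \<kappa> x t" if "A \<in> E" for A
  proof -
    obtain x where A: "x \<in> D" "x \<le> X" "AE t in Leb. t \<in> A \<and> t < X \<longleftrightarrow> t < x"
      using \<open>A \<in> E\<close> unfolding E_def by blast
    have "AE t in \<mu>. indicator A t * \<kappa> X t = \<kappa> x t"
      unfolding AE_mu using A(3) kappa_AE[OF A(1)] kappa_AE[OF X]
      by eventually_elim (use A(2) in \<open>auto simp: indicator_def\<close>)
    then show ?thesis using A(1) by blast
  qed
  show "Int_stable E"
  proof (rule Int_stableI)
    fix A B assume "A \<in> E" "B \<in> E"
    then obtain x y where A: "A \<in> sets Leb" "x \<in> D" "x \<le> X" "AE t in Leb. t \<in> A \<and> t < X \<longleftrightarrow> t < x"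
      and B: "B \<in> sets Leb" "y \<in> D" "y \<le> X" "AE t in Leb. t \<in> B \<and> t < X \<longleftrightarrow> t < y"
      unfolding E_def by blast
    have "AE t in Leb. t \<in> A \<inter> B \<and> t < X \<longleftrightarrow> t < min x y" using A(4) B(4) by eventually_elim auto
    moreover have "min x y \<in> D" using A(2) B(2) by (simp add: min_def)
    ultimately show "A \<inter> B \<in> E" using A B unfolding E_def by (auto intro!: bexI[of _ "min x y"])
  qed
  have top: "D \<in> E" using X unfolding E_def by (auto intro!: bexI[of _ X] AE_I2)
  then show "space \<mu> \<in> E" by simp
  have "sets Leb = sigma_sets D E"
  proof (rule sets_lebesgue_on_generated[OF domain(1,2) X domain(5)[OF X]])
    fix x assume x: "x \<in> D" "x \<le> X"
    have "{0..<x} \<in> sets Leb"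
      using domain(2) domain(5)[OF x(1)] by (auto simp: sets_restrict_space_iff)
    moreover have "AE t in Leb. t \<in> {0..<x} \<and> t < X \<longleftrightarrow> t < x" using domain(1) x by (intro AE_I2) auto
    ultimately show "{0..<x} \<in> E" using x unfolding E_def by auto
  next
    fix N assume N: "N \<in> sets Leb" "AE t in Leb. t \<notin> N \<or> X \<le> t"
    \<comment> \<open>Sets negligible below X correspond to the empty interval, x = 0.\<close>
    have "AE t in Leb. t \<in> N \<and> t < X \<longleftrightarrow> t < 0"
      using N(2) AE_space by eventually_elim (use domain(1) in auto)
    then show "N \<in> E" using N(1) domain X unfolding E_def by (auto intro!: bexI[of _ 0])
  qed (use top in \<open>auto simp: E_def\<close>)
  then show "sets \<mu> = sigma_sets (space \<mu>) E" by simp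
qed

text \<open>For fixed X in D the kernel \<kappa>_X is non-zero almost everywhere on [0, X), so g
  vanishes almost everywhere on the box [0, X)^u. Rational X exhaust almost all of D^u, which keeps
  the union of the exceptional sets null.\<close>

lemma T_op_Anchored_injective:
  assumes u: "finite u" and g: "integrable (Pr u) g"
    and z: "\<And>x. (\<And>j. j \<in> u \<Longrightarrow> x j \<in> D) \<Longrightarrow> T\<^sub>0 u g x = 0"
  shows "AE t in Pr u. g t = 0"
proof -
  have X: "AE t in Pr u. (\<forall>j\<in>u. t j < X) \<longrightarrow> g t = 0" if X: "X \<in> D" for X
  proof -
    have "AE t in Pr u. g t * of_real (\<Prod>j\<in>u. \<kappa> X (t j)) = 0"
    proof (rule product_kernel_injective[where D = D and L = "L X", OF u g X])
      show "(LINT t|Pr u. g t * of_real (\<Prod>j\<in>u. \<kappa> (x j) (t j))) = 0" if "\<And>j. j \<in> u \<Longrightarrow> x j \<in> D" for x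
        using z[OF that] T_op_Anchored[OF u borel_measurable_integrable[OF g] that] by simp
    qed (rule kernel_sets_generate[OF X] kappa_bound[OF X] kappa_measurable | assumption)+
    moreover have "AE t in Pr u. \<forall>j\<in>u. t j < X \<longrightarrow> \<kappa> X (t j) \<noteq> 0"
    proof (rule AE_finite_allI[OF u])
      fix j assume j: "j \<in> u"
      have "AE t in \<mu>. t < X \<longrightarrow> \<kappa> X t \<noteq> 0"
        unfolding AE_mu using kappa_AE[OF X] psi_pos AE_space
        by eventually_elim (use domain(1) in \<open>auto simp: indicator_def\<close>)
      then show "AE t in Pr u. t j < X \<longrightarrow> \<kappa> X (t j) \<noteq> 0" by (rule AE_PiM_component[OF prob_mu j])
    qed
    ultimately show ?thesis by eventually_elim (use u in auto)
  qed
  have "AE t in Pr u. \<forall>X\<in>\<rat> \<inter> D. (\<forall>j\<in>u. t j < X) \<longrightarrow> g t = 0"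
    using X countable_rat by (subst AE_ball_countable) (auto intro: countable_Int1)
  moreover have "AE t in Pr u. \<exists>X\<in>\<rat> \<inter> D. \<forall>j\<in>u. t j < X"
  proof -
    have "AE t in Pr u. \<forall>j\<in>u. \<exists>x\<in>D. t j < x"
    proof (rule AE_finite_allI[OF u])
      fix j assume j: "j \<in> u"
      show "AE t in Pr u. \<exists>x\<in>D. t j < x"
        by (rule AE_PiM_component[OF prob_mu j]) (simp add: AE_mu AE_ex_greater)
    qed
    then show ?thesis
      using AE_space
    proof eventually_elim
      case (elim t)
      show ?case
      proof (cases "u = {}")
        case True
        then show ?thesis using domain(3) by (auto intro!: bexI[of _ 0])
      next
        case False
        define m where "m = Max (t ` u)"
        have "m \<in> t ` u" unfolding m_def using False u by (intro Max_in) auto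
        then obtain x where x: "x \<in> D" "m < x" and m: "m \<in> D" using elim by (auto simp: space_PiM)
        \<comment> \<open>A rational between the largest coordinate and a point x of D lies in D,
          because D contains [0, x).\<close>
        obtain q where q: "q \<in> \<rat>" "m < q" "q < x" using Rats_dense_in_real[OF x(2)] by blast
        have "0 \<le> m" using domain(1) m by auto
        then have "q \<in> D" using domain(5)[OF x(1)] q by auto
        moreover have "t j < q" if "j \<in> u" for j
        proof -
          have "t j \<le> m" unfolding m_def using u that by (intro Max_ge) auto
          then show ?thesis using q(2) by simp
        qed
        ultimately show ?thesis using q(1) by blast
      qed
    qed
  qed
  ultimately show ?thesis by eventually_elim blast
qed

end

context admissible_setting
begin

lemma kernel_integrable:
  assumes u: "finite u" and g: "integrable (Pr u) g" and x: "\<And>j. j \<in> u \<Longrightarrow> x j \<in> D"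
  shows "integrable (Pr u) (\<lambda>t. g t * complex_of_real (\<Prod>j\<in>u. \<kappa> (x j) (t j)))"
proof (rule integrable_mult_bounded[OF g])
  show "\<bar>\<Prod>j\<in>u. \<kappa> (x j) (t j)\<bar> \<le> (\<Prod>j\<in>u. L (x j))" for t
    unfolding abs_prod using kappa_bound x by (intro prod_mono) auto
qed measurable

lemma T_op_Anchored_sum:
  assumes u: "finite u" and x: "\<And>j. j \<in> u \<Longrightarrow> x j \<in> D"
    and S: "finite S" and f: "\<And>i. i \<in> S \<Longrightarrow> integrable (Pr u) (f i)"
  shows "T\<^sub>0 u (\<lambda>t. \<Sum>i\<in>S. f i t) x = (\<Sum>i\<in>S. T\<^sub>0 u (f i) x)"
proof -
  have "T\<^sub>0 u (\<lambda>t. \<Sum>i\<in>S. f i t) x =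
      (LINT t|Pr u. (\<Sum>i\<in>S. f i t * complex_of_real (\<Prod>j\<in>u. \<kappa> (x j) (t j))))"
    using f by (subst T_op_Anchored[OF u _ x]) (auto simp: sum_distrib_right intro!: borel_measurable_sum)
  also have "\<dots> = (\<Sum>i\<in>S. LINT t|Pr u. f i t * complex_of_real (\<Prod>j\<in>u. \<kappa> (x j) (t j)))"
    by (rule Bochner_Integration.integral_sum) (rule kernel_integrable[OF u f x])
  also have "\<dots> = (\<Sum>i\<in>S. T\<^sub>0 u (f i) x)"
    using f by (intro sum.cong refl T_op_Anchored[OF u _ x, symmetric]) auto
  finally show ?thesis .
qed

lemma T_op_Anchored_diff:
  assumes u: "finite u" and x: "\<And>j. j \<in> u \<Longrightarrow> x j \<in> D"
    and f: "integrable (Pr u) f" and g: "integrable (Pr u) g"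
  shows "T\<^sub>0 u (\<lambda>t. f t - g t) x = T\<^sub>0 u f x - T\<^sub>0 u g x"
  using T_op_Anchored[OF u _ x, of f] T_op_Anchored[OF u _ x, of g] T_op_Anchored[OF u _ x, of "\<lambda>t. f t - g t"]
    kernel_integrable[OF u f x] kernel_integrable[OF u g x] f g
  by (simp add: left_diff_distrib borel_measurable_diff)

end

section \<open>Uniqueness of coefficients and norms of the weighted spaces\<close>

locale weighted_setting = admissible_setting +
  fixes d :: nat and \<gamma> :: "nat set \<Rightarrow> real"
  assumes nonzero: "\<exists>u. u \<subseteq> {1..d} \<and> 0 < \<gamma> u"
    and down: "\<And>u w. w \<subseteq> {1..d} \<Longrightarrow> u \<subseteq> w \<Longrightarrow> 0 < \<gamma> w \<Longrightarrow> 0 < \<gamma> u"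
begin

abbreviation A :: "nat set set" where "A \<equiv> active_sets d \<gamma>"

lemma active: "finite A" "\<And>u. u \<in> A \<Longrightarrow> finite u" "\<And>u. u \<in> A \<Longrightarrow> u \<subseteq> {1..d}" "{} \<in> A"
  "\<And>u v. u \<in> A \<Longrightarrow> v \<subseteq> u \<Longrightarrow> v \<in> A" "\<And>u. u \<in> A \<Longrightarrow> 0 < 1 / \<gamma> u"
proof -
  show "finite A" by (rule finite_subset[of _ "Pow {1..d}"]) (auto simp: active_sets_def)
  show "\<And>u. u \<in> A \<Longrightarrow> finite u" by (auto simp: active_sets_def intro: finite_subset)
  show "{} \<in> A" using nonzero down by (auto simp: active_sets_def)
  show "\<And>u v. u \<in> A \<Longrightarrow> v \<subseteq> u \<Longrightarrow> v \<in> A" using down by (auto simp: active_sets_def)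
qed (auto simp: active_sets_def)

lemma mixed_space_integrable:
  assumes "g \<in> mixed_space A Pr s" "0 \<le> s" "s \<le> 1" "u \<in> A"
  shows "integrable (Pr u) (g u)"
proof -
  interpret U: prob_space "Pr u" by (rule prob_Pr)
  show ?thesis using assms U.Lr_space_integrable[of "g u" s] by (simp add: mixed_space_def)
qed

lemma mixed_space_1:
  assumes g: "g \<in> mixed_space A Pr s" "0 \<le> s" "s \<le> 1"
  shows "g \<in> mixed_space A Pr 1"
  using mixed_space_integrable[OF g] by (auto simp: mixed_space_def Lr_space_pos)

text \<open>Induction on the size of \<open>v\<close>, evaluating at points whose coordinates
  outside \<open>v\<close> are the anchor 0. The kernel at the anchor vanishes, which removes every
  u not contained in v; proper subsets are removed by the induction hypothesis, and injectivity
  applies to the remaining term.\<close>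

lemma anchored_zero:
  assumes g: "g \<in> mixed_space A Pr 1"
    and z: "\<And>x. x \<in> {1..d} \<rightarrow>\<^sub>E D \<Longrightarrow> (\<Sum>u\<in>A. T\<^sub>0 u (g u) x) = 0" and v: "v \<in> A"
  shows "AE t in Pr v. g v t = 0"
  using v
proof (induction "card v" arbitrary: v rule: less_induct)
  case less
  have int: "integrable (Pr u) (g u)" if "u \<in> A" for u
    using mixed_space_integrable[OF g _ _ that] by simp
  show ?case
  proof (rule T_op_Anchored_injective[OF active(2)[OF less.prems] int[OF less.prems]])
    fix x assume x: "\<And>j. j \<in> v \<Longrightarrow> x j \<in> D"
    define y where "y = (\<lambda>j\<in>{1..d}. if j \<in> v then x j else 0)"
    have yD: "y \<in> {1..d} \<rightarrow>\<^sub>E D" using x domain(3) by (auto simp: y_def)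
    have T: "T\<^sub>0 u (g u) y =
        (LINT t|Pr u. g u t * complex_of_real (\<Prod>j\<in>u. \<kappa> (y j) (t j)))" if u: "u \<in> A" for u
      by (rule T_op_Anchored[OF active(2)[OF u] borel_measurable_integrable[OF int[OF u]]]) (use yD active(3)[OF u] in auto)
    have other: "T\<^sub>0 u (g u) y = 0" if u: "u \<in> A" "u \<noteq> v" for u
    proof (cases "u \<subseteq> v")
      case True
      then have "card u < card v" using u active(2)[OF less.prems] by (intro psubset_card_mono) auto
      from less.hyps[OF this u(1)] have "AE t in Pr u. g u t = 0" .
      then have "AE t in Pr u. g u t * complex_of_real (\<Prod>j\<in>u. \<kappa> (y j) (t j)) = 0"
        by eventually_elim simp
      then show ?thesis unfolding T[OF u(1)] by (rule integral_eq_zero_AE)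
    next
      case False
      then obtain j where j: "j \<in> u" "j \<notin> v" by blast
      then have "y j = 0" using active(3)[OF u(1)] by (auto simp: y_def)
      then have "\<kappa> (y j) t = 0" for t by (simp add: \<kappa>_def)
      then have "(\<Prod>j\<in>u. \<kappa> (y j) (t j)) = 0" for t
        using j(1) active(2)[OF u(1)] by (intro prod_zero) auto
      then show ?thesis unfolding T[OF u(1)] by simp
    qed
    have "0 = (\<Sum>u\<in>A. T\<^sub>0 u (g u) y)" using z[OF yD] by simp
    also have "\<dots> = T\<^sub>0 v (g v) y"
      using active(1) less.prems other by (subst sum.remove[of _ v]) auto
    also have "\<dots> = T\<^sub>0 v (g v) x"
    proof -
      have "(\<Prod>j\<in>v. \<kappa> (y j) (t j)) = (\<Prod>j\<in>v. \<kappa> (x j) (t j))" for t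
        using active(3)[OF less.prems] by (intro prod.cong) (auto simp: y_def)
      then show ?thesis
        unfolding T[OF less.prems]
        using T_op_Anchored[OF active(2)[OF less.prems] borel_measurable_integrable[OF int[OF less.prems]] x] by simp
    qed
    finally show "T\<^sub>0 v (g v) x = 0" ..
  qed
qed

text \<open>Exchanging the sums after the expansion over subsets collects the anchored coefficients.
  Closedness of the active sets under subsets makes every occurring v active again.\<close>

lemma synthesis_Anova:
  assumes g: "g \<in> mixed_space A Pr 1"
  shows "synthesis D \<psi> d \<gamma> Anova g = synthesis D \<psi> d \<gamma> Anchored (mix A g)"
  unfolding synthesis_def
proof (rule restrict_ext)
  fix x assume x: "x \<in> {1..d} \<rightarrow>\<^sub>E D"
  have xD: "x j \<in> D" if "u \<in> A" "j \<in> u" for u j using x active(3)[OF that(1)] that(2) by auto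
  have int: "integrable (Pr u) (g u)" if "u \<in> A" for u
    using mixed_space_integrable[OF g _ _ that] by simp
  let ?s = "\<lambda>v u. slice \<mu> b v (u - v) (g u)"
  have sl: "integrable (Pr v) (?s v u)" if u: "u \<in> A" "v \<subseteq> u" for u v
  proof -
    interpret V: prob_space "Pr v" by (rule prob_Pr)
    have vu: "v \<inter> (u - v) = {}" "finite v" "finite (u - v)" "v \<union> (u - v) = u"
      using u active(2)[OF u(1)] by (auto intro: finite_subset)
    have "g u \<in> Lr_space (Pr (v \<union> (u - v))) 1"
      using g u unfolding vu(4) by (simp add: mixed_space_def)
    from Lr_space_slice[OF vu(1-3) this] show ?thesis by (intro V.Lr_space_integrable[of _ 1]) auto
  qed
  have "(\<Sum>u\<in>A. T_op D \<psi> Anova u (g u) x) = (\<Sum>u\<in>A. \<Sum>v\<in>Pow u. T\<^sub>0 v (?s v u) x)"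
    by (intro sum.cong refl T_op_Anova active(2) int xD; assumption)
  also have "\<dots> = (\<Sum>u\<in>A. \<Sum>v\<in>{v \<in> A. v \<subseteq> u}. T\<^sub>0 v (?s v u) x)"
    using active(5) by (intro sum.cong) auto
  also have "\<dots> = (\<Sum>v\<in>A. \<Sum>u\<in>{u \<in> A. v \<subseteq> u}. T\<^sub>0 v (?s v u) x)"
    using active(1) by (rule sum.swap_restrict[OF active(1)])
  also have "\<dots> = (\<Sum>v\<in>A. T\<^sub>0 v (mix A g v) x)"
  proof (rule sum.cong[OF refl])
    fix v assume v: "v \<in> A"
    have "mix A g v = (\<lambda>t. \<Sum>u\<in>{u \<in> A. v \<subseteq> u}. ?s v u t)" by (simp add: mix_def fun_eq_iff)
    then show "(\<Sum>u\<in>{u \<in> A. v \<subseteq> u}. T\<^sub>0 v (?s v u) x) = T\<^sub>0 v (mix A g v) x"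
      using T_op_Anchored_sum[OF active(2)[OF v] xD[OF v], where S = "{u \<in> A. v \<subseteq> u}" and f = "?s v"] active(1) sl
      by simp
  qed
  finally show "(\<Sum>u\<in>A. T_op D \<psi> Anova u (g u) x) = (\<Sum>v\<in>A. T\<^sub>0 v (mix A g v) x)" .
qed

lemma anchored_unique:
  assumes g: "g \<in> mixed_space A Pr 1" and h: "h \<in> mixed_space A Pr 1"
    and eq: "synthesis D \<psi> d \<gamma> Anchored g = synthesis D \<psi> d \<gamma> Anchored h" and v: "v \<in> A"
  shows "AE t in Pr v. g v t = h v t"
proof -
  let ?k = "\<lambda>u t. g u t - h u t"
  have k: "?k \<in> mixed_space A Pr 1" using mixed_space_add_cmult[OF h g, of "-1"] by simp
  have "AE t in Pr v. ?k v t = 0"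
  proof (rule anchored_zero[OF k _ v])
    fix x assume x: "x \<in> {1..d} \<rightarrow>\<^sub>E D"
    have "(\<Sum>u\<in>A. T\<^sub>0 u (?k u) x) =
        (\<Sum>u\<in>A. T\<^sub>0 u (g u) x - T\<^sub>0 u (h u) x)"
    proof (rule sum.cong[OF refl])
      fix u assume u: "u \<in> A"
      show "T\<^sub>0 u (?k u) x = T\<^sub>0 u (g u) x - T\<^sub>0 u (h u) x"
        by (rule T_op_Anchored_diff[OF active(2)[OF u]])
           (use x active(3)[OF u] mixed_space_integrable[OF g _ _ u] mixed_space_integrable[OF h _ _ u] in auto)
    qed
    also have "\<dots> = 0" using fun_cong[OF eq, of x] x by (simp add: synthesis_def sum_subtractf)
    finally show "(\<Sum>u\<in>A. T\<^sub>0 u (?k u) x) = 0" .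
  qed
  then show ?thesis by simp
qed

lemma synthesis_unique:
  assumes g: "g \<in> mixed_space A Pr 1" and h: "h \<in> mixed_space A Pr 1"
    and eq: "synthesis D \<psi> d \<gamma> s g = synthesis D \<psi> d \<gamma> s h" and v: "v \<in> A"
  shows "AE t in Pr v. g v t = h v t"
proof (cases s)
  case Anchored
  then show ?thesis using anchored_unique[OF g h _ v] eq by simp
next
  case Anova
  let ?k = "\<lambda>u t. g u t - h u t"
  have k: "?k \<in> mixed_space A Pr 1" using mixed_space_add_cmult[OF h g, of "-1"] by simp
  have M: "mix A f \<in> mixed_space A Pr 1" if "f \<in> mixed_space A Pr 1" for f
    by (rule mix_space[OF active(1,2) _ _ that]) auto
  have "AE t in Pr v. ?k v t = 0"
  proof (rule mix_triangular[OF active(1,2) k _ v])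
    fix v assume v: "v \<in> A"
    have "AE t in Pr v. mix A g v t = mix A h v t"
      using eq Anova by (intro anchored_unique[OF M[OF g] M[OF h] _ v]) (simp add: synthesis_Anova g h)
    moreover have "AE t in Pr v. mix A ?k v t = (-1) * mix A h v t + mix A g v t"
      by (rule almost_linearD[OF almost_linear_mix[OF active(1,2)] h g k _ v]) auto
    ultimately show "AE t in Pr v. mix A ?k v t = 0" by eventually_elim simp
  qed auto
  then show ?thesis by simp
qed

abbreviation N :: "real \<Rightarrow> real \<Rightarrow> (nat set \<Rightarrow> (nat \<Rightarrow> real) \<Rightarrow> complex) \<Rightarrow> real" where
  "N \<equiv> mixed_norm A Pr (\<lambda>u. 1 / \<gamma> u)"

lemma coefficients_eq: "coefficients D \<psi> d \<gamma> (inverse (ennreal s)) = mixed_space A Pr s"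
  using weighted_measure_eq[OF active(2)] by (auto simp: coefficients_def mixed_space_def Lr_space_def)

lemma coefficient_norm_eq:
  assumes r: "0 \<le> r"
  shows "coefficient_norm D \<psi> d \<gamma> (inverse (ennreal s)) (inverse (ennreal r)) g = N s r g"
proof -
  let ?a = "\<lambda>u. Lp_norm (weighted_measure D \<psi> u) (inverse (ennreal s)) (g u) / \<gamma> u"
  let ?b = "\<lambda>u. 1 / \<gamma> u * Lr_norm (Pr u) s (g u)"
  have ab: "?a u = ?b u" "0 \<le> ?b u" "norm (?b u) = ?b u" if "u \<in> A" for u
  proof -
    show "?a u = ?b u" using weighted_measure_eq[OF active(2)[OF that]] by (simp add: Lr_norm_def)
    show "0 \<le> ?b u" by (intro mult_nonneg_nonneg less_imp_le[OF active(6)[OF that]] Lr_norm_nonneg)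
    then show "norm (?b u) = ?b u" unfolding real_norm_def by (rule abs_of_nonneg)
  qed
  show ?thesis
  proof (cases "r = 0")
    case True
    have "Max (?a ` A) = Max (?b ` A)" using ab by (intro arg_cong[where f = Max] image_cong) auto
    also have "\<dots> = N s 0 g"
    proof (rule antisym)
      have "\<forall>u\<in>A. norm (?b u) \<le> N s 0 g"
        using Lr_norm_zero_AE[OF Lr_space_count_space[OF active(1), of 0 ?b]]
        unfolding AE_count_space mixed_norm_def by simp
      then have "\<forall>u\<in>A. ?b u \<le> N s 0 g" using ab(3) by (metis (no_types, lifting))
      then show "Max (?b ` A) \<le> N s 0 g" using active(1,4) by (intro Max.boundedI) auto
      have "?b {} \<le> Max (?b ` A)" using active(1,4) by (intro Max_ge) auto
      then have "0 \<le> Max (?b ` A)" using ab(2)[OF active(4)] by linarith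
      moreover have "norm (?b u) \<le> Max (?b ` A)" if "u \<in> A" for u
        unfolding ab(3)[OF that] using that active(1) by (intro Max_ge) auto
      ultimately show "N s 0 g \<le> Max (?b ` A)"
        unfolding mixed_norm_def by (intro Lr_norm_zero_le) (auto simp: AE_count_space)
    qed
    finally show ?thesis using True by (simp add: coefficient_norm_def)
  next
    case False
    with r have r0: "0 < r" by simp
    have "(\<Sum>u\<in>A. ?a u powr (1 / r)) = (\<Sum>u\<in>A. norm (?b u) powr (1 / r))"
      using ab(1,3) by (intro sum.cong refl) (simp only:)
    then show ?thesis
      using r0 active(1)
      by (simp add: coefficient_norm_def mixed_norm_def Lr_norm_pos lebesgue_integral_count_space_finite
          inverse_ennreal inverse_eq_divide)
  qed
qed

text \<open>Two coefficient families of the same function agree almost everywhere and so have equal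
  norms, which gives the definite description in \<open>W_norm\<close> its value.\<close>

lemma W_norm_synthesis:
  assumes g: "g \<in> mixed_space A Pr s" and s: "0 \<le> s" "s \<le> 1" and r: "0 \<le> r"
  shows "W_norm D \<psi> d \<gamma> k (inverse (ennreal s)) (inverse (ennreal r)) (synthesis D \<psi> d \<gamma> k g) = N s r g"
  unfolding W_norm_def coefficients_eq coefficient_norm_eq[OF r]
proof (rule the_equality)
  show "\<exists>h\<in>mixed_space A Pr s. synthesis D \<psi> d \<gamma> k g = synthesis D \<psi> d \<gamma> k h \<and> N s r g = N s r h"
    using g by blast
  fix x assume "\<exists>h\<in>mixed_space A Pr s. synthesis D \<psi> d \<gamma> k g = synthesis D \<psi> d \<gamma> k h \<and> x = N s r h"
  then obtain h where h: "h \<in> mixed_space A Pr s" "synthesis D \<psi> d \<gamma> k g = synthesis D \<psi> d \<gamma> k h" "x = N s r h"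
    by blast
  have "AE t in Pr u. cmod (h u t) = 1 * cmod (g u t)" if u: "u \<in> A" for u
    using synthesis_unique[OF mixed_space_1[OF g s] mixed_space_1[OF h(1) s] h(2) u] by eventually_elim simp
  moreover have "h u \<in> borel_measurable (Pr u)" if "u \<in> A" for u
    using h(1) that by (auto simp: mixed_space_def dest: Lr_space_measurable)
  ultimately have "N s r h = 1 * N s r g"
    by (intro mixed_norm_cmult[OF active(1) s(1) r _ less_imp_le[OF active(6)] g]) auto
  then show "x = N s r g" using h(3) by simp
qed

section \<open>The norm of the embedding\<close>

abbreviation emb :: "real \<Rightarrow> real \<Rightarrow> real" where
  "emb s r \<equiv> embedding_norm D \<psi> d \<gamma> (inverse (ennreal s)) (inverse (ennreal r))"

text \<open>From here on the function spaces disappear: only the operator \<open>mix\<close> on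
  coefficient families remains.\<close>

lemma emb_eq:
  assumes s: "0 \<le> s" "s \<le> 1" and r: "0 \<le> r"
  shows "emb s r = (SUP g\<in>mixed_space A Pr s. N s r (mix A g) / N s r g)"
proof -
  have "W_norm D \<psi> d \<gamma> Anchored (inverse (ennreal s)) (inverse (ennreal r)) (synthesis D \<psi> d \<gamma> Anova g) = N s r (mix A g)"
    if g: "g \<in> mixed_space A Pr s" for g
    unfolding synthesis_Anova[OF mixed_space_1[OF g s]]
    by (rule W_norm_synthesis[OF mix_space[OF active(1,2) s g] s r])
  then show ?thesis
    unfolding embedding_norm_def W_space_def coefficients_eq image_image
    using W_norm_synthesis[OF _ s r, of _ Anova] by (intro SUP_cong) auto
qed

text \<open>The finite constant makes the supremum that defines the embedding norm one over a set
  bounded above, and it is the a priori bound for the interpolation theorem.\<close>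

lemma mix_bounded:
  assumes s: "0 \<le> s" "s \<le> 1" and r: "0 \<le> r" "r \<le> 1"
  obtains C where "0 \<le> C" "\<And>g. g \<in> mixed_space A Pr s \<Longrightarrow> N s r (mix A g) \<le> C * N s r g"
proof -
  let ?K = "max 1 c ^ card (\<Union>A)"
  let ?C = "?K * Lr_norm (count_space A) (1 - r) (\<lambda>u. 1 / (1 / \<gamma> u)) * Lr_norm (count_space A) r (\<lambda>u. 1 / \<gamma> u)"
  have K: "0 \<le> ?K" by simp
  show ?thesis
  proof (rule that[of ?C])
    show "0 \<le> ?C" by simp
    fix g assume g: "g \<in> mixed_space A Pr s"
    show "N s r (mix A g) \<le> ?C * N s r g"
      by (rule mixed_norm_bounded[OF active(1) r active(6) K Lr_norm_mix[OF active(1,2) s g]])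
  qed
qed

lemma emb_upper:
  assumes s: "0 \<le> s" "s \<le> 1" and r: "0 \<le> r" "r \<le> 1" and g: "g \<in> mixed_space A Pr s"
  shows "N s r (mix A g) \<le> emb s r * N s r g"
proof -
  obtain C where C: "0 \<le> C" "\<And>g. g \<in> mixed_space A Pr s \<Longrightarrow> N s r (mix A g) \<le> C * N s r g"
    by (rule mix_bounded[OF s r]) (rule that)
  show ?thesis
  proof (cases "N s r g = 0")
    \<comment> \<open>For norm 0 the quotient is 0 by convention and carries no information, so the
      crude bound is used.\<close>
    case True
    then show ?thesis using C(2)[OF g] by simp
  next
    case False
    then have pos: "0 < N s r g" by (simp add: less_le)
    have "N s r (mix A g) / N s r g \<le> emb s r"
      unfolding emb_eq[OF s r(1)]
    proof (rule cSUP_upper[OF g])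
      have "N s r (mix A h) / N s r h \<le> C" if "h \<in> mixed_space A Pr s" for h
        using C(1) C(2)[OF that] mixed_norm_nonneg[of A Pr _ s r h]
        by (cases "N s r h = 0") (auto simp: pos_divide_le_eq less_le)
      then show "bdd_above ((\<lambda>g. N s r (mix A g) / N s r g) ` mixed_space A Pr s)"
        by (intro bdd_aboveI[of _ C]) auto
    qed
    then show ?thesis using pos by (simp add: pos_divide_le_eq)
  qed
qed

lemma emb_least:
  assumes s: "0 \<le> s" "s \<le> 1" and r: "0 \<le> r" and B: "0 \<le> B"
    and le: "\<And>g. g \<in> mixed_space A Pr s \<Longrightarrow> N s r (mix A g) \<le> B * N s r g"
  shows "emb s r \<le> B"
  unfolding emb_eq[OF s r]
proof (rule cSUP_least)
  have "(\<lambda>u t. 0) \<in> mixed_space A Pr s" using s by (auto simp: mixed_space_def intro: Lr_norm_0_AE)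
  then show "mixed_space A Pr s \<noteq> {}" by blast
  fix g assume "g \<in> mixed_space A Pr s"
  then show "N s r (mix A g) / N s r g \<le> B"
    using B le mixed_norm_nonneg[of A Pr _ s r g]
    by (cases "N s r g = 0") (auto simp: pos_divide_le_eq less_le)
qed

text \<open>The embedding fixes constants: the family that is 1 at the empty set and 0 elsewhere is
  mapped to itself. Positive endpoint norms are required by the three lines theorem and for \<theta>
  \<in> {0, 1}, where a power with exponent 0 equals 1 only for a non-zero base.\<close>

lemma emb_ge_1:
  assumes s: "0 \<le> s" "s \<le> 1" and r: "0 \<le> r" "r \<le> 1"
  shows "1 \<le> emb s r"
proof -
  define g :: "nat set \<Rightarrow> (nat \<Rightarrow> real) \<Rightarrow> complex" where "g u t = (if u = {} then 1 else 0)" for u t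
  have gL: "g u \<in> Lr_space (Pr u) s" for u
  proof -
    interpret U: prob_space "Pr u" by (rule prob_Pr)
    have "g u = (\<lambda>_. if u = {} then 1 else 0)" by (simp add: g_def fun_eq_iff)
    then show ?thesis using s by (intro U.Lr_space_bounded[where C = 1]) auto
  qed
  then have g: "g \<in> mixed_space A Pr s" by (simp add: mixed_space_def)
  have "mix A g v t = g v t" for v t
  proof -
    have "mix A g v t = (\<Sum>u\<in>{u \<in> A. v \<subseteq> u}. if u = {} then g v t else 0)"
      unfolding mix_def
    proof (rule sum.cong[OF refl])
      fix u assume u: "u \<in> {u \<in> A. v \<subseteq> u}"
      show "slice \<mu> b v (u - v) (g u) t = (if u = {} then g v t else 0)"
        using u by (auto simp: slice_def g_def PiM_empty lebesgue_integral_count_space_finite)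
    qed
    also have "\<dots> = (if v = {} then g v t else 0)" using active(1,4) by (auto simp: sum.delta)
    also have "\<dots> = g v t" by (simp add: g_def)
    finally show ?thesis .
  qed
  then have "mix A g = g" by (simp add: fun_eq_iff)
  with emb_upper[OF s r g] have le: "N s r g \<le> emb s r * N s r g" by simp
  have "N s r g \<noteq> 0"
  proof
    assume "N s r g = 0"
    then have "AE u in count_space A. 1 / \<gamma> u * Lr_norm (Pr u) s (g u) = 0"
      unfolding mixed_norm_def by (intro Lr_norm_eq_0_AE[OF Lr_space_count_space]) (use active(1) r in auto)
    then have "Lr_norm (Pr {}) s (g {}) = 0"
      using active(4) active(6)[OF active(4)] by (auto simp: AE_count_space)
    then have AE0: "AE t in Pr {}. g {} t = 0" by (intro Lr_norm_eq_0_AE[OF gL s(1)])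
    interpret P: prob_space "Pr {}" by (rule prob_Pr)
    show False using AE0 by (simp add: g_def)
  qed
  then have "0 < N s r g" by (simp add: less_le)
  with le show ?thesis by simp
qed

lemma emb_interpolation:
  assumes s0: "0 \<le> s0" "s0 \<le> 1" and r0: "0 \<le> r0" "r0 \<le> 1"
    and s1: "0 \<le> s1" "s1 \<le> 1" and r1: "0 \<le> r1" "r1 \<le> 1"
    and \<theta>: "0 \<le> \<theta>" "\<theta> \<le> 1"
    and s: "s = (1 - \<theta>) * s0 + \<theta> * s1" and r: "r = (1 - \<theta>) * r0 + \<theta> * r1"
  shows "emb s r \<le> emb s0 r0 powr (1 - \<theta>) * emb s1 r1 powr \<theta>"
proof -
  have e: "1 \<le> emb s0 r0" "1 \<le> emb s1 r1" using emb_ge_1 s0 r0 s1 r1 by auto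
  consider "\<theta> = 0" | "\<theta> = 1" | "0 < \<theta>" "\<theta> < 1" using \<theta> by fastforce
  then show ?thesis
  proof cases
    case 1
    then show ?thesis using e s r by simp
  next
    case 2
    then show ?thesis using e s r by simp
  next
    case 3
    have sr: "0 \<le> s" "s \<le> 1" "0 \<le> r" "r \<le> 1"
      using convex_combination_unit[OF s0 s1 \<theta>] convex_combination_unit[OF r0 r1 \<theta>] by (simp_all add: s r)
    obtain C where C: "0 \<le> C" "\<And>g. g \<in> mixed_space A Pr s \<Longrightarrow> N s r (mix A g) \<le> C * N s r g"
      by (rule mix_bounded[OF sr]) (rule that)
    have fin: "finite_measure (Pr u)" for u :: "nat set"
      using prob_Pr by (rule prob_space.finite_measure)
    have setting: "interpolation_setting A Pr (\<lambda>u. 1 / \<gamma> u) (mix A) s0 r0 s1 r1 s r \<theta> (emb s0 r0) (emb s1 r1)"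
      by (rule interpolation_setting.intro[OF active(1) fin active(6) almost_linear_mix[OF active(1,2)] s0 r0 s1 r1 3 s r
            mix_space[OF active(1,2) s0] emb_upper[OF s0 r0] mix_space[OF active(1,2) s1] emb_upper[OF s1 r1]])
         (use e in auto)
    show ?thesis
    proof (rule emb_least[OF sr(1-3)])
      fix g assume g: "g \<in> mixed_space A Pr s"
      show "N s r (mix A g) \<le> emb s0 r0 powr (1 - \<theta>) * emb s1 r1 powr \<theta> * N s r g"
        by (rule interpolation_setting.riesz_thorin_mixed[OF setting mix_space[OF active(1,2) sr(1,2)] C(2) g])
    qed simp
  qed
qed

end

lemma inverse_exponent:
  assumes "1 \<le> p"
  obtains s where "0 \<le> s" "s \<le> 1" "p = inverse (ennreal s)" "1 / p = ennreal s"
proof (cases p)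
  case (real x)
  then have x: "1 \<le> x" using assms by simp
  then have "p = inverse (ennreal (1 / x))" "1 / p = ennreal (1 / x)"
    using real by (simp_all add: inverse_ennreal divide_ennreal_def inverse_eq_divide)
  with x show ?thesis by (intro that[of "1 / x"]) auto
next
  case top
  then show ?thesis by (intro that[of 0]) (auto simp: divide_ennreal_def)
qed

theorem theorem16:
  fixes D :: "real set" and \<psi> :: "real \<Rightarrow> real" and d :: nat and \<gamma> :: "nat set \<Rightarrow> real"
    and p q p0 q0 p1 q1 :: ennreal and \<theta> :: real
  assumes "admissible_domain D"
    and "positive_density D \<psi>"
    and "integrability_condition D \<psi> 1"
    and "d \<ge> 1"
    and "\<And>u. u \<subseteq> {1..d} \<Longrightarrow> 0 \<le> \<gamma> u"
    and "\<exists>u. u \<subseteq> {1..d} \<and> \<gamma> u \<noteq> 0"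
    and "\<And>u w. w \<subseteq> {1..d} \<Longrightarrow> u \<subseteq> w \<Longrightarrow> 0 < \<gamma> w \<Longrightarrow> 0 < \<gamma> u"
    and "1 \<le> p" "1 \<le> q" "1 \<le> p0" "1 \<le> q0" "1 \<le> p1" "1 \<le> q1"
    and "0 \<le> \<theta>" "\<theta> \<le> 1"
    and "1 / p = ennreal (1 - \<theta>) / p0 + ennreal \<theta> / p1"
    and "1 / q = ennreal (1 - \<theta>) / q0 + ennreal \<theta> / q1"
  shows "embedding_norm D \<psi> d \<gamma> p q
    \<le> embedding_norm D \<psi> d \<gamma> p0 q0 powr (1 - \<theta>) * embedding_norm D \<psi> d \<gamma> p1 q1 powr \<theta>"
proof -
  have "\<exists>u. u \<subseteq> {1..d} \<and> 0 < \<gamma> u" using assms(5,6) by (auto simp: less_le)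
  then interpret weighted_setting D \<psi> d \<gamma> using assms(1-3,7) by unfold_locales auto
  \<comment> \<open>All reciprocals are finite, so the exponent relation descends from extended to
    real numbers.\<close>
  have interp: "s = (1 - \<theta>) * s0 + \<theta> * s1"
    if "1 / a = ennreal (1 - \<theta>) / a0 + ennreal \<theta> / a1" "1 / a = ennreal s" "1 / a0 = ennreal s0"
      "1 / a1 = ennreal s1" "0 \<le> s" "0 \<le> s0" "0 \<le> s1" for a a0 a1 :: ennreal and s s0 s1
  proof -
    have "ennreal s = ennreal (1 - \<theta>) * ennreal s0 + ennreal \<theta> * ennreal s1"
      using that(1-4) by (metis ennreal_times_divide mult.right_neutral)
    also have "\<dots> = ennreal ((1 - \<theta>) * s0 + \<theta> * s1)"
      using that(5-) assms(14,15) by (simp add: ennreal_mult'' ennreal_plus)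
    finally show ?thesis using that(5-) assms(14,15) by (subst (asm) ennreal_inj) auto
  qed
  obtain s where s: "0 \<le> s" "s \<le> 1" "p = inverse (ennreal s)" "1 / p = ennreal s"
    using inverse_exponent[OF assms(8)] .
  obtain r where r: "0 \<le> r" "r \<le> 1" "q = inverse (ennreal r)" "1 / q = ennreal r"
    using inverse_exponent[OF assms(9)] .
  obtain s0 where s0: "0 \<le> s0" "s0 \<le> 1" "p0 = inverse (ennreal s0)" "1 / p0 = ennreal s0"
    using inverse_exponent[OF assms(10)] .
  obtain r0 where r0: "0 \<le> r0" "r0 \<le> 1" "q0 = inverse (ennreal r0)" "1 / q0 = ennreal r0"
    using inverse_exponent[OF assms(11)] .
  obtain s1 where s1: "0 \<le> s1" "s1 \<le> 1" "p1 = inverse (ennreal s1)" "1 / p1 = ennreal s1"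
    using inverse_exponent[OF assms(12)] .
  obtain r1 where r1: "0 \<le> r1" "r1 \<le> 1" "q1 = inverse (ennreal r1)" "1 / q1 = ennreal r1"
    using inverse_exponent[OF assms(13)] .
  show ?thesis
    unfolding s(3) r(3) s0(3) r0(3) s1(3) r1(3)
    by (rule emb_interpolation[OF s0(1,2) r0(1,2) s1(1,2) r1(1,2) assms(14,15)
        interp[OF assms(16) s(4) s0(4) s1(4) s(1) s0(1) s1(1)]
        interp[OF assms(17) r(4) r0(4) r1(4) r(1) r0(1) r1(1)]])
qed

end
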